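(* Let $d\ge 1$ and let $k$ be a positive integer with $k\le 2d$. Consider the constrained-degree percolation model on $\mathbb{L}^d$ with constraint $k$. Let $t\in[0,1)$. If $\theta(t)>0$, then $$\inf_{x,y\in\mathbb{Z}^d}\tau_t(x,y)>0.$$
   Context: $\mathbb{L}^d=(\mathbb{Z}^d,\mathcal{E}^d)$ is the hypercubic lattice with nearest-neighbor edge set $\mathcal{E}^d$. Constrained-degree percolation (CDP) with constraint $k$: let $U=(U_e)_{e\in\mathcal{E}^d}$ (the collection of clocks) be i.i.d. random variables, uniform on $[0,1]$, and let $\mathbb{P}$ be the corresponding product probability measure on $[0,1]^{\mathcal{E}^d}$. At time $0$ all edges are closed. An edge $e=\langle u,v\rangle$ opens at time $U_e$ if, for all $s<U_e$, $$\max\{|\{x\in\mathbb{Z}^d:\langle x,u\rangle\text{ is open at time }s\}|,\ |\{x\in\mathbb{Z}^d:\langle x,v\rangle\text{ is open at time }s\}|\}<k;$$ otherwise it never opens. Once open, an edge remains open. For almost every $U$ this determines the state of every edge at every time. The open clusters at time $t$ are the connected components of the subgraph of $\mathbb{L}^d$ formed by the edges open at time $t$. For $x,y\in\mathbb{Z}^d$, $x\longleftrightarrow y$ at time $t$ means that $x$ and $y$ lie in the same open cluster at time $t$, and $x\longleftrightarrow\infty$ at time $t$ means that the open cluster of $x$ at time $t$ is infinite. Define $\theta(t)=\mathbb{P}(0\longleftrightarrow\infty\text{ at time }t)$ and $\tau_t(x,y)=\mathbb{P}(x\longleftrightarrow y\text{ at time }t)$. *)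

theory Defs
  imports "HOL-Probability.Probability"
begin

text \<open>The lattice \<open>\<int>\<^sup>d\<close> is the type \<open>int ^ 'd\<close>, with \<open>d = CARD('d)\<close>; edges are unordered pairs.\<close>

definition lattice_edges :: "(int ^ 'd) set set" where
  "lattice_edges = {{u, v} | u v. (\<Sum>i\<in>UNIV. \<bar>u $ i - v $ i\<bar>) = 1}"

definition degree_in :: "'a set set \<Rightarrow> 'a \<Rightarrow> nat" where
  "degree_in H v = card {x. {x, v} \<in> H}"

definition connected_in :: "'a set set \<Rightarrow> 'a \<Rightarrow> 'a \<Rightarrow> bool" where
  "connected_in H x y \<longleftrightarrow> (x, y) \<in> {(u, v). {u, v} \<in> H}\<^sup>*"

definition cluster_in :: "'a set set \<Rightarrow> 'a \<Rightarrow> 'a set" where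
  "cluster_in H x = {y. connected_in H x y}"

text \<open>\<open>cdp_evolution k U \<omega>\<close>: the family \<open>\<omega> t\<close> of edges open at time \<open>t\<close> obeys the
  constrained-degree dynamics driven by the clocks \<open>U\<close>. The configuration \<open>\<omega> 0\<close> consists of edges
  with \<open>U e = 0\<close>, so it is empty for almost every \<open>U\<close>.\<close>

definition cdp_evolution ::
  "nat \<Rightarrow> ((int ^ 'd) set \<Rightarrow> real) \<Rightarrow> (real \<Rightarrow> (int ^ 'd) set set) \<Rightarrow> bool" where
  "cdp_evolution k U \<omega> \<longleftrightarrow>
     (\<forall>t. \<omega> t = {e \<in> lattice_edges. U e \<le> t \<and> (\<forall>s < U e. \<forall>v \<in> e. degree_in (\<omega> s) v < k)})"

text \<open>The description is meaningful whenever the evolution exists and is unique, which is the case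
  for almost every \<open>U\<close>: almost surely there is no infinite path of edges along which the clocks
  strictly decrease.\<close>

definition cdp_open :: "nat \<Rightarrow> ((int ^ 'd) set \<Rightarrow> real) \<Rightarrow> real \<Rightarrow> (int ^ 'd) set set" where
  "cdp_open k U = (THE \<omega>. cdp_evolution k U \<omega>)"

text \<open>The completion of the product measure is taken because \<open>cdp_open\<close> is arbitrary on a null set;
  probabilities do not depend on its values there.\<close>

definition clock_law :: "((int ^ 'd) set \<Rightarrow> real) measure" where
  "clock_law = completion (\<Pi>\<^sub>M e\<in>lattice_edges. restrict_space lborel {0..1})"

definition cdp_theta :: "'d::finite itself \<Rightarrow> nat \<Rightarrow> real \<Rightarrow> real" where
  "cdp_theta _ k t =
     measure clock_law {U \<in> space clock_law. infinite (cluster_in (cdp_open k U t) (0 :: int ^ 'd))}"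

definition cdp_tau :: "nat \<Rightarrow> real \<Rightarrow> int ^ 'd \<Rightarrow> int ^ 'd \<Rightarrow> real" where
  "cdp_tau k t x y =
     measure clock_law {U \<in> space clock_law. connected_in (cdp_open k U t) x y}"

end

theory Submission imports Defs begin

text \<open>
  Uniqueness of the infinite cluster is not needed, only that there are at most two of them, and
  neither ergodicity nor positive association is used. Surgery: if in a finite set of edges all
  closed edges get clocks above \<open>t\<close>, then any configuration with degrees at most \<open>k\<close> can be imposed
  in the interior of that set without an effect elsewhere; this costs a factor that depends only on
  the number of edges. If \<open>k \<le> 2\<close>, surgery turns a vertex of an infinite cluster into the endpoint of
  an infinite path; if \<open>k \<ge> 3\<close> and there are three infinite clusters, it creates a trifurcation. Both
  kinds of points would have positive density although a cube contains at most as many of them as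
  it has boundary points. Hence \<open>k \<ge> 3\<close> and there are at most two infinite clusters, so for large
  \<open>n\<close> the cubes of radius \<open>n\<close> around \<open>x\<close> and \<open>y\<close> both meet every infinite cluster with
  probability close to one, uniformly in \<open>x\<close> and \<open>y\<close>. On this event surgery inside the two cubes
  connects \<open>x\<close> to \<open>y\<close>.
\<close>

section \<open>Clusters and simple paths\<close>

text \<open>The obstacle is that closing one edge can let others open, and the change may travel
  along chains of increasing clocks. The fate of an edge depends only on adjacent edges with smaller
  clocks, so it suffices to fence the region: two layers of edges,
  \<open>touch (\<Union> (touch D))\<close>, are controlled, and every edge further out meets, up to
  time \<open>t\<close>, the same open edges with the same clocks. This is why edges open both
  before and after keep their clocks exactly. Opening needs room below \<open>t\<close> and closing
  needs room above, whence \<open>min t (1 - t)\<close>; a further 1/4 per edge pays for a union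
  bound over pairs of old and new patterns, because the new graph may depend on the old one in an
  arbitrary way. The split at \<open>k = 3\<close> is the degree of the centre of a tripod. The
  cubes must meet all infinite clusters rather than one each, since with two clusters they could
  meet different ones; then any infinite cluster serves as a link, and a single event, the existence
  of an infinite cluster, has probability at least \<theta>(t) whatever \<open>x\<close> and
  \<open>y\<close> are.\<close>

lemma connected_in_refl [simp]: "connected_in H x x"
  by (simp add: connected_in_def)

lemma connected_in_sym: "connected_in H x y \<Longrightarrow> connected_in H y x"
proof -
  have "sym ({(u, v). {u, v} \<in> H}\<^sup>*)"
    by (rule sym_rtrancl) (auto simp: sym_def insert_commute)
  then show "connected_in H x y \<Longrightarrow> connected_in H y x"
    unfolding connected_in_def by (auto dest: symD)
qed

lemma connected_in_trans: "connected_in H x y \<Longrightarrow> connected_in H y z \<Longrightarrow> connected_in H x z"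
  unfolding connected_in_def by (rule rtrancl_trans)

lemma connected_in_edge: "{x, y} \<in> H \<Longrightarrow> connected_in H x y"
  unfolding connected_in_def by auto

lemma connected_in_mono: "connected_in H x y \<Longrightarrow> H \<subseteq> K \<Longrightarrow> connected_in K x y"
  using rtrancl_mono[of "{(u, v). {u, v} \<in> H}" "{(u, v). {u, v} \<in> K}"]
  unfolding connected_in_def by auto

lemma connected_in_closed:
  assumes "connected_in H x y" "x \<in> S" "\<And>u v. {u, v} \<in> H \<Longrightarrow> u \<in> S \<Longrightarrow> v \<in> S"
  shows "y \<in> S"
  using assms(1) unfolding connected_in_def
  by (induction rule: rtrancl_induct) (use assms in auto)

lemma connected_in_step: "connected_in H x u \<Longrightarrow> {u, v} \<in> H \<Longrightarrow> connected_in H x v"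
  by (rule connected_in_trans[OF _ connected_in_edge])

lemma mem_cluster_in [simp]: "y \<in> cluster_in H x \<longleftrightarrow> connected_in H x y"
  by (simp add: cluster_in_def)

lemma cluster_in_eq: "connected_in H x y \<Longrightarrow> cluster_in H x = cluster_in H y"
  using connected_in_trans[of H x y] connected_in_trans[OF connected_in_sym, of H x y]
  unfolding cluster_in_def by blast

text \<open>Only edges with both ends in the cluster are compared, so graphs that differ elsewhere
  can be related. This is how deleting vertices is shown to leave a cluster intact.\<close>

lemma cluster_in_subset:
  assumes "\<And>u v. {u, v} \<in> H \<Longrightarrow> connected_in H x u \<Longrightarrow> connected_in H x v \<Longrightarrow> {u, v} \<in> K"
  shows "cluster_in H x \<subseteq> cluster_in K x"
proof
  fix y assume "y \<in> cluster_in H x"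
  then have "(x, y) \<in> {(u, v). {u, v} \<in> H}\<^sup>*"
    by (simp add: connected_in_def)
  then show "y \<in> cluster_in K x"
  proof (induction rule: rtrancl_induct)
    case base
    then show ?case by simp
  next
    case (step y z)
    then have "connected_in H x y" "{y, z} \<in> H"
      by (auto simp: connected_in_def)
    moreover from this have "connected_in H x z"
      by (rule connected_in_step)
    ultimately show ?case
      using step.IH assms[of y z] connected_in_step[of K x y z] by simp
  qed
qed

lemma cluster_in_exits:
  assumes "infinite (cluster_in H a)" "a \<in> S" "finite S"
  obtains u v where "connected_in H a u" "{u, v} \<in> H" "u \<in> S" "v \<notin> S"
proof -
  have "\<exists>u v. connected_in H a u \<and> {u, v} \<in> H \<and> u \<in> S \<and> v \<notin> S"
  proof (rule ccontr)
    assume *: "\<not> ?thesis"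
    have "y \<in> S \<inter> cluster_in H a" if "connected_in H a y" for y
    proof (rule connected_in_closed[OF that])
      fix u v assume "{u, v} \<in> H" "u \<in> S \<inter> cluster_in H a"
      with * connected_in_step[of H a u v] show "v \<in> S \<inter> cluster_in H a"
        by auto
    qed (simp add: assms)
    then have "cluster_in H a \<subseteq> S"
      by (auto simp: cluster_in_def)
    then show False
      using assms finite_subset by blast
  qed
  then show thesis
    using that by blast
qed

section \<open>Paths as lists of vertices, and tripods\<close>

fun path_edges :: "'a list \<Rightarrow> 'a set set" where
  "path_edges (x # y # xs) = insert {x, y} (path_edges (y # xs))"
| "path_edges _ = {}"

lemma path_edges_Cons: "xs \<noteq> [] \<Longrightarrow> path_edges (x # xs) = insert {x, hd xs} (path_edges xs)"
  by (cases xs) auto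

lemma path_edges_append:
  "path_edges (xs @ y # ys) = path_edges (xs @ [y]) \<union> path_edges (y # ys)"
  by (induction xs rule: path_edges.induct) auto

lemma path_edges_rev [simp]: "path_edges (rev xs) = path_edges xs"
proof (induction xs rule: path_edges.induct)
  case (1 x y xs)
  have "path_edges (rev (x # y # xs)) = path_edges (rev xs @ [y]) \<union> path_edges [y, x]"
    using path_edges_append[of "rev xs" y "[x]"] by simp
  then show ?case
    using 1 by (auto simp: insert_commute)
qed auto

lemma path_edges_subset: "e \<in> path_edges xs \<Longrightarrow> e \<subseteq> set xs"
  by (induction xs rule: path_edges.induct) auto

lemma path_edges_connected:
  assumes "path_edges xs \<subseteq> H" "x \<in> set xs" "y \<in> set xs"
  shows "connected_in H x y"
proof -
  have *: "connected_in H (hd xs) z" if "z \<in> set xs" for z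
    using assms(1) that
  proof (induction xs rule: path_edges.induct)
    case (1 a b xs)
    then show ?case
      using connected_in_trans[OF connected_in_edge, of a b H z] by auto
  qed auto
  show ?thesis
    using connected_in_trans[OF connected_in_sym[OF *[OF assms(2)]] *[OF assms(3)]] .
qed

lemma connected_in_path:
  assumes "connected_in H x y"
  obtains xs where "xs \<noteq> []" "hd xs = x" "last xs = y" "distinct xs" "path_edges xs \<subseteq> H"
proof -
  have "\<exists>xs. xs \<noteq> [] \<and> hd xs = x \<and> last xs = y \<and> distinct xs \<and> path_edges xs \<subseteq> H"
    using assms unfolding connected_in_def
  proof (induction rule: converse_rtrancl_induct)
    case base
    show ?case by (rule exI[of _ "[y]"]) simp
  next
    case (step x z)
    then obtain xs where xs: "xs \<noteq> []" "hd xs = z" "last xs = y" "distinct xs" "path_edges xs \<subseteq> H"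
      by blast
    show ?case
    proof (cases "x \<in> set xs")
      case True
      then obtain ys zs where "xs = ys @ x # zs"
        by (meson split_list)
      with xs show ?thesis
        using path_edges_append[of ys x zs] by (intro exI[of _ "x # zs"]) auto
    next
      case False
      with xs step show ?thesis
        by (intro exI[of _ "x # xs"]) (auto simp: path_edges_Cons)
    qed
  qed
  then show ?thesis
    using that by blast
qed

text \<open>Walk from \<open>c\<close> towards \<open>a\<close> on a simple path and stop at the
  first vertex \<open>t\<close> that lies on a simple path from \<open>a\<close> to
  \<open>b\<close>; it exists because \<open>a\<close> itself qualifies. The three pieces then meet
  only in \<open>t\<close>. Arms may be empty, when \<open>t\<close> is one of the three
  tips.\<close>

lemma tripod_exists:
  assumes "connected_in H a b" "connected_in H a c"
  obtains t p q r where "distinct (t # p @ q @ r)"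
    "last (t # p) = a" "last (t # q) = b" "last (t # r) = c"
    "path_edges (t # p) \<union> path_edges (t # q) \<union> path_edges (t # r) \<subseteq> H"
proof -
  obtain xs where xs: "xs \<noteq> []" "hd xs = a" "last xs = b" "distinct xs" "path_edges xs \<subseteq> H"
    using assms(1) by (rule connected_in_path)
  obtain ys where ys: "ys \<noteq> []" "hd ys = c" "last ys = a" "distinct ys" "path_edges ys \<subseteq> H"
    using connected_in_sym[OF assms(2)] by (rule connected_in_path)
  have "\<exists>y\<in>set ys. y \<in> set xs"
    using xs ys by (metis hd_in_set last_in_set)
  from split_list_first_prop[OF this]
  obtain ys1 t ys2 where y: "ys = ys1 @ t # ys2" "t \<in> set xs" "\<forall>y\<in>set ys1. y \<notin> set xs"
    by auto
  obtain xs1 xs2 where x: "xs = xs1 @ t # xs2"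
    using y(2) by (meson split_list)
  show thesis
  proof (rule that[of t "rev xs1" xs2 "rev ys1"])
    show "distinct (t # rev xs1 @ xs2 @ rev ys1)"
      using x y xs ys by auto
    show "last (t # rev xs1) = a"
      using x xs by (cases xs1) auto
    show "last (t # xs2) = b"
      using x xs by auto
    show "last (t # rev ys1) = c"
      using y ys by (cases ys1) auto
    have "path_edges (t # rev zs) = path_edges (zs @ [t])" for zs :: "'a list"
      using path_edges_rev[of "zs @ [t]"] by simp
    then show "path_edges (t # rev xs1) \<union> path_edges (t # xs2) \<union> path_edges (t # rev ys1) \<subseteq> H"
      using x y xs ys path_edges_append[of xs1 t xs2] path_edges_append[of ys1 t ys2] by auto
  qed
qed

section \<open>Degrees in unions of paths\<close>

lemma degree_in_mono: "H \<subseteq> K \<Longrightarrow> finite {x. {x, v} \<in> K} \<Longrightarrow> degree_in H v \<le> degree_in K v"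
  unfolding degree_in_def by (rule card_mono) auto

lemma degree_in_Un: "degree_in (H \<union> K) v \<le> degree_in H v + degree_in K v"
proof -
  have "{x. {x, v} \<in> H \<union> K} = {x. {x, v} \<in> H} \<union> {x. {x, v} \<in> K}" by auto
  then show ?thesis
    unfolding degree_in_def by (metis card_Un_le)
qed

lemma degree_in_doubleton: "degree_in {{x, y}} v \<le> (if v = x \<or> v = y then 1 else 0)"
proof -
  have "{z. {z, v} \<in> {{x, y}}} \<subseteq> (if v = x then {y} else if v = y then {x} else {})"
    by (auto simp: doubleton_eq_iff)
  moreover have "finite (if v = x then {y} else if v = y then {x} else {})"
    by simp
  ultimately have "degree_in {{x, y}} v \<le> card (if v = x then {y} else if v = y then {x} else {})"
    unfolding degree_in_def by (rule card_mono[rotated])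
  also have "\<dots> \<le> (if v = x \<or> v = y then 1 else 0)"
    by simp
  finally show ?thesis .
qed

lemma degree_in_insert: "degree_in (insert {x, y} H) v \<le> degree_in H v + (if v = x \<or> v = y then 1 else 0)"
  using degree_in_Un[of "{{x, y}}" H v] degree_in_doubleton[of x y v] by simp

lemma degree_in_path_edges:
  assumes "distinct xs"
  shows "degree_in (path_edges xs) v \<le> 2" "v = hd xs \<Longrightarrow> degree_in (path_edges xs) v \<le> 1"
    "v \<notin> set xs \<Longrightarrow> degree_in (path_edges xs) v = 0"
proof -
  have "degree_in (path_edges xs) v \<le> 2 \<and> (v = hd xs \<longrightarrow> degree_in (path_edges xs) v \<le> 1) \<and>
     (v \<notin> set xs \<longrightarrow> degree_in (path_edges xs) v = 0)"
    using assms
  proof (induction xs rule: path_edges.induct)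
    case (1 x y xs)
    then show ?case
      using degree_in_insert[of x y "path_edges (y # xs)" v] by (auto split: if_splits)
  qed (auto simp: degree_in_def)
  then show "degree_in (path_edges xs) v \<le> 2" "v = hd xs \<Longrightarrow> degree_in (path_edges xs) v \<le> 1"
    "v \<notin> set xs \<Longrightarrow> degree_in (path_edges xs) v = 0"
    by auto
qed

text \<open>At the centre each arm contributes at most one edge, since \<open>t\<close> is the head
  of its list; any other vertex lies on at most one arm and gets at most two edges. The value 3 at
  the centre is what the constraint has to allow.\<close>

lemma degree_in_tripod:
  assumes "distinct (t # p @ q @ r)"
  shows "degree_in (path_edges (t # p) \<union> path_edges (t # q) \<union> path_edges (t # r)) v \<le> 3"
proof -
  have d: "distinct (t # p)" "distinct (t # q)" "distinct (t # r)"
    using assms by auto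
  have "degree_in (path_edges (t # p) \<union> path_edges (t # q) \<union> path_edges (t # r)) v
     \<le> degree_in (path_edges (t # p)) v + degree_in (path_edges (t # q)) v + degree_in (path_edges (t # r)) v"
    using degree_in_Un[of "path_edges (t # p)" "path_edges (t # q)" v]
      degree_in_Un[of "path_edges (t # p) \<union> path_edges (t # q)" "path_edges (t # r)" v] by linarith
  also have "\<dots> \<le> 3"
  proof (cases "v = t")
    case True
    then show ?thesis
      using d[THEN degree_in_path_edges(2), of v] by simp
  next
    case False
    consider "v \<notin> set p" "v \<notin> set q" | "v \<notin> set p" "v \<notin> set r" | "v \<notin> set q" "v \<notin> set r"
      using assms by auto
    then show ?thesis
      using False d[THEN degree_in_path_edges(1), of v] d[THEN degree_in_path_edges(3), of v]
      by cases auto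
  qed
  finally show ?thesis .
qed

section \<open>Trifurcations and endpoints\<close>

text \<open>Edges are deleted but vertices stay: points of \<open>T\<close> become isolated, so an
  infinite cluster of \<open>avoid H T\<close> cannot meet \<open>T\<close>.\<close>

definition avoid :: "'a set set \<Rightarrow> 'a set \<Rightarrow> 'a set set" where
  "avoid H T = {e \<in> H. e \<inter> T = {}}"

lemma avoid_subset: "avoid H T \<subseteq> H"
  by (auto simp: avoid_def)

lemma cluster_in_avoid_eq:
  assumes "T \<subseteq> T'" "cluster_in (avoid H T) a \<inter> T' = {}"
  shows "cluster_in (avoid H T') a = cluster_in (avoid H T) a"
proof
  show "cluster_in (avoid H T') a \<subseteq> cluster_in (avoid H T) a"
    by (rule cluster_in_subset) (use assms in \<open>auto simp: avoid_def\<close>)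
  show "cluster_in (avoid H T) a \<subseteq> cluster_in (avoid H T') a"
    by (rule cluster_in_subset) (use assms in \<open>auto simp: avoid_def\<close>)
qed

text \<open>Cut a path at its first visit to \<open>t\<close>; the vertex just before is reached
  without using \<open>t\<close>.\<close>

lemma connected_in_last_step:
  assumes "connected_in H s t" "s \<noteq> t"
  obtains a where "{a, t} \<in> H" "connected_in (avoid H {t}) s a"
proof -
  have "t \<in> cluster_in (avoid H {t}) s \<or> (\<exists>a. {a, t} \<in> H \<and> connected_in (avoid H {t}) s a)"
  proof (rule ccontr)
    assume n: "\<not> ?thesis"
    have "t \<in> cluster_in (avoid H {t}) s"
    proof (rule connected_in_closed[OF assms(1)])
      fix u v assume uv: "{u, v} \<in> H" "u \<in> cluster_in (avoid H {t}) s"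
      with n have "u \<noteq> t" "v \<noteq> t"
        by auto
      with uv(1) have "connected_in (avoid H {t}) u v"
        by (intro connected_in_edge) (simp add: avoid_def)
      with uv(2) show "v \<in> cluster_in (avoid H {t}) s"
        by (auto intro: connected_in_trans)
    qed simp
    with n show False by blast
  qed
  moreover have "t \<notin> cluster_in (avoid H {t}) s"
  proof
    assume "t \<in> cluster_in (avoid H {t}) s"
    then have "t \<in> - {t}"
      by (intro connected_in_closed[of "avoid H {t}" s t]) (use assms(2) in \<open>auto simp: avoid_def\<close>)
    then show False by simp
  qed
  ultimately show thesis
    using that by auto
qed

text \<open>The Burton-Keane notion, with any further neighbours or branches allowed. The three
  separation conditions already force \<open>a\<close>, \<open>b\<close>, \<open>c\<close> to be
  distinct.\<close>

definition trifurcation :: "'a set set \<Rightarrow> 'a \<Rightarrow> bool" where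
  "trifurcation H t \<longleftrightarrow> (\<exists>a b c. {a, t} \<in> H \<and> {b, t} \<in> H \<and> {c, t} \<in> H \<and>
     infinite (cluster_in (avoid H {t}) a) \<and> infinite (cluster_in (avoid H {t}) b) \<and>
     infinite (cluster_in (avoid H {t}) c) \<and> \<not> connected_in (avoid H {t}) a b \<and>
     \<not> connected_in (avoid H {t}) a c \<and> \<not> connected_in (avoid H {t}) b c)"

text \<open>Branches are recorded as vertex sets, so a branch adjacent to several points of
  \<open>T\<close> is counted once.\<close>

definition branches :: "'a set set \<Rightarrow> 'a set \<Rightarrow> 'a set set" where
  "branches H T = {C. \<exists>a. \<exists>t\<in>T. {a, t} \<in> H \<and> C = cluster_in (avoid H T) a \<and> infinite C}"

text \<open>Among all pairs of a trifurcation \<open>t \<in> T\<close> and a branch at \<open>t\<close>, one whose branch contains the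
  most points of \<open>T\<close> leaves no point of \<open>T\<close> in the other branches at \<open>t\<close>.\<close>

lemma extremal_trifurcation:
  assumes "finite T" "T \<noteq> {}" "\<forall>t\<in>T. trifurcation H t"
  obtains t a b where "t \<in> T" "{a, t} \<in> H" "{b, t} \<in> H"
    "infinite (cluster_in (avoid H {t}) a)" "infinite (cluster_in (avoid H {t}) b)"
    "cluster_in (avoid H {t}) a \<noteq> cluster_in (avoid H {t}) b"
    "cluster_in (avoid H {t}) a \<inter> T = {}" "cluster_in (avoid H {t}) b \<inter> T = {}"
proof -
  define C where "C = (\<lambda>t. cluster_in (avoid H {t}))"
  define P where "P = (\<lambda>(t, a). t \<in> T \<and> {a, t} \<in> H \<and> infinite (C t a))"
  have "\<exists>z. P z"
    using assms unfolding P_def trifurcation_def C_def by fastforce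
  moreover have bound: "\<forall>y. P y \<longrightarrow> card (C (fst y) (snd y) \<inter> T) < Suc (card T)"
    using assms(1) by (auto intro!: card_mono simp: less_Suc_eq_le)
  ultimately obtain z where z: "P z" "\<And>y. P y \<Longrightarrow> card (C (fst y) (snd y) \<inter> T) \<le> card (C (fst z) (snd z) \<inter> T)"
    using ex_has_greatest_nat[of P _ "\<lambda>y. card (C (fst y) (snd y) \<inter> T)" "Suc (card T)"]
    by metis
  obtain t a0 where ta: "z = (t, a0)" by (cases z)
  have t: "t \<in> T" "{a0, t} \<in> H" "infinite (C t a0)"
    using z(1) by (auto simp: P_def ta)
  \<comment> \<open>Suppose a branch at \<open>t\<close> other than the maximal one contains
    \<open>t'\<close> in \<open>T\<close>. Seen from \<open>t'\<close>, the branch in the direction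
    of \<open>t\<close> contains all of \<open>C t a0\<close> and also \<open>t\<close>, hence more
    points of \<open>T\<close>, against maximality.\<close>
  have key: "C t a \<inter> T = {}" if a: "{a, t} \<in> H" "C t a \<noteq> C t a0" "infinite (C t a)" for a
  proof (rule ccontr)
    assume "C t a \<inter> T \<noteq> {}"
    then obtain t' where t': "t' \<in> T" "connected_in (avoid H {t}) a t'"
      by (auto simp: C_def)
    have t'2: "t' \<notin> C t a0"
      using a(2) cluster_in_eq[OF t'(2)] cluster_in_eq[of "avoid H {t}" a0 t'] by (auto simp: C_def)
    have tt': "t \<noteq> t'"
    proof
      assume "t = t'"
      then have "a = t"
        using connected_in_closed[OF connected_in_sym[OF t'(2)], of "{t}"]
        by (auto simp: avoid_def)
      then have "C t a \<subseteq> {t}"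
        using connected_in_closed[of "avoid H {t}" t _ "{t}"] by (auto simp: C_def avoid_def)
      then show False
        using a(3) finite_subset by auto
    qed
    have "connected_in H t t'"
      using a(1) t'(2) by (metis avoid_subset connected_in_edge connected_in_mono connected_in_sym connected_in_trans)
    then obtain a' where a': "{a', t'} \<in> H" "connected_in (avoid H {t'}) t a'"
      using tt' by (rule connected_in_last_step)
    have "connected_in (avoid H {t'}) a0 t"
      using t(2) tt' t'2 by (intro connected_in_edge) (auto simp: avoid_def C_def)
    then have eq: "C t' a' = C t' a0"
      using cluster_in_eq[OF a'(2)] cluster_in_eq[of "avoid H {t'}" a0 t] unfolding C_def by simp
    have "C t a0 \<subseteq> C t' a0"
      unfolding C_def
      by (rule cluster_in_subset) (use t'2 in \<open>auto simp: avoid_def C_def\<close>)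
    moreover have "t \<in> C t' a0"
      using \<open>connected_in (avoid H {t'}) a0 t\<close> by (simp add: C_def)
    moreover have "t \<notin> C t a0"
    proof
      assume "t \<in> C t a0"
      then have "connected_in (avoid H {t}) t a0"
        by (simp add: C_def connected_in_sym)
      from connected_in_closed[OF this, of "{t}"] have "a0 = t"
        by (auto simp: avoid_def)
      then have "C t a0 \<subseteq> {t}"
        using connected_in_closed[of "avoid H {t}" t _ "{t}"] by (auto simp: C_def avoid_def)
      then show False
        using t(3) finite_subset by auto
    qed
    ultimately have "C t a0 \<inter> T \<subset> C t' a' \<inter> T"
      using t(1) eq by blast
    then have less: "card (C t a0 \<inter> T) < card (C t' a' \<inter> T)"
      using assms(1) by (intro psubset_card_mono) auto
    have "infinite (C t' a')"
      using \<open>C t a0 \<subseteq> C t' a0\<close> t(3) eq finite_subset by auto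
    then have "card (C t' a' \<inter> T) \<le> card (C t a0 \<inter> T)"
      using z(2)[of "(t', a')"] t'(1) a'(1) \<open>infinite (C t' a')\<close> by (simp add: P_def ta)
    with less show False by simp
  qed
  have "trifurcation H t"
    using assms(3) t(1) by blast
  then obtain a b c where "{a, t} \<in> H \<and> {b, t} \<in> H \<and> {c, t} \<in> H \<and>
     infinite (cluster_in (avoid H {t}) a) \<and> infinite (cluster_in (avoid H {t}) b) \<and> infinite (cluster_in (avoid H {t}) c) \<and> \<not> connected_in (avoid H {t}) a b \<and>
     \<not> connected_in (avoid H {t}) a c \<and> \<not> connected_in (avoid H {t}) b c"
    unfolding trifurcation_def by (elim exE) (rule that)
  then have abc: "{a, t} \<in> H" "{b, t} \<in> H" "{c, t} \<in> H"
    "infinite (C t a)" "infinite (C t b)" "infinite (C t c)"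
    "\<not> connected_in (avoid H {t}) a b" "\<not> connected_in (avoid H {t}) a c"
    "\<not> connected_in (avoid H {t}) b c"
    by (simp_all add: C_def)
  have "C t x \<noteq> C t y" if "\<not> connected_in (avoid H {t}) x y" for x y
  proof
    assume "C t x = C t y"
    then have "y \<in> C t x"
      by (simp add: C_def)
    with that show False
      by (simp add: C_def)
  qed
  from abc(7-9)[THEN this] have neq: "C t a \<noteq> C t b" "C t a \<noteq> C t c" "C t b \<noteq> C t c" .
  then consider "C t a \<noteq> C t a0" "C t b \<noteq> C t a0" | "C t a \<noteq> C t a0" "C t c \<noteq> C t a0"
    | "C t b \<noteq> C t a0" "C t c \<noteq> C t a0"
    by argo
  then show thesis
  proof cases
    case 1
    show ?thesis
      by (rule that[OF t(1) abc(1,2,4,5)[unfolded C_def] neq(1)[unfolded C_def]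
            key[OF abc(1) 1(1) abc(4), unfolded C_def] key[OF abc(2) 1(2) abc(5), unfolded C_def]])
  next
    case 2
    show ?thesis
      by (rule that[OF t(1) abc(1,3,4,6)[unfolded C_def] neq(2)[unfolded C_def]
            key[OF abc(1) 2(1) abc(4), unfolded C_def] key[OF abc(3) 2(2) abc(6), unfolded C_def]])
  next
    case 3
    show ?thesis
      by (rule that[OF t(1) abc(2,3,5,6)[unfolded C_def] neq(3)[unfolded C_def]
            key[OF abc(2) 3(1) abc(5), unfolded C_def] key[OF abc(3) 3(2) abc(6), unfolded C_def]])
  qed
qed

lemma isolated_cluster: "s \<in> T \<Longrightarrow> cluster_in (avoid H T) s \<subseteq> {s}"
proof
  fix y assume "s \<in> T" "y \<in> cluster_in (avoid H T) s"
  then have "connected_in (avoid H T) s y" by simp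
  from connected_in_closed[OF this, of "{s}"] show "y \<in> {s}"
    using \<open>s \<in> T\<close> by (auto simp: avoid_def)
qed

lemma infinite_cluster_avoids:
  assumes "infinite (cluster_in (avoid H T) a)"
  shows "cluster_in (avoid H T) a \<inter> T = {}"
proof (rule ccontr)
  assume "\<not> ?thesis"
  then obtain s where s: "s \<in> T" "connected_in (avoid H T) a s"
    by auto
  then have "cluster_in (avoid H T) a \<subseteq> {s}"
    using isolated_cluster cluster_in_eq by metis
  with assms show False
    using finite_subset by blast
qed

text \<open>Induction by adding an extremal trifurcation \<open>t\<close>: deleting its edges
  affects only the one old branch through \<open>t\<close>, while two branches at \<open>t\<close>
  free of \<open>T\<close> are new, so the number grows by at least one. Degrees may be infinite
  here, and \<open>card\<close> of an infinite family would be 0; hence the finite subfamily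
  \<open>F\<close>.\<close>

lemma card_branches:
  assumes "finite T" "\<forall>t\<in>T. trifurcation H t"
  shows "\<exists>F. F \<subseteq> branches H T \<and> finite F \<and> card T \<le> card F"
  using assms
proof (induction "card T" arbitrary: T)
  case 0
  then show ?case by auto
next
  case (Suc n)
  then have "T \<noteq> {}" by auto
  obtain t a b where t: "t \<in> T" and e: "{a, t} \<in> H" "{b, t} \<in> H"
    and inf: "infinite (cluster_in (avoid H {t}) a)" "infinite (cluster_in (avoid H {t}) b)"
    and neq: "cluster_in (avoid H {t}) a \<noteq> cluster_in (avoid H {t}) b"
    and disj: "cluster_in (avoid H {t}) a \<inter> T = {}" "cluster_in (avoid H {t}) b \<inter> T = {}"
    using extremal_trifurcation[OF Suc.prems(1) \<open>T \<noteq> {}\<close> Suc.prems(2)] .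
  define T' where "T' = T - {t}"
  have "n = card T'"
    using Suc.hyps(2) t Suc.prems(1) by (simp add: T'_def)
  from Suc.hyps(1)[OF this] Suc.prems obtain F
    where F: "F \<subseteq> branches H T'" "finite F" "card T' \<le> card F"
    by (auto simp: T'_def)
  \<comment> \<open>\<open>K\<close> is the only cluster that can change when the edges at
    \<open>t\<close> are deleted as well; it is dropped from \<open>F\<close> whether or not it
    belongs to it.\<close>
  define K where "K = cluster_in (avoid H T') t"
  define A where "A = cluster_in (avoid H {t}) a"
  define B where "B = cluster_in (avoid H {t}) b"
  have AB: "A \<in> branches H T" "B \<in> branches H T"
    using t e inf cluster_in_avoid_eq[OF _ disj(1)] cluster_in_avoid_eq[OF _ disj(2)]
    unfolding branches_def A_def B_def by auto
  have rest: "C \<in> branches H T" if CF: "C \<in> F - {K}" for C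
  proof -
    obtain a' t' where C: "t' \<in> T'" "{a', t'} \<in> H" "C = cluster_in (avoid H T') a'" "infinite C"
      using F(1) CF unfolding branches_def by blast
    have "t \<notin> C"
    proof
      assume "t \<in> C"
      then have "C = K"
        unfolding K_def C(3) by (intro cluster_in_eq) simp
      with that show False by simp
    qed
    moreover have "C \<inter> T' = {}"
      using infinite_cluster_avoids[of H T' a'] C by simp
    ultimately have "cluster_in (avoid H T') a' \<inter> T = {}"
      using C(3) by (auto simp: T'_def)
    from cluster_in_avoid_eq[OF _ this] have "cluster_in (avoid H T) a' = C"
      using C(3) by (auto simp: T'_def)
    moreover have "t' \<in> T"
      using C(1) by (simp add: T'_def)
    ultimately show ?thesis
      using C unfolding branches_def by auto
  qed
  \<comment> \<open>Before the deletion, the edge from \<open>x\<close> to \<open>t\<close> places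
    \<open>x\<close> in \<open>K\<close>; so an old branch that contains \<open>x\<close> is
    \<open>K\<close> itself.\<close>
  have new: "cluster_in (avoid H {t}) x \<notin> F - {K}"
    if edge: "{x, t} \<in> H" and disj: "cluster_in (avoid H {t}) x \<inter> T = {}" for x
  proof
    assume C: "cluster_in (avoid H {t}) x \<in> F - {K}"
    with F(1) have "cluster_in (avoid H {t}) x \<in> branches H T'"
      by blast
    then obtain a' where a': "cluster_in (avoid H {t}) x = cluster_in (avoid H T') a'"
      unfolding branches_def mem_Collect_eq by (elim exE bexE conjE) (rule that)
    have "x \<in> cluster_in (avoid H {t}) x"
      by simp
    with disj have "x \<notin> T"
      by blast
    then have "connected_in (avoid H T') x t"
      using edge by (intro connected_in_edge) (auto simp: avoid_def T'_def)
    moreover have "connected_in (avoid H T') a' x"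
      using a' mem_cluster_in[of x "avoid H {t}" x] mem_cluster_in[of x "avoid H T'" a'] by simp
    ultimately have "cluster_in (avoid H T') a' = K"
      unfolding K_def by (intro cluster_in_eq) (rule connected_in_trans)
    with C a' show False by simp
  qed
  define F' where "F' = insert A (insert B (F - {K}))"
  have "card F' = Suc (Suc (card (F - {K})))"
    using new[OF e(1) disj(1)] new[OF e(2) disj(2)] neq F(2) unfolding F'_def A_def B_def by simp
  also have "\<dots> \<ge> Suc (card F)"
    using diff_card_le_card_Diff[of "{K}" F] by simp
  finally have "card T \<le> card F'"
    using F(3) t Suc.prems(1) by (simp add: T'_def)
  moreover have "F' \<subseteq> branches H T"
    using AB rest by (auto simp: F'_def)
  moreover have "finite F'"
    using F(2) by (simp add: F'_def)
  ultimately show ?case by blast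
qed

lemma branches_disjoint: "C \<in> branches H T \<Longrightarrow> C' \<in> branches H T \<Longrightarrow> x \<in> C \<Longrightarrow> x \<in> C' \<Longrightarrow> C = C'"
proof -
  assume "C \<in> branches H T" "C' \<in> branches H T"
  then obtain a a' where "C = cluster_in (avoid H T) a" "C' = cluster_in (avoid H T) a'"
    unfolding branches_def by auto
  moreover assume "x \<in> C" "x \<in> C'"
  ultimately show "C = C'"
    using cluster_in_eq[of "avoid H T" a x] cluster_in_eq[of "avoid H T" a' x] by simp
qed

lemma card_le_disjoint_meeting:
  assumes "finite S" "\<And>C. C \<in> F \<Longrightarrow> C \<inter> S \<noteq> {}"
    and "\<And>C C' x. C \<in> F \<Longrightarrow> C' \<in> F \<Longrightarrow> x \<in> C \<Longrightarrow> x \<in> C' \<Longrightarrow> C = C'"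
  shows "card F \<le> card S"
proof -
  have "\<forall>C\<in>F. \<exists>x. x \<in> C \<and> x \<in> S"
    using assms(2) by blast
  then obtain f where f: "\<forall>C\<in>F. f C \<in> C \<and> f C \<in> S"
    by metis
  then have "inj_on f F"
    using assms(3) by (intro inj_onI) metis
  then show ?thesis
    using f assms(1) by (intro card_inj_on_le[of f]) auto
qed

section \<open>Endpoints in graphs of degree at most two\<close>

definition endpoint :: "'a set set \<Rightarrow> 'a \<Rightarrow> bool" where
  "endpoint H v \<longleftrightarrow> (\<exists>u. \<forall>x. {x, v} \<in> H \<longrightarrow> x = u) \<and> infinite (cluster_in H v)"

lemma path_edges_nth: "Suc i < length xs \<Longrightarrow> {xs ! i, xs ! Suc i} \<in> path_edges xs"
proof (induction xs arbitrary: i rule: path_edges.induct)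
  case (1 x y xs)
  then show ?case by (cases i) auto
qed auto

text \<open>A simple path between two distinct endpoints uses up all edges at each of its vertices.
  Its vertex set is then closed under adjacency, so the cluster would be finite.\<close>

lemma endpoints_not_connected:
  assumes fin: "\<And>v. finite {x. {x, v} \<in> H}" and deg: "\<And>v. degree_in H v \<le> 2"
    and ab: "endpoint H a" "endpoint H b" "connected_in H a b"
  shows "a = b"
proof (rule ccontr)
  assume "a \<noteq> b"
  obtain xs where xs: "xs \<noteq> []" "hd xs = a" "last xs = b" "distinct xs" "path_edges xs \<subseteq> H"
    using ab(3) by (rule connected_in_path)
  have hd: "xs ! 0 = a" and la: "xs ! (length xs - 1) = b"
    using xs by (auto simp: hd_conv_nth last_conv_nth)
  then have len: "length xs \<ge> 2"
    using \<open>a \<noteq> b\<close> xs(1) by (cases xs; cases "tl xs") auto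
  have up: "{xs ! Suc i, xs ! i} \<in> H" and dn: "{xs ! i, xs ! Suc i} \<in> H" if "Suc i < length xs" for i
    using path_edges_nth[OF that] xs(5) by (auto simp: insert_commute)
  have closed: "v \<in> set xs" if uv: "{u, v} \<in> H" "u \<in> set xs" for u v
  proof -
    obtain i where i: "i < length xs" "u = xs ! i"
      using uv(2) by (metis in_set_conv_nth)
    have vu: "{v, u} \<in> H"
      using uv(1) by (simp add: insert_commute)
    consider "i = 0" | "i = length xs - 1" | "0 < i" "Suc i < length xs"
      using i by linarith
    then show ?thesis
    proof cases
      case 1
      obtain w where w: "\<forall>x. {x, a} \<in> H \<longrightarrow> x = w"
        using ab(1) unfolding endpoint_def by blast
      have "v = xs ! 1"
        using w vu up[of 0] len 1 i hd by auto
      then show ?thesis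
        using len by simp
    next
      case 2
      obtain w where w: "\<forall>x. {x, b} \<in> H \<longrightarrow> x = w"
        using ab(2) unfolding endpoint_def by blast
      have "Suc (length xs - 2) = length xs - 1"
        using len by simp
      then have "v = xs ! (length xs - 2)"
        using w vu dn[of "length xs - 2"] len 2 i la by auto
      then show ?thesis
        using len by simp
    next
      \<comment> \<open>The predecessor and the successor on the path are distinct and exhaust the
        degree of an inner vertex.\<close>
      case 3
      define w w' where "w = xs ! (i - 1)" "w' = xs ! Suc i"
      have "w \<noteq> w'"
        using 3 xs(4) by (simp add: w_w'_def nth_eq_iff_index_eq)
      moreover have "{w, w'} \<subseteq> {x. {x, u} \<in> H}"
        using up[of i] dn[of "i - 1"] 3 i by (auto simp: w_w'_def)
      ultimately have "{w, w'} = {x. {x, u} \<in> H}"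
        using deg[of u] fin[of u] by (intro card_seteq) (auto simp: degree_in_def)
      then have "v \<in> {w, w'}"
        using vu by blast
      then show ?thesis
        using 3 by (auto simp: w_w'_def)
    qed
  qed
  have "cluster_in H a \<subseteq> set xs"
  proof
    fix y assume "y \<in> cluster_in H a"
    then have "connected_in H a y" by simp
    then show "y \<in> set xs"
      by (rule connected_in_closed) (use closed xs in auto)
  qed
  with ab(1) show False
    unfolding endpoint_def using finite_subset by blast
qed

section \<open>The lattice\<close>

lemma lattice_edge_iff: "{u, v} \<in> lattice_edges \<longleftrightarrow> (\<Sum>i\<in>UNIV. \<bar>u $ i - v $ i\<bar>) = 1"
  unfolding lattice_edges_def by (auto simp: doubleton_eq_iff abs_minus_commute)

lemma lattice_edge_cases:
  assumes "e \<in> lattice_edges"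
  obtains u v where "e = {u, v}" "u \<noteq> v"
proof -
  obtain u v where uv: "e = {u, v}" "(\<Sum>i\<in>UNIV. \<bar>u $ i - v $ i\<bar>) = 1"
    using assms unfolding lattice_edges_def by auto
  from uv(2) have "u \<noteq> v"
    by auto
  with uv(1) show thesis
    by (rule that)
qed

lemma lattice_edge_other:
  assumes "e \<in> lattice_edges" "v \<in> e"
  obtains u where "e = {u, v}" "u \<noteq> v"
proof -
  obtain a b where "e = {a, b}" "a \<noteq> b"
    using lattice_edge_cases[OF assms(1)] .
  with assms(2) that[of a] that[of b] show thesis
    by (auto simp: insert_commute)
qed

section \<open>Cubes as balls of the supremum norm\<close>

definition cube :: "nat \<Rightarrow> int ^ 'd \<Rightarrow> (int ^ 'd) set" where
  "cube n x = {y. \<forall>i. \<bar>y $ i - x $ i\<bar> \<le> int n}"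

lemma cube_eq_image: "cube n x = vec_lambda ` (\<Pi>\<^sub>E i\<in>UNIV. {x $ i - int n..x $ i + int n})"
proof (intro set_eqI iffI)
  fix y assume "y \<in> cube n x"
  then have "vec_nth y \<in> (\<Pi>\<^sub>E i\<in>UNIV. {x $ i - int n..x $ i + int n})"
    unfolding cube_def PiE_UNIV_domain by (auto simp: abs_le_iff algebra_simps)
  then show "y \<in> vec_lambda ` (\<Pi>\<^sub>E i\<in>UNIV. {x $ i - int n..x $ i + int n})"
    by (intro image_eqI[of y vec_lambda "vec_nth y"]) simp_all
next
  fix y assume "y \<in> vec_lambda ` (\<Pi>\<^sub>E i\<in>UNIV. {x $ i - int n..x $ i + int n})"
  then obtain f where "y = vec_lambda f" "\<forall>i. f i \<in> {x $ i - int n..x $ i + int n}"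
    by (auto simp: PiE_UNIV_domain Pi_iff)
  then show "y \<in> cube n x"
    by (auto simp: cube_def abs_le_iff algebra_simps)
qed

lemma finite_cube [simp]: "finite (cube n x)"
  unfolding cube_eq_image by (intro finite_imageI finite_PiE) auto

lemma card_cube: "card (cube n (x :: int ^ 'd)) = (2 * n + 1) ^ CARD('d::finite)"
proof -
  have "inj_on (vec_lambda :: _ \<Rightarrow> int ^ 'd) (\<Pi>\<^sub>E i\<in>UNIV. {x $ i - int n..x $ i + int n})"
    by (intro inj_onI) (simp add: vec_lambda_inject)
  then have "card (cube n x) = card (\<Pi>\<^sub>E i\<in>UNIV. {x $ i - int n..x $ i + int n})"
    unfolding cube_eq_image by (rule card_image)
  also have "\<dots> = (2 * n + 1) ^ CARD('d)"
    by (subst card_PiE) (auto simp: nat_add_distrib nat_mult_distrib)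
  finally show ?thesis .
qed

lemma cube_mono: "m \<le> n \<Longrightarrow> cube m x \<subseteq> cube n x"
  unfolding cube_def by (auto intro: order_trans)

lemma center_in_cube [simp]: "x \<in> cube n x"
  by (simp add: cube_def)

lemma cube_translate: "y + a \<in> cube n (x + a) \<longleftrightarrow> y \<in> cube n x"
  by (simp add: cube_def)

lemma cube_exhausts:
  fixes x :: "int ^ 'd::finite"
  assumes "finite S"
  obtains n where "S \<subseteq> cube n x"
proof -
  define n where "n = nat (\<Sum>y\<in>S. \<Sum>i\<in>UNIV. \<bar>y $ i - x $ i\<bar>)"
  have "y \<in> cube n x" if "y \<in> S" for y
    unfolding cube_def
  proof (intro CollectI allI)
    fix i
    have "\<bar>y $ i - x $ i\<bar> \<le> (\<Sum>i\<in>UNIV. \<bar>y $ i - x $ i\<bar>)"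
      by (intro member_le_sum) auto
    also have "\<dots> \<le> (\<Sum>y\<in>S. \<Sum>i\<in>UNIV. \<bar>y $ i - x $ i\<bar>)"
      using assms that by (intro member_le_sum[of y S "\<lambda>y. \<Sum>i\<in>UNIV. \<bar>y $ i - x $ i\<bar>"]) (auto intro: sum_nonneg)
    finally show "\<bar>y $ i - x $ i\<bar> \<le> int n"
      unfolding n_def by linarith
  qed
  then show thesis
    using that by blast
qed

lemma lattice_edge_cube: "{u, v} \<in> lattice_edges \<Longrightarrow> u \<in> cube n x \<Longrightarrow> v \<in> cube (Suc n) x"
  unfolding cube_def lattice_edge_iff
proof (intro CollectI allI)
  fix i assume "(\<Sum>i\<in>UNIV. \<bar>u $ i - v $ i\<bar>) = 1" "u \<in> {y. \<forall>i. \<bar>y $ i - x $ i\<bar> \<le> int n}"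
  moreover have "\<bar>u $ i - v $ i\<bar> \<le> (\<Sum>i\<in>UNIV. \<bar>u $ i - v $ i\<bar>)"
    by (intro member_le_sum) auto
  ultimately have "\<bar>u $ i - v $ i\<bar> \<le> 1" "\<bar>u $ i - x $ i\<bar> \<le> int n"
    by auto
  then show "\<bar>v $ i - x $ i\<bar> \<le> int (Suc n)"
    by linarith
qed

definition nbrs :: "int ^ 'd \<Rightarrow> (int ^ 'd) set" where
  "nbrs v = {x. {x, v} \<in> lattice_edges}"

lemma nbrs_subset_cube: "nbrs v \<subseteq> cube 1 v"
proof
  fix x assume "x \<in> nbrs v"
  then have "{v, x} \<in> lattice_edges"
    by (simp add: nbrs_def insert_commute)
  moreover have "v \<in> cube 0 v" by simp
  ultimately show "x \<in> cube 1 v"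
    using lattice_edge_cube[of v x 0 v] by simp
qed

lemma finite_nbrs [simp]: "finite (nbrs v)"
  using nbrs_subset_cube finite_subset finite_cube by metis

text \<open>The neighbours are counted crudely by the cube of radius one; every later factor
  \<open>3 ^ CARD('d)\<close> comes from here.\<close>

lemma card_nbrs: "card (nbrs (v :: int ^ 'd::finite)) \<le> 3 ^ CARD('d)"
  using card_mono[OF finite_cube nbrs_subset_cube, of v] card_cube[of 1 v] by simp

lemma finite_open_nbrs: "H \<subseteq> lattice_edges \<Longrightarrow> finite {x. {x, v} \<in> H}"
  by (rule finite_subset[OF _ finite_nbrs[of v]]) (auto simp: nbrs_def)

text \<open>\<open>D\<close> may be any set of vertices, also an edge: for a lattice edge
  \<open>e\<close>, \<open>touch e\<close> consists of \<open>e\<close> and the edges that share a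
  vertex with it. Correspondingly \<open>touch (\<Union> (touch D))\<close> adds to
  \<open>touch D\<close> all edges adjacent to it.\<close>

definition touch :: "(int ^ 'd) set \<Rightarrow> (int ^ 'd) set set" where
  "touch D = {e \<in> lattice_edges. e \<inter> D \<noteq> {}}"

lemma touch_subset: "touch D \<subseteq> (\<Union>v\<in>D. (\<lambda>x. {x, v}) ` nbrs v)"
proof
  fix e assume "e \<in> touch D"
  then obtain v where v: "e \<in> lattice_edges" "v \<in> e" "v \<in> D"
    by (auto simp: touch_def)
  obtain u where "e = {u, v}"
    using lattice_edge_other[OF v(1,2)] .
  with v show "e \<in> (\<Union>v\<in>D. (\<lambda>x. {x, v}) ` nbrs v)"
    by (auto simp: nbrs_def)
qed

lemma finite_touch: "finite D \<Longrightarrow> finite (touch D)"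
  by (rule finite_subset[OF touch_subset]) auto

lemma card_touch:
  assumes "finite (D :: (int ^ 'd::finite) set)"
  shows "card (touch D) \<le> card D * 3 ^ CARD('d)"
proof -
  have "card (touch D) \<le> card (\<Union>v\<in>D. (\<lambda>x. {x, v}) ` nbrs v)"
    using assms by (intro card_mono touch_subset) auto
  also have "\<dots> \<le> (\<Sum>v\<in>D. card ((\<lambda>x. {x, v}) ` nbrs v))"
    using assms by (rule card_UN_le)
  also have "\<dots> \<le> (\<Sum>v\<in>D. 3 ^ CARD('d))"
    by (intro sum_mono order_trans[OF card_image_le card_nbrs]) auto
  finally show ?thesis by simp
qed

lemma finite_Union_touch: "finite D \<Longrightarrow> finite (\<Union> (touch D))"
proof (rule finite_Union)
  fix e assume "e \<in> touch D"
  then show "finite e"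
    unfolding touch_def by (auto elim: lattice_edge_cases)
qed (rule finite_touch)

lemma card_Union_touch:
  assumes "finite (D :: (int ^ 'd::finite) set)"
  shows "card (\<Union> (touch D)) \<le> 2 * card (touch D)"
proof -
  have "card (\<Union> (touch D)) \<le> (\<Sum>e\<in>touch D. card e)"
    by (rule card_Union_le_sum_card)
  also have "\<dots> \<le> (\<Sum>e\<in>touch D. 2)"
    by (intro sum_mono) (auto simp: touch_def elim: lattice_edge_cases)
  finally show ?thesis by simp
qed

text \<open>Move one coordinate of \<open>y\<close> by one towards \<open>z\<close>: it stays
  between two admissible values, and the sum of the coordinate distances drops.\<close>

lemma cube_connected:
  fixes y z :: "int ^ 'd::finite"
  assumes "y \<in> cube n x" "z \<in> cube n x"
  shows "connected_in {e \<in> lattice_edges. e \<subseteq> cube n x} y z"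
  using assms(1)
proof (induction "nat (\<Sum>i\<in>UNIV. \<bar>y $ i - z $ i\<bar>)" arbitrary: y rule: less_induct)
  case less
  show ?case
  proof (cases "y = z")
    case False
    then obtain i where i: "y $ i \<noteq> z $ i"
      by (auto simp: vec_eq_iff)
    define s where "s = (if y $ i < z $ i then 1 else - 1 :: int)"
    define y' where "y' = (\<chi> j. if j = i then y $ i + s else y $ j)"
    have y'_simps: "y' $ j = (if j = i then y $ i + s else y $ j)" for j
      by (simp add: y'_def)
    have "(\<Sum>j\<in>UNIV. \<bar>y $ j - y' $ j\<bar>) = (\<Sum>j\<in>UNIV. if j = i then 1 else 0)"
      by (intro sum.cong) (auto simp: y'_simps s_def)
    then have edge: "{y, y'} \<in> lattice_edges"
      by (simp add: lattice_edge_iff)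
    have cube: "y' \<in> cube n x"
      unfolding cube_def
    proof (intro CollectI allI)
      fix j
      have "\<bar>y $ j - x $ j\<bar> \<le> int n" "\<bar>z $ j - x $ j\<bar> \<le> int n"
        using less.prems assms(2) by (auto simp: cube_def)
      then show "\<bar>y' $ j - x $ j\<bar> \<le> int n"
        using i by (auto simp: y'_simps s_def)
    qed
    have "(\<Sum>j\<in>UNIV. \<bar>y' $ j - z $ j\<bar>) < (\<Sum>j\<in>UNIV. \<bar>y $ j - z $ j\<bar>)"
      using i by (intro sum_strict_mono_ex1) (auto simp: y'_simps s_def intro!: exI[of _ i])
    moreover have "0 \<le> (\<Sum>j\<in>UNIV. \<bar>y' $ j - z $ j\<bar>)"
      by (intro sum_nonneg) auto
    ultimately have "nat (\<Sum>j\<in>UNIV. \<bar>y' $ j - z $ j\<bar>) < nat (\<Sum>j\<in>UNIV. \<bar>y $ j - z $ j\<bar>)"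
      by linarith
    from less.hyps[OF this cube]
    have "connected_in {e \<in> lattice_edges. e \<subseteq> cube n x} y' z" .
    moreover have "connected_in {e \<in> lattice_edges. e \<subseteq> cube n x} y y'"
      using edge cube less.prems by (intro connected_in_edge) auto
    ultimately show ?thesis
      by (rule connected_in_trans[rotated])
  qed simp
qed

text \<open>An infinite cluster that starts in the inner cube has to leave it, and one lattice step
  out of \<open>cube n x\<close> lands in the shell. If it starts in the shell, the starting point
  itself will do.\<close>

lemma cluster_crosses_cube:
  assumes "H \<subseteq> lattice_edges" "infinite (cluster_in H a)" "a \<in> cube (Suc n) x"
  shows "cluster_in H a \<inter> (cube (Suc n) x - cube n x) \<noteq> {}"
proof (cases "a \<in> cube n x")
  case True
  obtain u v where uv: "connected_in H a u" "{u, v} \<in> H" "u \<in> cube n x" "v \<notin> cube n x"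
    by (rule cluster_in_exits[OF assms(2) True finite_cube])
  have "v \<in> cube (Suc n) x"
    using uv assms(1) by (intro lattice_edge_cube[of u v]) auto
  moreover have "connected_in H a v"
    using uv by (intro connected_in_step[of H a u v])
  ultimately show ?thesis
    using uv(4) by auto
next
  case False
  then have "a \<in> cluster_in H a \<inter> (cube (Suc n) x - cube n x)"
    using assms(3) by simp
  then show ?thesis by blast
qed

text \<open>A branch starts next to a point of \<open>cube n x\<close>, hence inside
  \<open>cube (Suc n) x\<close>, and is infinite, so it crosses the shell. Distinct branches are
  disjoint and therefore use different points of the shell.\<close>

lemma card_trifurcations:
  assumes "H \<subseteq> lattice_edges"
  shows "card {t \<in> cube n x. trifurcation H t} \<le> card (cube (Suc n) x - cube n x)"
proof -
  define T where "T = {t \<in> cube n x. trifurcation H t}"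
  have "finite T" "\<forall>t\<in>T. trifurcation H t"
    by (simp_all add: T_def)
  from card_branches[OF this]
  obtain F where F: "F \<subseteq> branches H T" "finite F" "card T \<le> card F"
    by (elim exE conjE) (rule that)
  have "card F \<le> card (cube (Suc n) x - cube n x)"
  proof (rule card_le_disjoint_meeting)
    fix C assume "C \<in> F"
    then obtain a t where C: "t \<in> T" "{a, t} \<in> H" "C = cluster_in (avoid H T) a" "infinite C"
      using F(1) unfolding branches_def by blast
    have "a \<in> cube (Suc n) x"
      using C assms by (intro lattice_edge_cube[of t a]) (auto simp: T_def insert_commute)
    moreover have "avoid H T \<subseteq> lattice_edges"
      using assms by (auto simp: avoid_def)
    ultimately show "C \<inter> (cube (Suc n) x - cube n x) \<noteq> {}"
      using C cluster_crosses_cube[of "avoid H T" a n x] by simp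
  next
    fix C C' y assume "C \<in> F" "C' \<in> F" "y \<in> C" "y \<in> C'"
    then show "C = C'"
      using F(1) branches_disjoint[of C H T C' y] by blast
  qed simp
  with F show ?thesis
    by (simp add: T_def)
qed

text \<open>Distinct endpoints lie in distinct infinite clusters, and each of these takes a point of
  the shell for itself.\<close>

lemma card_endpoints:
  assumes "H \<subseteq> lattice_edges" "\<And>v. degree_in H v \<le> 2"
  shows "card {t \<in> cube n x. endpoint H t} \<le> card (cube (Suc n) x - cube n x)"
proof -
  define T where "T = {t \<in> cube n x. endpoint H t}"
  have *: "a = b" if "a \<in> T" "b \<in> T" "connected_in H a b" for a b
    using that endpoints_not_connected[of H a b] finite_open_nbrs[OF assms(1)] assms(2)
    by (simp add: T_def)
  have "cluster_in H a = cluster_in H b \<Longrightarrow> connected_in H a b" for a b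
    using mem_cluster_in[of b H a] by simp
  then have "inj_on (cluster_in H) T"
    using * by (intro inj_onI) blast
  then have "card T = card (cluster_in H ` T)"
    by (simp add: card_image)
  also have "\<dots> \<le> card (cube (Suc n) x - cube n x)"
  proof (rule card_le_disjoint_meeting)
    fix C assume "C \<in> cluster_in H ` T"
    then obtain a where "a \<in> T" "C = cluster_in H a" by blast
    moreover have "a \<in> cube (Suc n) x"
      using \<open>a \<in> T\<close> cube_mono[of n "Suc n" x] by (auto simp: T_def)
    ultimately show "C \<inter> (cube (Suc n) x - cube n x) \<noteq> {}"
      using cluster_crosses_cube[OF assms(1), of a n x] by (simp add: T_def endpoint_def)
  next
    fix C C' y assume "C \<in> cluster_in H ` T" "C' \<in> cluster_in H ` T" "y \<in> C" "y \<in> C'"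
    moreover from this obtain a b where "C = cluster_in H a" "C' = cluster_in H b"
      by auto
    ultimately show "C = C'"
      using cluster_in_eq[of H a y] cluster_in_eq[of H b y] by simp
  qed simp
  finally show ?thesis
    by (simp add: T_def)
qed

section \<open>The dynamics as a recursion over earlier clocks\<close>

text \<open>A pair \<open>(f, e)\<close> means that the fate of \<open>e\<close> may depend directly
  on that of \<open>f\<close>. Well-foundedness says that tracing the dependence back from any edge
  terminates, which makes the dynamics well defined.\<close>

definition earlier :: "((int ^ 'd) set \<Rightarrow> real) \<Rightarrow> ((int ^ 'd) set \<times> (int ^ 'd) set) set" where
  "earlier U = {(f, e). f \<in> lattice_edges \<and> e \<in> lattice_edges \<and> f \<inter> e \<noteq> {} \<and> U f < U e}"

text \<open>Iterating the local rule from the empty graph, instead of recursing along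
  \<open>earlier U\<close>, gives a total definition for every \<open>U\<close>; at a fixed edge
  each stage involves only finitely many clocks, which makes it measurable.\<close>

fun stage :: "nat \<Rightarrow> ((int ^ 'd) set \<Rightarrow> real) \<Rightarrow> nat \<Rightarrow> (int ^ 'd) set set" where
  "stage k U 0 = {}"
| "stage k U (Suc n) =
     {e \<in> lattice_edges. \<forall>v\<in>e. card {x. {x, v} \<in> stage k U n \<and> U {x, v} < U e} < k}"

text \<open>The rule is antitone in the set of open edges, so the stages oscillate: for
  \<open>k > 0\<close> stage 0 is empty and stage 1 contains every edge. Hence a limit inferior
  instead of a union.\<close>

definition opened :: "nat \<Rightarrow> ((int ^ 'd) set \<Rightarrow> real) \<Rightarrow> (int ^ 'd) set set" where
  "opened k U = {e. \<exists>n. \<forall>m\<ge>n. e \<in> stage k U m}"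

definition config :: "nat \<Rightarrow> real \<Rightarrow> ((int ^ 'd) set \<Rightarrow> real) \<Rightarrow> (int ^ 'd) set set" where
  "config k t U = {e \<in> opened k U. U e \<le> t}"

lemma stage_subset: "stage k U n \<subseteq> lattice_edges"
  by (cases n) auto

lemma opened_subset: "opened k U \<subseteq> lattice_edges"
  using stage_subset by (fastforce simp: opened_def)

lemma config_subset: "config k t U \<subseteq> lattice_edges"
  using opened_subset by (fastforce simp: config_def)

text \<open>An edge settles one stage after all adjacent edges with smaller clocks have settled.
  There are finitely many of those, so a common stage exists.\<close>

lemma stage_stable:
  assumes "wf (earlier U)" "e \<in> lattice_edges"
  shows "\<exists>n. \<forall>m\<ge>n. e \<in> stage k U m \<longleftrightarrow> e \<in> opened k U"
  using assms
proof (induction e rule: wf_induct_rule)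
  case (less e)
  define N where "N = {f \<in> touch e. U f < U e}"
  have "finite e"
    using less.prems by (auto elim: lattice_edge_cases)
  then have "finite N"
    unfolding N_def using finite_touch[of e] by simp
  have "\<forall>f\<in>N. \<exists>n. \<forall>m\<ge>n. f \<in> stage k U m \<longleftrightarrow> f \<in> opened k U"
    using less.IH less.prems by (auto simp: N_def touch_def earlier_def)
  then obtain h where h: "\<And>f m. f \<in> N \<Longrightarrow> m \<ge> h f \<Longrightarrow> f \<in> stage k U m \<longleftrightarrow> f \<in> opened k U"
    by metis
  define n where "n = Max (insert 0 (h ` N))"
  have hn: "h f \<le> n" if "f \<in> N" for f
    unfolding n_def using that \<open>finite N\<close> by (intro Max_ge) auto
  have same: "({x, v} \<in> stage k U m \<and> U {x, v} < U e) \<longleftrightarrow> ({x, v} \<in> opened k U \<and> U {x, v} < U e)"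
    if "m \<ge> n" "v \<in> e" for m v x
  proof (cases "{x, v} \<in> N")
    case True
    then show ?thesis
      using h[of "{x, v}" m] hn[of "{x, v}"] that by auto
  next
    case False
    then show ?thesis
      using that stage_subset[of k U m] opened_subset[of k U] by (auto simp: N_def touch_def)
  qed
  have st: "e \<in> stage k U m \<longleftrightarrow> (\<forall>v\<in>e. card {x. {x, v} \<in> opened k U \<and> U {x, v} < U e} < k)"
    if "m \<ge> Suc n" for m
  proof -
    define m' where "m' = m - 1"
    have "m = Suc m'" "m' \<ge> n"
      using that by (auto simp: m'_def)
    then show ?thesis
      using less.prems same[of m'] by simp
  qed
  have "e \<in> opened k U \<longleftrightarrow> (\<forall>v\<in>e. card {x. {x, v} \<in> opened k U \<and> U {x, v} < U e} < k)"
  proof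
    assume "e \<in> opened k U"
    then obtain n' where "\<forall>m\<ge>n'. e \<in> stage k U m"
      by (auto simp: opened_def)
    then show "\<forall>v\<in>e. card {x. {x, v} \<in> opened k U \<and> U {x, v} < U e} < k"
      using st[of "max (Suc n) n'"] by simp
  next
    assume "\<forall>v\<in>e. card {x. {x, v} \<in> opened k U \<and> U {x, v} < U e} < k"
    then have "\<forall>m\<ge>Suc n. e \<in> stage k U m"
      using st by blast
    then show "e \<in> opened k U"
      unfolding opened_def by blast
  qed
  then show ?case
    using st by blast
qed

lemma opened_iff:
  assumes "wf (earlier U)" "e \<in> lattice_edges"
  shows "e \<in> opened k U \<longleftrightarrow> (\<forall>v\<in>e. card {x. {x, v} \<in> opened k U \<and> U {x, v} < U e} < k)"
proof -
  have "finite e"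
    using assms by (auto elim: lattice_edge_cases)
  have "\<forall>f\<in>insert e (touch e). \<exists>n. \<forall>m\<ge>n. f \<in> stage k U m \<longleftrightarrow> f \<in> opened k U"
    using stage_stable[OF assms(1)] assms(2) by (auto simp: touch_def)
  then obtain h where h: "\<And>f m. f \<in> insert e (touch e) \<Longrightarrow> m \<ge> h f \<Longrightarrow> f \<in> stage k U m \<longleftrightarrow> f \<in> opened k U"
    by metis
  define n where "n = Max (h ` insert e (touch e))"
  have hn: "h f \<le> n" if "f \<in> insert e (touch e)" for f
    unfolding n_def using that finite_touch[OF \<open>finite e\<close>] by (intro Max_ge) auto
  have "e \<in> opened k U \<longleftrightarrow> e \<in> stage k U (Suc n)"
    using h[of e "Suc n"] hn[of e] by simp
  also have "\<dots> \<longleftrightarrow> (\<forall>v\<in>e. card {x. {x, v} \<in> stage k U n \<and> U {x, v} < U e} < k)"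
    using assms(2) by simp
  also have "\<dots> \<longleftrightarrow> (\<forall>v\<in>e. card {x. {x, v} \<in> opened k U \<and> U {x, v} < U e} < k)"
  proof (rule ball_cong[OF refl])
    fix v assume v: "v \<in> e"
    have "{x, v} \<in> stage k U n \<longleftrightarrow> {x, v} \<in> opened k U" for x
    proof (cases "{x, v} \<in> touch e")
      case True
      then show ?thesis
        using h[of "{x, v}" n] hn[of "{x, v}"] by blast
    next
      case False
      then show ?thesis
        using v stage_subset[of k U n] opened_subset[of k U] by (auto simp: touch_def)
    qed
    then show "(card {x. {x, v} \<in> stage k U n \<and> U {x, v} < U e} < k) =
      (card {x. {x, v} \<in> opened k U \<and> U {x, v} < U e} < k)"
      by simp
  qed
  finally show ?thesis .
qed

lemma opened_unique:
  assumes "wf (earlier U)" "S \<subseteq> lattice_edges"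
    and "\<And>e. e \<in> lattice_edges \<Longrightarrow> e \<in> S \<longleftrightarrow> (\<forall>v\<in>e. card {x. {x, v} \<in> S \<and> U {x, v} < U e} < k)"
  shows "S = opened k U"
proof -
  have "e \<in> S \<longleftrightarrow> e \<in> opened k U" if "e \<in> lattice_edges" for e
    using assms(1) that
  proof (induction e rule: wf_induct_rule)
    case (less e)
    have "({x, v} \<in> S \<and> U {x, v} < U e) \<longleftrightarrow> ({x, v} \<in> opened k U \<and> U {x, v} < U e)" if "v \<in> e" for x v
    proof (cases "{x, v} \<in> lattice_edges \<and> U {x, v} < U e")
      case True
      then have "({x, v}, e) \<in> earlier U"
        using that less.prems by (auto simp: earlier_def)
      with less.IH True show ?thesis by blast
    next
      case False
      then show ?thesis
        using assms(2) opened_subset by blast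
    qed
    then show ?case
      using assms(3)[OF less.prems] opened_iff[OF assms(1) less.prems] by simp
  qed
  then show ?thesis
    using assms(2) opened_subset by blast
qed

text \<open>Only finitely many edges meet at \<open>v\<close>, so the count of edges with clock
  below \<open>r\<close> is attained at an actual time \<open>s < r\<close>, namely the largest of
  these clocks. This turns the quantifier over times into a single count.\<close>

lemma degree_before_iff:
  fixes U :: "(int ^ 'd::finite) set \<Rightarrow> real"
  assumes "S \<subseteq> lattice_edges" "0 < k"
  shows "(\<forall>s<r. degree_in {f \<in> S. U f \<le> s} v < k) \<longleftrightarrow> card {x. {x, v} \<in> S \<and> U {x, v} < r} < k"
proof
  assume *: "\<forall>s<r. degree_in {f \<in> S. U f \<le> s} v < k"
  define X where "X = {x. {x, v} \<in> S \<and> U {x, v} < r}"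
  have "finite X"
    by (rule finite_subset[OF _ finite_open_nbrs[OF assms(1), of v]]) (auto simp: X_def)
  show "card {x. {x, v} \<in> S \<and> U {x, v} < r} < k"
  proof (cases "X = {}")
    case True
    with assms(2) show ?thesis
      by (simp add: X_def[symmetric])
  next
    case False
    define s where "s = Max ((\<lambda>x. U {x, v}) ` X)"
    have "s \<in> (\<lambda>x. U {x, v}) ` X"
      unfolding s_def using False \<open>finite X\<close> by (intro Max_in) auto
    then have "s < r"
      by (auto simp: X_def)
    have "U {x, v} \<le> s" if "x \<in> X" for x
      unfolding s_def using that \<open>finite X\<close> by (intro Max_ge) auto
    then have "X = {x. {x, v} \<in> {f \<in> S. U f \<le> s}}"
      using \<open>s < r\<close> by (auto simp: X_def)
    then show ?thesis
      using * \<open>s < r\<close> by (auto simp: X_def degree_in_def)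
  qed
next
  assume *: "card {x. {x, v} \<in> S \<and> U {x, v} < r} < k"
  show "\<forall>s<r. degree_in {f \<in> S. U f \<le> s} v < k"
  proof (intro allI impI)
    fix s assume "s < r"
    have "finite {x. {x, v} \<in> S \<and> U {x, v} < r}"
      by (rule finite_subset[OF _ finite_open_nbrs[OF assms(1), of v]]) auto
    then have "degree_in {f \<in> S. U f \<le> s} v \<le> card {x. {x, v} \<in> S \<and> U {x, v} < r}"
      unfolding degree_in_def using \<open>s < r\<close> by (intro card_mono) auto
    with * show "degree_in {f \<in> S. U f \<le> s} v < k" by simp
  qed
qed

text \<open>Both existence and uniqueness reduce to the fixed-point equation of
  \<open>opened\<close>. An evolution is determined by the set \<open>S\<close> of edges that ever
  open, because the edges open at time \<open>t\<close> are those of \<open>S\<close> with clock at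
  most \<open>t\<close>, and \<open>S\<close> satisfies the same equation.\<close>

lemma cdp_open_eq_config:
  assumes "wf (earlier U)" "0 < k"
  shows "cdp_open k U = (\<lambda>t. config k t U)"
  unfolding cdp_open_def
proof (rule the_equality)
  show "cdp_evolution k U (\<lambda>t. config k t U)"
    unfolding cdp_evolution_def
  proof
    fix t
    have "e \<in> opened k U \<longleftrightarrow> (\<forall>s<U e. \<forall>v\<in>e. degree_in (config k s U) v < k)"
      if "e \<in> lattice_edges" for e
      using opened_iff[OF assms(1) that] degree_before_iff[OF opened_subset assms(2)]
      unfolding config_def by blast
    then show "config k t U =
      {e \<in> lattice_edges. U e \<le> t \<and> (\<forall>s<U e. \<forall>v\<in>e. degree_in (config k s U) v < k)}"
      using opened_subset[of k U] unfolding config_def by blast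
  qed
next
  fix \<omega> assume "cdp_evolution k U \<omega>"
  then have \<omega>: "\<omega> t = {e \<in> lattice_edges. U e \<le> t \<and> (\<forall>s<U e. \<forall>v\<in>e. degree_in (\<omega> s) v < k)}" for t
    unfolding cdp_evolution_def by blast
  define S where "S = {e \<in> lattice_edges. \<forall>s<U e. \<forall>v\<in>e. degree_in (\<omega> s) v < k}"
  have S: "S \<subseteq> lattice_edges"
    by (auto simp: S_def)
  have \<omega>S: "\<omega> t = {e \<in> S. U e \<le> t}" for t
    unfolding S_def by (subst \<omega>) blast
  have "S = opened k U"
  proof (rule opened_unique[OF assms(1) S])
    fix e :: "(int ^ 'a) set" assume "e \<in> lattice_edges"
    then have "e \<in> S \<longleftrightarrow> (\<forall>v\<in>e. \<forall>s<U e. degree_in {f \<in> S. U f \<le> s} v < k)"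
      unfolding \<omega>S[symmetric] unfolding S_def by blast
    also have "\<dots> \<longleftrightarrow> (\<forall>v\<in>e. card {x. {x, v} \<in> S \<and> U {x, v} < U e} < k)"
      using degree_before_iff[OF S assms(2)] by blast
    finally show "e \<in> S \<longleftrightarrow> (\<forall>v\<in>e. card {x. {x, v} \<in> S \<and> U {x, v} < U e} < k)" .
  qed
  then show "\<omega> = (\<lambda>t. config k t U)"
    using \<omega>S by (simp add: config_def fun_eq_iff)
qed


text \<open>The last edge to open at \<open>v\<close> found fewer than \<open>k\<close> open edges
  there. Injectivity of the clocks matters because the rule counts strictly smaller clocks only, so
  tied edges would not see each other.\<close>

lemma degree_config:
  assumes "wf (earlier U)" "inj_on U lattice_edges"
  shows "degree_in (config k t U) v \<le> k"
proof (rule ccontr)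
  assume n: "\<not> ?thesis"
  define X where "X = {x. {x, v} \<in> config k t U}"
  have fin: "finite X"
    unfolding X_def by (rule finite_open_nbrs[OF config_subset])
  have card: "k < card X"
    using n by (simp add: X_def degree_in_def)
  then have "X \<noteq> {}"
    by auto
  then have "Max ((\<lambda>x. U {x, v}) ` X) \<in> (\<lambda>x. U {x, v}) ` X"
    using fin by (intro Max_in) auto
  then obtain y where y: "y \<in> X" "U {y, v} = Max ((\<lambda>x. U {x, v}) ` X)"
    by auto
  have lat: "{x, v} \<in> lattice_edges" if "x \<in> X" for x
    using that config_subset by (auto simp: X_def)
  have "U {x, v} < U {y, v}" if "x \<in> X - {y}" for x
  proof -
    have "U {x, v} \<le> U {y, v}"
      unfolding y(2) using that fin by (intro Max_ge) auto
    moreover have "U {x, v} \<noteq> U {y, v}"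
      using inj_onD[OF assms(2) _ lat[of x] lat[OF y(1)]] that by (auto simp: doubleton_eq_iff)
    ultimately show ?thesis by simp
  qed
  then have "X - {y} \<subseteq> {x. {x, v} \<in> opened k U \<and> U {x, v} < U {y, v}}"
    by (auto simp: X_def config_def)
  moreover have "finite {x. {x, v} \<in> opened k U \<and> U {x, v} < U {y, v}}"
    by (rule finite_subset[OF _ finite_open_nbrs[OF opened_subset, of v]]) auto
  ultimately have "card (X - {y}) \<le> card {x. {x, v} \<in> opened k U \<and> U {x, v} < U {y, v}}"
    by (intro card_mono)
  also have "\<dots> < k"
  proof -
    have "{y, v} \<in> opened k U"
      using y(1) by (simp add: X_def config_def)
    then show ?thesis
      using opened_iff[OF assms(1) lat[OF y(1)]] by simp
  qed
  finally show False
    using card y(1) fin by simp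
qed

text \<open>Outside \<open>touch D\<close> the new configuration agrees with the old one. Edges adjacent to \<open>touch D\<close>
  that are closed at time \<open>t\<close> get clocks above \<open>t\<close>: this keeps them from opening once a vertex
  loses an edge, so the modification has no effect further away.\<close>

lemma config_surgery:
  fixes U U' :: "(int ^ 'd::finite) set \<Rightarrow> real"
  assumes wf: "wf (earlier U)" "wf (earlier U')" and k: "0 < k"
    and H: "H \<subseteq> lattice_edges" "H - touch D = config k t U - touch D" "\<And>v. degree_in H v \<le> k"
    and far: "\<And>e. e \<in> lattice_edges \<Longrightarrow> e \<notin> touch (\<Union> (touch D)) \<Longrightarrow> U' e = U e"
    and keep: "\<And>e. e \<in> H \<Longrightarrow> e \<in> config k t U \<Longrightarrow> U' e = U e"
    and opn: "\<And>e. e \<in> H \<Longrightarrow> e \<notin> config k t U \<Longrightarrow> U' e \<le> t"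
    and cls: "\<And>e. e \<in> touch (\<Union> (touch D)) \<Longrightarrow> e \<notin> H \<Longrightarrow> t < U' e"
  shows "config k t U' = H"
proof -
  have early: "U' e \<le> t" if "e \<in> H" for e
    using keep[OF that] opn[OF that] by (cases "e \<in> config k t U") (auto simp: config_def)
  have main: "e \<in> opened k U' \<longleftrightarrow> e \<in> H" if "e \<in> lattice_edges" "U' e \<le> t" for e
    using wf(2) that
  proof (induction e rule: wf_induct_rule)
    case (less e)
    have IH: "({x, v} \<in> opened k U' \<and> U' {x, v} < U' e) \<longleftrightarrow> ({x, v} \<in> H \<and> U' {x, v} < U' e)"
      if "v \<in> e" for x v
    proof (cases "{x, v} \<in> lattice_edges \<and> U' {x, v} < U' e")
      case True
      then have "({x, v}, e) \<in> earlier U'"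
        using that less.prems by (auto simp: earlier_def)
      with less.IH[OF this] True less.prems show ?thesis by auto
    next
      case False
      then show ?thesis
        using H(1) opened_subset by blast
    qed
    have iff: "e \<in> opened k U' \<longleftrightarrow> (\<forall>v\<in>e. card {x. {x, v} \<in> H \<and> U' {x, v} < U' e} < k)"
      using opened_iff[OF wf(2) less.prems(1)] IH by simp
    show ?case
    proof (cases "e \<in> H")
      \<comment> \<open>An edge of \<open>H\<close> is never blocked: \<open>H\<close> has degree at
        most \<open>k\<close> at each of its ends, and the edge itself is not counted among the
        strictly earlier ones.\<close>
      case True
      have "card {x. {x, v} \<in> H \<and> U' {x, v} < U' e} < k" if ve: "v \<in> e" for v
      proof -
        obtain u where u: "e = {u, v}"
          using lattice_edge_other[OF less.prems(1) ve] .
        have "{x. {x, v} \<in> H \<and> U' {x, v} < U' e} \<subset> {x. {x, v} \<in> H}"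
          using True u by auto
        then have "card {x. {x, v} \<in> H \<and> U' {x, v} < U' e} < card {x. {x, v} \<in> H}"
          by (intro psubset_card_mono finite_open_nbrs[OF H(1)])
        then show ?thesis
          using H(3)[of v] by (simp add: degree_in_def)
      qed
      with iff True show ?thesis by blast
    next
      \<comment> \<open>Edges outside \<open>H\<close> with clock at most \<open>t\<close> lie
        beyond both controlled layers. There the old clock is unchanged and the edge was blocked by
        \<open>k\<close> open edges at some vertex; none of them is in \<open>touch D\<close>, so
        all survive with their clocks and block it again.\<close>
      case False
      with cls less.prems have e: "e \<notin> touch (\<Union> (touch D))"
        by (meson linorder_not_less)
      have eD: "f \<notin> touch D" if "f \<in> lattice_edges" "f \<inter> e \<noteq> {}" for f
        using e that less.prems(1) by (auto simp: touch_def)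
      have "e \<noteq> {}"
        using less.prems(1) by (auto elim: lattice_edge_cases)
      then have "e \<notin> touch D"
        using eD[of e] less.prems(1) by simp
      have Ue: "U' e = U e"
        using far[OF less.prems(1) e] .
      have "e \<notin> config k t U"
        using False H(2) \<open>e \<notin> touch D\<close> by blast
      then have "e \<notin> opened k U"
        using Ue less.prems by (simp add: config_def)
      then obtain v where v: "v \<in> e" "\<not> card {x. {x, v} \<in> opened k U \<and> U {x, v} < U e} < k"
        using opened_iff[OF wf(1) less.prems(1)] by blast
      have sub: "{x. {x, v} \<in> opened k U \<and> U {x, v} < U e} \<subseteq> {x. {x, v} \<in> H \<and> U' {x, v} < U' e}"
      proof
        fix x assume "x \<in> {x. {x, v} \<in> opened k U \<and> U {x, v} < U e}"
        then have x: "{x, v} \<in> opened k U" "U {x, v} < U e" by auto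
        then have G: "{x, v} \<in> config k t U"
          using less.prems Ue by (simp add: config_def)
        have "{x, v} \<in> lattice_edges"
          using x(1) opened_subset by blast
        then have "{x, v} \<notin> touch D"
          by (rule eD) (use v(1) in auto)
        with G H(2) have "{x, v} \<in> H"
          by blast
        with keep[OF this G] x(2) Ue show "x \<in> {x. {x, v} \<in> H \<and> U' {x, v} < U' e}"
          by simp
      qed
      have "finite {x. {x, v} \<in> H \<and> U' {x, v} < U' e}"
        by (rule finite_subset[OF _ finite_open_nbrs[OF H(1), of v]]) auto
      from card_mono[OF this sub] v have "\<not> card {x. {x, v} \<in> H \<and> U' {x, v} < U' e} < k"
        by simp
      with iff v(1) False show ?thesis by blast
    qed
  qed
  show ?thesis
  proof (intro set_eqI iffI)
    fix e assume e: "e \<in> config k t U'"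
    then have "e \<in> lattice_edges" "U' e \<le> t" "e \<in> opened k U'"
      using config_subset by (auto simp: config_def)
    with main show "e \<in> H" by blast
  next
    fix e assume "e \<in> H"
    with main[of e] early[of e] H(1) show "e \<in> config k t U'"
      by (auto simp: config_def)
  qed
qed

text \<open>The restriction keeps the result in the extensional function space that carries the
  product measure.\<close>

definition shift_clocks :: "int ^ 'd \<Rightarrow> ((int ^ 'd) set \<Rightarrow> real) \<Rightarrow> (int ^ 'd) set \<Rightarrow> real" where
  "shift_clocks a U = (\<lambda>e\<in>lattice_edges. U ((\<lambda>v. v + a) ` e))"

lemma translate_edge [simp]: "(\<lambda>v. v + a) ` e \<in> lattice_edges \<longleftrightarrow> e \<in> lattice_edges"
proof
  assume "e \<in> lattice_edges"
  then show "(\<lambda>v. v + a) ` e \<in> lattice_edges"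
    unfolding lattice_edges_def by fastforce
next
  assume "(\<lambda>v. v + a) ` e \<in> lattice_edges"
  then have "(\<lambda>v. v + (- a)) ` (\<lambda>v. v + a) ` e \<in> lattice_edges"
    unfolding lattice_edges_def by fastforce
  then show "e \<in> lattice_edges"
    by (simp add: image_image)
qed

lemma stage_shift: "e \<in> stage k (shift_clocks a U) n \<longleftrightarrow> (\<lambda>v. v + a) ` e \<in> stage k U n"
proof (induction n arbitrary: e)
  case (Suc n)
  have "card {x. {x, v} \<in> stage k (shift_clocks a U) n \<and> shift_clocks a U {x, v} < shift_clocks a U e}
    = card {x. {x, v + a} \<in> stage k U n \<and> U {x, v + a} < U ((\<lambda>v. v + a) ` e)}"
    if e: "e \<in> lattice_edges" for v
  proof (rule bij_betw_same_card[of "\<lambda>x. x + a"], rule bij_betw_byWitness[where f' = "\<lambda>x. x - a"])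
    have "{x + a, v + a} \<in> stage k U n \<and> U {x + a, v + a} < U ((\<lambda>v. v + a) ` e)"
      if x: "{x, v} \<in> stage k (shift_clocks a U) n" "shift_clocks a U {x, v} < shift_clocks a U e" for x
    proof -
      have "{x, v} \<in> lattice_edges"
        using x(1) stage_subset by blast
      then show ?thesis
        using x e by (simp add: Suc) (simp add: shift_clocks_def)
    qed
    then show "(\<lambda>x. x + a) ` {x. {x, v} \<in> stage k (shift_clocks a U) n \<and> shift_clocks a U {x, v} < shift_clocks a U e}
      \<subseteq> {x. {x, v + a} \<in> stage k U n \<and> U {x, v + a} < U ((\<lambda>v. v + a) ` e)}"
      by blast
    have "{x - a, v} \<in> stage k (shift_clocks a U) n \<and> shift_clocks a U {x - a, v} < shift_clocks a U e"
      if x: "{x, v + a} \<in> stage k U n" "U {x, v + a} < U ((\<lambda>v. v + a) ` e)" for x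
    proof -
      have "{x - a, v} \<in> stage k (shift_clocks a U) n"
        using x(1) by (simp add: Suc)
      moreover from this have "{x - a, v} \<in> lattice_edges"
        using stage_subset by blast
      ultimately show ?thesis
        using x(2) e by (simp add: shift_clocks_def)
    qed
    then show "(\<lambda>x. x - a) ` {x. {x, v + a} \<in> stage k U n \<and> U {x, v + a} < U ((\<lambda>v. v + a) ` e)}
      \<subseteq> {x. {x, v} \<in> stage k (shift_clocks a U) n \<and> shift_clocks a U {x, v} < shift_clocks a U e}"
      by blast
  qed auto
  then show ?case
    by auto
qed simp

lemma config_shift: "e \<in> config k t (shift_clocks a U) \<longleftrightarrow> (\<lambda>v. v + a) ` e \<in> config k t U"
proof (cases "e \<in> lattice_edges")
  case True
  then show ?thesis
    by (simp add: config_def opened_def stage_shift) (simp add: shift_clocks_def)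
next
  case False
  then have "e \<notin> config k t (shift_clocks a U)" "(\<lambda>v. v + a) ` e \<notin> config k t U"
    using config_subset translate_edge by blast+
  then show ?thesis by simp
qed

section \<open>Surgery on open graphs\<close>

lemma avoid_lattice: "G \<subseteq> lattice_edges \<Longrightarrow> avoid G D = G - touch D"
  by (auto simp: avoid_def touch_def)

text \<open>At a vertex of \<open>D\<close> all edges of the new graph come from \<open>P\<close>;
  at a vertex outside \<open>D\<close> they all come from \<open>G\<close>, since the edges that
  \<open>P\<close> adds lie inside \<open>D\<close>. So the two degree bounds never add up.\<close>

lemma surgery_graph:
  fixes G :: "(int ^ 'd::finite) set set"
  assumes G: "G \<subseteq> lattice_edges" "\<And>v. degree_in G v \<le> k"
    and P: "P \<subseteq> G \<union> {e \<in> lattice_edges. e \<subseteq> D}" "\<And>v. degree_in P v \<le> k"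
  shows "avoid G D \<union> P \<subseteq> lattice_edges" "(avoid G D \<union> P) - touch D = G - touch D"
    "degree_in (avoid G D \<union> P) v \<le> k"
proof -
  show "avoid G D \<union> P \<subseteq> lattice_edges"
    using G P by (auto simp: avoid_def)
  have "e \<in> touch D" if e: "e \<in> lattice_edges" "e \<subseteq> D" for e
  proof -
    obtain a b where "e = {a, b}"
      using lattice_edge_cases[OF e(1)] .
    with e show ?thesis
      by (auto simp: touch_def)
  qed
  then show "(avoid G D \<union> P) - touch D = G - touch D"
    using P(1) G(1) by (auto simp: avoid_lattice)
  show "degree_in (avoid G D \<union> P) v \<le> k"
  proof (cases "v \<in> D")
    case True
    then have "{x. {x, v} \<in> avoid G D \<union> P} = {x. {x, v} \<in> P}"
      by (auto simp: avoid_def)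
    then show ?thesis
      using P(2)[of v] by (simp add: degree_in_def)
  next
    case False
    then have "{x. {x, v} \<in> avoid G D \<union> P} \<subseteq> {x. {x, v} \<in> G}"
      using P(1) by (auto simp: avoid_def)
    then have "degree_in (avoid G D \<union> P) v \<le> degree_in G v"
      unfolding degree_in_def by (intro card_mono finite_open_nbrs[OF G(1)])
    then show ?thesis
      using G(2)[of v] by simp
  qed
qed

text \<open>Inside \<open>D\<close> only a simple path is kept, which has degree at most two; all
  other edges that meet \<open>D\<close> are removed to make room for it.\<close>

lemma connecting_surgery:
  fixes G :: "(int ^ 'd::finite) set set"
  assumes G: "G \<subseteq> lattice_edges" "\<And>v. degree_in G v \<le> k" and "2 \<le> k"
    and "connected_in (G \<union> {e \<in> lattice_edges. e \<subseteq> D}) x y"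
  obtains H where "H \<subseteq> lattice_edges" "H - touch D = G - touch D" "\<And>v. degree_in H v \<le> k"
    "connected_in H x y"
proof -
  obtain xs where xs: "xs \<noteq> []" "hd xs = x" "last xs = y" "distinct xs"
    "path_edges xs \<subseteq> G \<union> {e \<in> lattice_edges. e \<subseteq> D}"
    using assms(4) by (rule connected_in_path)
  have deg: "degree_in (path_edges xs) v \<le> k" for v
    using degree_in_path_edges(1)[OF xs(4), of v] assms(3) by simp
  note H = surgery_graph[OF G xs(5) deg]
  have "connected_in (avoid G D \<union> path_edges xs) x y"
    using xs(1-3) by (intro path_edges_connected[of xs]) auto
  with H that show thesis by blast
qed

text \<open>Up to the finite set \<open>D\<close>, the cluster is covered by the clusters outside
  \<open>D\<close> of the finitely many vertices \<open>N\<close> through which it leaves; one of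
  these must be infinite.\<close>

lemma infinite_cluster_leaves:
  fixes G :: "(int ^ 'd::finite) set set"
  assumes G: "G \<subseteq> lattice_edges" and D: "finite D" and "infinite (cluster_in G v)" "v \<in> D"
  obtains u w where "u \<notin> D" "w \<in> D" "{u, w} \<in> G" "connected_in G v w"
    "infinite (cluster_in (avoid G D) u)"
proof -
  define N where "N = {u. u \<notin> D \<and> (\<exists>w\<in>D. {u, w} \<in> G \<and> connected_in G v w)}"
  have "y \<in> cluster_in G v \<inter> (D \<union> (\<Union>u\<in>N. cluster_in (avoid G D) u))" if "connected_in G v y" for y
  proof (rule connected_in_closed[OF that])
    show "v \<in> cluster_in G v \<inter> (D \<union> (\<Union>u\<in>N. cluster_in (avoid G D) u))"
      using assms(4) by simp
  next
    fix y z assume e: "{y, z} \<in> G" and y: "y \<in> cluster_in G v \<inter> (D \<union> (\<Union>u\<in>N. cluster_in (avoid G D) u))"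
    then have z: "connected_in G v z"
      using connected_in_step[of G v y z] by simp
    have "z \<in> D \<union> (\<Union>u\<in>N. cluster_in (avoid G D) u)"
    proof (cases "z \<in> D")
      case False
      show ?thesis
      proof (cases "y \<in> D")
        case True
        then have "z \<in> N"
          using False e y by (auto simp: N_def insert_commute)
        moreover have "z \<in> cluster_in (avoid G D) z"
          by simp
        ultimately show ?thesis by blast
      next
        case yD: False
        then obtain u where u: "u \<in> N" "connected_in (avoid G D) u y"
          using y by auto
        then have "connected_in (avoid G D) u z"
          using e False yD by (intro connected_in_step[of _ u y z]) (auto simp: avoid_def)
        with u(1) show ?thesis by auto
      qed
    qed simp
    with z show "z \<in> cluster_in G v \<inter> (D \<union> (\<Union>u\<in>N. cluster_in (avoid G D) u))"
      by simp
  qed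
  then have sub: "cluster_in G v \<subseteq> D \<union> (\<Union>u\<in>N. cluster_in (avoid G D) u)"
    by (auto simp: cluster_in_def)
  have "N \<subseteq> (\<Union>w\<in>D. {u. {u, w} \<in> G})"
    by (auto simp: N_def)
  then have "finite N"
    using D finite_open_nbrs[OF G] by (auto intro: finite_subset)
  have "\<exists>u\<in>N. infinite (cluster_in (avoid G D) u)"
  proof (rule ccontr)
    assume "\<not> ?thesis"
    then have "finite (D \<union> (\<Union>u\<in>N. cluster_in (avoid G D) u))"
      using D \<open>finite N\<close> by blast
    with sub assms(3) show False
      using finite_subset by blast
  qed
  then show thesis
    using that by (auto simp: N_def)
qed

text \<open>Keep one edge at \<open>v\<close>, chosen to lead into an infinite part of what remains
  without \<open>v\<close>, and delete the others. Degrees only decrease, so \<open>k\<close> is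
  arbitrary.\<close>

lemma endpoint_surgery:
  fixes G :: "(int ^ 'd::finite) set set"
  assumes G: "G \<subseteq> lattice_edges" "\<And>v. degree_in G v \<le> k"
    and "infinite (cluster_in G v)"
  obtains H where "H \<subseteq> lattice_edges" "H - touch {v} = G - touch {v}" "\<And>v. degree_in H v \<le> k"
    "endpoint H v"
proof -
  have "finite {v}" "v \<in> {v}"
    by auto
  then obtain u where u: "u \<noteq> v" "{u, v} \<in> G" "infinite (cluster_in (avoid G {v}) u)"
    using infinite_cluster_leaves[OF G(1) _ assms(3), of "{v}"] by auto
  have "degree_in {{u, v}} w \<le> degree_in G w" for w
    by (intro degree_in_mono finite_open_nbrs[OF G(1)]) (use u in auto)
  then have deg: "degree_in {{u, v}} w \<le> k" for w
    using G(2) order_trans by blast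
  have "{{u, v}} \<subseteq> G \<union> {e \<in> lattice_edges. e \<subseteq> {v}}"
    using u by simp
  note H = surgery_graph[OF G this deg]
  define H where "H = avoid G {v} \<union> {{u, v}}"
  have "cluster_in (avoid G {v}) u \<subseteq> cluster_in H v"
  proof
    fix y assume "y \<in> cluster_in (avoid G {v}) u"
    then have "connected_in H u y"
      using connected_in_mono[of "avoid G {v}" u y H] by (auto simp: H_def)
    moreover have "connected_in H v u"
      by (intro connected_in_edge) (simp add: H_def insert_commute)
    ultimately show "y \<in> cluster_in H v"
      using connected_in_trans[of H v u y] by simp
  qed
  then have "infinite (cluster_in H v)"
    using u(3) finite_subset by blast
  moreover have "\<forall>x. {x, v} \<in> H \<longrightarrow> x = u"
    using u(1) by (auto simp: H_def avoid_def doubleton_eq_iff)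
  ultimately have "endpoint H v"
    unfolding endpoint_def by blast
  with H[folded H_def] that show thesis by blast
qed

lemma path_edges_avoid_hd: "e \<in> path_edges (t # p) \<Longrightarrow> t \<notin> e \<Longrightarrow> e \<in> path_edges p"
  by (cases p) auto

text \<open>Without \<open>t\<close>, the arm \<open>p\<close> can be left only through its tip
  \<open>u\<close> into the cluster of \<open>u\<close> outside \<open>D\<close>; that cluster
  misses the other arms because their tips belong to other clusters of \<open>G\<close>. Stated for
  one arm and used for all three after permuting them.\<close>

lemma tripod_branch:
  fixes G :: "(int ^ 'd::finite) set set"
  assumes H: "H = avoid G D \<union> (path_edges (t # p) \<union> path_edges (t # q) \<union> path_edges (t # r))"
    and t: "t \<in> D" "distinct (t # p @ q @ r)"
    and sub: "set p \<subseteq> insert u D" "set q \<subseteq> insert u' D" "set r \<subseteq> insert u'' D"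
    and p: "p \<noteq> []" "last p = u" and inf: "infinite (cluster_in (avoid G D) u)"
    and sep: "\<not> connected_in G u u'" "\<not> connected_in G u u''"
  shows "infinite (cluster_in (avoid H {t}) (hd p))"
    and "cluster_in (avoid H {t}) (hd p) \<subseteq> cluster_in (avoid G D) u \<union> set p"
proof -
  have X: "cluster_in (avoid G D) u \<inter> D = {}"
    using infinite_cluster_avoids[OF inf] .
  have "u' \<notin> cluster_in (avoid G D) u" "u'' \<notin> cluster_in (avoid G D) u"
    using sep connected_in_mono[of "avoid G D" u _ G] avoid_subset[of G D] by auto
  then have Xqr: "cluster_in (avoid G D) u \<inter> (set q \<union> set r) = {}"
    using X sub by blast
  have uD: "u \<notin> D"
    using X connected_in_refl[of "avoid G D" u] by (auto simp del: connected_in_refl)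
  show "cluster_in (avoid H {t}) (hd p) \<subseteq> cluster_in (avoid G D) u \<union> set p"
  proof
    fix y assume "y \<in> cluster_in (avoid H {t}) (hd p)"
    then have "connected_in (avoid H {t}) (hd p) y" by simp
    then show "y \<in> cluster_in (avoid G D) u \<union> set p"
    proof (rule connected_in_closed)
      show "hd p \<in> cluster_in (avoid G D) u \<union> set p"
        using p by simp
    next
      fix x y assume e: "{x, y} \<in> avoid H {t}" and x: "x \<in> cluster_in (avoid G D) u \<union> set p"
      have nt: "t \<notin> {x, y}"
        using e by (auto simp: avoid_def)
      have "{x, y} \<in> H"
        using e by (auto simp: avoid_def)
      then consider "{x, y} \<in> avoid G D" | "{x, y} \<in> path_edges p" | "{x, y} \<in> path_edges q"
        | "{x, y} \<in> path_edges r"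
        unfolding H using path_edges_avoid_hd[OF _ nt] by blast
      then show "y \<in> cluster_in (avoid G D) u \<union> set p"
      proof cases
        case 1
        then have "x \<notin> D"
          by (auto simp: avoid_def)
        then have "x \<in> cluster_in (avoid G D) u"
          using x sub(1) by auto
        then show ?thesis
          using connected_in_step[of "avoid G D" u x y] 1 by simp
      next
        case 2
        then show ?thesis
          using path_edges_subset[of _ p] by blast
      next
        case 3
        then have "x \<in> set q"
          using path_edges_subset[of _ q] by blast
        then show ?thesis
          using x Xqr t(2) by auto
      next
        case 4
        then have "x \<in> set r"
          using path_edges_subset[of _ r] by blast
        then show ?thesis
          using x Xqr t(2) by auto
      qed
    qed
  qed
  have "e \<in> avoid H {t}" if "e \<in> path_edges p" for e
    using that path_edges_subset[OF that] t(2) p(1) by (auto simp: H avoid_def path_edges_Cons)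
  then have "connected_in (avoid H {t}) (hd p) u"
    using p by (intro path_edges_connected[of p]) auto
  then have "cluster_in (avoid H {t}) (hd p) = cluster_in (avoid H {t}) u"
    by (rule cluster_in_eq)
  moreover have "avoid G D \<subseteq> avoid H {t}"
    using t(1) by (auto simp: H avoid_def)
  then have "cluster_in (avoid G D) u \<subseteq> cluster_in (avoid H {t}) u"
    by (auto intro: connected_in_mono)
  ultimately show "infinite (cluster_in (avoid H {t}) (hd p))"
    using inf finite_subset by metis
qed

lemma path_edges_vertex:
  assumes "p \<noteq> []" "x \<in> set (t # p)"
  obtains e where "e \<in> path_edges (t # p)" "x \<in> e"
proof -
  have "\<exists>e. e \<in> path_edges (t # p) \<and> x \<in> e"
    using assms
  proof (induction p arbitrary: t)
    case (Cons s p)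
    then show ?case
    proof (cases "x = t \<or> x = s")
      case True
      then show ?thesis
        by (intro exI[of _ "{t, s}"]) auto
    next
      case False
      with Cons obtain e where "e \<in> path_edges (s # p)" "x \<in> e"
        by (cases p) auto
      then show ?thesis by auto
    qed
  qed simp
  then show thesis
    using that by blast
qed

text \<open>Replace everything at \<open>D\<close> by a tripod whose tips \<open>u1\<close>,
  \<open>u2\<close>, \<open>u3\<close> lie just outside \<open>D\<close>, in three different
  infinite clusters. Its centre becomes the trifurcation, at a position that depends on
  \<open>G\<close>.\<close>

lemma trifurcation_surgery:
  fixes G :: "(int ^ 'd::finite) set set"
  assumes G: "G \<subseteq> lattice_edges" "\<And>v. degree_in G v \<le> k" and "3 \<le> k"
    and D: "finite D" "\<And>y z. y \<in> D \<Longrightarrow> z \<in> D \<Longrightarrow> connected_in {e \<in> lattice_edges. e \<subseteq> D} y z"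
    and abc: "a \<in> D" "b \<in> D" "c \<in> D"
    and inf: "infinite (cluster_in G a)" "infinite (cluster_in G b)" "infinite (cluster_in G c)"
    and sep: "\<not> connected_in G a b" "\<not> connected_in G a c" "\<not> connected_in G b c"
  obtains H t where "t \<in> D" "H \<subseteq> lattice_edges" "H - touch D = G - touch D"
    "\<And>v. degree_in H v \<le> k" "trifurcation H t"
proof -
  obtain u1 w1 where 1: "u1 \<notin> D" "w1 \<in> D" "{u1, w1} \<in> G" "connected_in G a w1"
    "infinite (cluster_in (avoid G D) u1)"
    by (rule infinite_cluster_leaves[OF G(1) D(1) inf(1) abc(1)])
  obtain u2 w2 where 2: "u2 \<notin> D" "w2 \<in> D" "{u2, w2} \<in> G" "connected_in G b w2"
    "infinite (cluster_in (avoid G D) u2)"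
    by (rule infinite_cluster_leaves[OF G(1) D(1) inf(2) abc(2)])
  obtain u3 w3 where 3: "u3 \<notin> D" "w3 \<in> D" "{u3, w3} \<in> G" "connected_in G c w3"
    "infinite (cluster_in (avoid G D) u3)"
    by (rule infinite_cluster_leaves[OF G(1) D(1) inf(3) abc(3)])
  have cu: "connected_in G a u1" "connected_in G b u2" "connected_in G c u3"
    using 1(3,4) 2(3,4) 3(3,4) connected_in_step by (metis insert_commute)+
  have sepu: "\<not> connected_in G u1 u2" "\<not> connected_in G u1 u3" "\<not> connected_in G u2 u3"
    "\<not> connected_in G u2 u1" "\<not> connected_in G u3 u1" "\<not> connected_in G u3 u2"
    using cu sep connected_in_trans connected_in_sym by metis+
  then have ne: "u1 \<noteq> u2" "u1 \<noteq> u3" "u2 \<noteq> u3"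
    by auto
  \<comment> \<open>All edges inside \<open>D\<close>, open or not, together with the three open
    exit edges: each tip is then a leaf of \<open>K\<close>.\<close>
  define K where "K = {e \<in> lattice_edges. e \<subseteq> D} \<union> {{u1, w1}, {u2, w2}, {u3, w3}}"
  have KD: "connected_in K y z" if "y \<in> D" "z \<in> D" for y z
    by (rule connected_in_mono[OF D(2)[OF that]]) (auto simp: K_def)
  have Ke: "connected_in K u1 w1" "connected_in K w2 u2" "connected_in K w3 u3"
    by (intro connected_in_edge; simp add: K_def insert_commute)+
  have K12: "connected_in K u1 u2"
    using Ke KD[OF 1(2) 2(2)] connected_in_trans by metis
  have K13: "connected_in K u1 u3"
    using Ke KD[OF 1(2) 3(2)] connected_in_trans by metis
  obtain t p q r where T: "distinct (t # p @ q @ r)"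
    "last (t # p) = u1" "last (t # q) = u2" "last (t # r) = u3"
    "path_edges (t # p) \<union> path_edges (t # q) \<union> path_edges (t # r) \<subseteq> K"
    by (rule tripod_exists[OF K12 K13])
  have leaf: "x = y" if "{u, x} \<in> K" "{u, y} \<in> K" "u \<in> {u1, u2, u3}" for u x y
  proof -
    have "u \<notin> D" using that(3) 1(1) 2(1) 3(1) by auto
    then have "{u, x} \<in> {{u1, w1}, {u2, w2}, {u3, w3}}" "{u, y} \<in> {{u1, w1}, {u2, w2}, {u3, w3}}"
      using that(1,2) by (auto simp: K_def)
    then show ?thesis
      using that(3) ne 1(1,2) 2(1,2) 3(1,2) by (auto simp: doubleton_eq_iff)
  qed
  have hdK: "{t, hd s} \<in> K" if "s \<noteq> []" "path_edges (t # s) \<subseteq> K" for s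
    using that by (simp add: path_edges_Cons)
  have pK: "path_edges (t # p) \<subseteq> K" "path_edges (t # q) \<subseteq> K" "path_edges (t # r) \<subseteq> K"
    using T(5) by auto
  have diff: "hd s \<noteq> hd s'" if "s \<noteq> []" "s' \<noteq> []" "set s \<inter> set s' = {}" for s s' :: "(int ^ 'd) list"
    using that by (metis disjoint_iff hd_in_set)
  have dj: "set p \<inter> set q = {}" "set p \<inter> set r = {}" "set q \<inter> set r = {}"
    "t \<notin> set p" "t \<notin> set q" "t \<notin> set r"
    using T(1) by auto
  \<comment> \<open>Two nonempty arms start with different edges at \<open>t\<close>, which is
    impossible at a leaf. If \<open>t\<close> were a tip, two arms would thus be empty and two tips
    would coincide.\<close>
  have tu: "t \<notin> {u1, u2, u3}"
  proof
    assume tu: "t \<in> {u1, u2, u3}"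
    have *: "p = [] \<or> q = []" "p = [] \<or> r = []" "q = [] \<or> r = []"
      using leaf[OF hdK[of p] hdK[of q] tu] leaf[OF hdK[of p] hdK[of r] tu]
        leaf[OF hdK[of q] hdK[of r] tu] diff[of p q] diff[of p r] diff[of q r] pK dj by blast+
    have "s = [] \<Longrightarrow> last (t # s) = t" for s by simp
    then show False
      using * T(2-4) ne by metis
  qed
  then have nonempty: "p \<noteq> []" "q \<noteq> []" "r \<noteq> []"
    using T(2-4) by auto
  have Kvert: "x \<in> D \<union> {u1, u2, u3}" if "e \<in> K" "x \<in> e" for e x
    using that 1(2) 2(2) 3(2) by (auto simp: K_def)
  have pv: "set (t # s) \<subseteq> D \<union> {u1, u2, u3}" if s: "s \<noteq> []" "path_edges (t # s) \<subseteq> K" for s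
  proof
    fix x assume "x \<in> set (t # s)"
    then obtain e where "e \<in> path_edges (t # s)" "x \<in> e"
      by (rule path_edges_vertex[OF s(1)])
    then show "x \<in> D \<union> {u1, u2, u3}"
      using s(2) Kvert by blast
  qed
  have t: "t \<in> D"
    using pv[OF nonempty(1) pK(1)] tu by auto
  have la: "last p = u1" "last q = u2" "last r = u3"
    using T(2-4) nonempty by auto
  have "u1 \<in> set p" "u2 \<in> set q" "u3 \<in> set r"
    using la nonempty last_in_set by metis+
  then have sub: "set p \<subseteq> insert u1 D" "set q \<subseteq> insert u2 D" "set r \<subseteq> insert u3 D"
    using pv[OF nonempty(1) pK(1)] pv[OF nonempty(2) pK(2)] pv[OF nonempty(3) pK(3)] dj
    by auto
  define P where "P = path_edges (t # p) \<union> path_edges (t # q) \<union> path_edges (t # r)"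
  define H where "H = avoid G D \<union> P"
  have "P \<subseteq> G \<union> {e \<in> lattice_edges. e \<subseteq> D}"
    using T(5) 1(3) 2(3) 3(3) unfolding P_def K_def by blast
  moreover have "degree_in P v \<le> k" for v
    using degree_in_tripod[OF T(1), of v] assms(3) by (simp add: P_def)
  ultimately have HG: "H \<subseteq> lattice_edges" "H - touch D = G - touch D" "\<And>v. degree_in H v \<le> k"
    unfolding H_def by (rule surgery_graph[OF G])+
  have H1: "H = avoid G D \<union> (path_edges (t # p) \<union> path_edges (t # q) \<union> path_edges (t # r))"
    by (simp add: H_def P_def)
  have H2: "H = avoid G D \<union> (path_edges (t # q) \<union> path_edges (t # p) \<union> path_edges (t # r))"
    and H3: "H = avoid G D \<union> (path_edges (t # r) \<union> path_edges (t # p) \<union> path_edges (t # q))"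
    unfolding H1 by blast+
  have T2: "distinct (t # q @ p @ r)" and T3: "distinct (t # r @ p @ q)"
    using T(1) by auto
  note b1 = tripod_branch[OF H1 t T(1) sub nonempty(1) la(1) 1(5) sepu(1,2)]
  note b2 = tripod_branch[OF H2 t T2 sub(2,1,3) nonempty(2) la(2) 2(5) sepu(4,3)]
  note b3 = tripod_branch[OF H3 t T3 sub(3,1,2) nonempty(3) la(3) 3(5) sepu(5,6)]
  have apart: "\<not> connected_in (avoid H {t}) (hd s) (hd s')"
    if "cluster_in (avoid H {t}) (hd s) \<subseteq> cluster_in (avoid G D) u \<union> set s"
      "set s \<inter> set s' = {}" "s' \<noteq> []" "set s' \<subseteq> insert u' D" "\<not> connected_in G u u'"
      "infinite (cluster_in (avoid G D) u)" for s s' u u'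
  proof
    assume "connected_in (avoid H {t}) (hd s) (hd s')"
    then have "hd s' \<in> cluster_in (avoid G D) u \<union> set s"
      using that(1) by auto
    moreover have "hd s' \<in> set s'"
      using that(3) by simp
    ultimately have "hd s' \<in> cluster_in (avoid G D) u" "hd s' \<in> insert u' D"
      using that(2,4) by auto
    moreover have "cluster_in (avoid G D) u \<inter> D = {}"
      using infinite_cluster_avoids[OF that(6)] .
    moreover have "u' \<notin> cluster_in (avoid G D) u"
      using that(5) connected_in_mono[of "avoid G D" u _ G] avoid_subset[of G D] by auto
    ultimately show False by auto
  qed
  have adj: "{hd s, t} \<in> H" if "s \<noteq> []" "path_edges (t # s) \<subseteq> H" for s
    using that by (simp add: path_edges_Cons insert_commute)
  have "trifurcation H t"
    unfolding trifurcation_def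
  proof (intro exI conjI)
    show "{hd p, t} \<in> H" "{hd q, t} \<in> H" "{hd r, t} \<in> H"
      by (rule adj[OF nonempty(1)] adj[OF nonempty(2)] adj[OF nonempty(3)]; use H1 in blast)+
    show "\<not> connected_in (avoid H {t}) (hd p) (hd q)"
      by (rule apart[OF b1(2) dj(1) nonempty(2) sub(2) sepu(1) 1(5)])
    show "\<not> connected_in (avoid H {t}) (hd p) (hd r)"
      by (rule apart[OF b1(2) dj(2) nonempty(3) sub(3) sepu(2) 1(5)])
    show "\<not> connected_in (avoid H {t}) (hd q) (hd r)"
      by (rule apart[OF b2(2) dj(3) nonempty(3) sub(3) sepu(3) 2(5)])
  qed (rule b1(1) b2(1) b3(1))+
  with t HG that show thesis by blast
qed

section \<open>The law of the clocks\<close>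

lemma prob_space_unit: "prob_space (restrict_space lborel {0..1::real})"
  by (rule prob_spaceI) (simp add: emeasure_restrict_space space_restrict_space)

text \<open>The law before completion. Measurability is settled here and carried over to
  \<open>clock_law\<close> at the end.\<close>

definition clocks :: "((int ^ 'd) set \<Rightarrow> real) measure" where
  "clocks = (\<Pi>\<^sub>M e\<in>lattice_edges. restrict_space lborel {0..1})"

interpretation clock: product_prob_space "\<lambda>_. restrict_space lborel {0..1::real}"
  "lattice_edges :: (int ^ 'd::finite) set set"
  by (intro product_prob_spaceI prob_space_unit)

interpretation clocks: prob_space "clocks :: ((int ^ 'd::finite) set \<Rightarrow> real) measure"
  unfolding clocks_def by (rule clock.prob_space_axioms)

lemma countable_lattice_edges: "countable (lattice_edges :: (int ^ 'd::finite) set set)"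
proof (rule countable_subset)
  show "(lattice_edges :: (int ^ 'd) set set) \<subseteq> range (\<lambda>(u, v). {u, v})"
    unfolding lattice_edges_def by auto
qed simp

lemma clock_bounds: "U \<in> space clocks \<Longrightarrow> e \<in> lattice_edges \<Longrightarrow> 0 \<le> U e \<and> U e \<le> 1"
  by (auto simp: clocks_def space_PiM space_restrict_space PiE_def Pi_def)

lemma measurable_clock [measurable]: "e \<in> lattice_edges \<Longrightarrow> (\<lambda>U. U e) \<in> borel_measurable clocks"
proof -
  assume "e \<in> lattice_edges"
  then have "(\<lambda>U. U e) \<in> measurable clocks (restrict_space lborel {0..1})"
    unfolding clocks_def by measurable
  then show ?thesis
    by (auto simp: measurable_restrict_space2_iff)
qed

lemma prob_cylinder:
  assumes "finite J" "J \<subseteq> lattice_edges" "\<And>e. e \<in> J \<Longrightarrow> X e \<in> sets borel"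
  shows "clocks.prob {U \<in> space clocks. \<forall>e\<in>J. U e \<in> X e} = (\<Prod>e\<in>J. measure lborel (X e \<inter> {0..1}))"
proof -
  have X: "X e \<inter> {0..1} \<in> sets (restrict_space lborel {0..1})" if "e \<in> J" for e
    using assms(3)[OF that] by (auto simp: sets_restrict_space)
  have "{U \<in> space clocks. \<forall>e\<in>J. U e \<in> X e} = {U \<in> space clocks. \<forall>e\<in>J. U e \<in> X e \<inter> {0..1}}"
    using clock_bounds assms(2) by auto
  also have "emeasure clocks \<dots> = (\<Prod>e\<in>J. emeasure (restrict_space lborel {0..1}) (X e \<inter> {0..1}))"
    unfolding clocks_def by (rule clock.emeasure_PiM_Collect[OF assms(2,1) X])
  also have "\<dots> = (\<Prod>e\<in>J. emeasure lborel (X e \<inter> {0..1}))"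
    by (intro prod.cong refl emeasure_restrict_space) auto
  also have "\<dots> = (\<Prod>e\<in>J. ennreal (measure lborel (X e \<inter> {0..1})))"
  proof (intro prod.cong refl emeasure_eq_ennreal_measure)
    fix e
    have "emeasure lborel (X e \<inter> {0..1}) \<le> emeasure lborel {0..1::real}"
      by (intro emeasure_mono) auto
    then show "emeasure lborel (X e \<inter> {0..1}) \<noteq> \<top>"
      by (auto simp: top_unique)
  qed
  finally show ?thesis
    by (simp add: clocks.emeasure_eq_measure prod_ennreal prod_nonneg)
qed

text \<open>Half-open windows tile the line. The bound is an inequality because a window may stick
  out of the unit interval.\<close>

lemma prob_cylinder_interval:
  assumes "finite J" "J \<subseteq> lattice_edges" "a \<le> b"
  shows "clocks.prob {U \<in> space clocks. \<forall>e\<in>J. a \<le> U e \<and> U e < b} \<le> (b - a) ^ card J"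
proof -
  have "clocks.prob {U \<in> space clocks. \<forall>e\<in>J. U e \<in> {a..<b}} = (\<Prod>e\<in>J. measure lborel ({a..<b} \<inter> {0..1}))"
    by (rule prob_cylinder) (use assms in auto)
  also have "\<dots> \<le> (\<Prod>e\<in>J. b - a)"
  proof (intro prod_mono conjI)
    have "measure lborel ({a..<b} \<inter> {0..1}) \<le> measure lborel {a..<b}"
      by (rule measure_mono_fmeasurable) (use assms(3) in \<open>auto simp: fmeasurable_def\<close>)
    then show "measure lborel ({a..<b} \<inter> {0..1}) \<le> b - a"
      using assms(3) by simp
  qed simp
  finally show ?thesis
    by simp
qed

section \<open>Almost surely no infinite chain of decreasing clocks\<close>

fun edge_paths :: "(int ^ 'd) set \<Rightarrow> nat \<Rightarrow> (int ^ 'd) set list set" where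
  "edge_paths e 0 = {[e]}"
| "edge_paths e (Suc n) = (\<Union>f\<in>touch e. (#) e ` edge_paths f n)"

lemma finite_edge: "e \<in> lattice_edges \<Longrightarrow> finite e"
  by (auto elim: lattice_edge_cases)

text \<open>An edge has two ends with at most \<open>3 ^ CARD('d)\<close> neighbours each, so each
  step of a path of edges has at most \<open>2 * 3 ^ CARD('d)\<close> choices.\<close>

lemma edge_paths_props:
  "e \<in> lattice_edges \<Longrightarrow> finite (edge_paths e n) \<and> card (edge_paths e n) \<le> (2 * 3 ^ CARD('d)) ^ n \<and>
    (\<forall>p\<in>edge_paths e n. length p = Suc n \<and> set p \<subseteq> lattice_edges)" for e :: "(int ^ 'd::finite) set"
proof (induction n arbitrary: e)
  case (Suc n)
  have fin: "finite (touch e)"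
    using finite_touch[OF finite_edge[OF Suc.prems]] .
  have IH: "finite (edge_paths f n)" "card (edge_paths f n) \<le> (2 * 3 ^ CARD('d)) ^ n"
    "\<forall>p\<in>edge_paths f n. length p = Suc n \<and> set p \<subseteq> lattice_edges" if "f \<in> touch e" for f
    using Suc.IH[of f] that by (auto simp: touch_def)
  have "card e = 2"
    using Suc.prems by (auto elim!: lattice_edge_cases)
  then have ct: "card (touch e) \<le> 2 * 3 ^ CARD('d)"
    using card_touch[OF finite_edge[OF Suc.prems]] by simp
  have "card (edge_paths e (Suc n)) \<le> (\<Sum>f\<in>touch e. card ((#) e ` edge_paths f n))"
    using card_UN_le[OF fin] by simp
  also have "\<dots> \<le> (\<Sum>f\<in>touch e. (2 * 3 ^ CARD('d)) ^ n)"
    by (intro sum_mono order_trans[OF card_image_le IH(2)] IH(1))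
  also have "\<dots> = card (touch e) * (2 * 3 ^ CARD('d)) ^ n"
    by simp
  also have "\<dots> \<le> (2 * 3 ^ CARD('d)) ^ Suc n"
    unfolding power_Suc by (rule mult_right_mono[OF ct]) simp
  finally show ?case
    using fin IH(1,3) Suc.prems by auto
qed auto

lemma decreasing_path:
  assumes "\<And>i. (f (Suc i), f i) \<in> earlier U"
  shows "map f [i..<Suc (i + n)] \<in> edge_paths (f i) n"
proof (induction n arbitrary: i)
  case (Suc n)
  have "f (Suc i) \<in> touch (f i)"
    using assms[of i] by (auto simp: earlier_def touch_def)
  then have "f i # map f [Suc i..<Suc (Suc i + n)] \<in> edge_paths (f i) (Suc n)"
    unfolding edge_paths.simps by (rule UN_I) (rule imageI[OF Suc[of "Suc i"]])
  moreover have "map f [i..<Suc (i + Suc n)] = f i # map f [Suc i..<Suc (Suc i + n)]"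
    by (subst upt_conv_Cons) auto
  ultimately show ?case
    by (simp only:)
qed simp

text \<open>Distinct edges have independent clocks, so a given path lies in the window with
  probability at most \<open>(b - a) ^ Suc n\<close>. The window is so narrow that this beats the
  number of paths by \<open>(1 / 2) ^ n\<close>.\<close>

lemma AE_no_long_paths:
  fixes e :: "(int ^ 'd::finite) set"
  assumes e: "e \<in> lattice_edges" and ab: "a \<le> b" "(b - a) * (2 * 3 ^ CARD('d)) \<le> 1 / 2"
  shows "AE U in clocks. \<not> (\<forall>n. \<exists>p\<in>edge_paths e n. distinct p \<and> (\<forall>g\<in>set p. a \<le> U g \<and> U g < b))"
proof -
  define c :: nat where "c = 2 * 3 ^ CARD('d)"
  define Q where "Q = (\<lambda>n U. \<exists>p\<in>edge_paths e n. distinct p \<and> (\<forall>g\<in>set p. a \<le> U g \<and> U g < b))"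
  note ch = edge_paths_props[OF e]
  define S where "S = (\<lambda>(p :: (int ^ 'd) set list) U. \<forall>g\<in>set p. a \<le> U g \<and> U g < b)"
  define C where "C = (\<lambda>n. {p \<in> edge_paths e n. distinct p})"
  have Q: "Q n = (\<lambda>U. \<exists>p\<in>C n. S p U)" for n
    by (auto simp: Q_def C_def S_def fun_eq_iff)
  have S [measurable]: "Measurable.pred clocks (S p)" if "p \<in> C n" for p n
    unfolding S_def
  proof (intro pred_intros_finite)
    fix g assume "g \<in> set p"
    then have [measurable]: "g \<in> lattice_edges"
      using ch that by (auto simp: C_def)
    show "Measurable.pred clocks (\<lambda>U. a \<le> U g \<and> U g < b)"
      by measurable
  qed simp
  have C: "finite (C n)" "card (C n) \<le> c ^ n" for n
    using ch[of n] card_mono[of "edge_paths e n" "C n"] by (auto simp: C_def c_def)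
  have [measurable]: "Measurable.pred clocks (Q n)" for n
    unfolding Q using C(1)[of n] S by (rule pred_intros_finite)
  have bound: "clocks.prob {U \<in> space clocks. Q n U} \<le> (1 / 2) ^ n * (b - a)" for n
  proof -
    have "{U \<in> space clocks. Q n U} = (\<Union>p\<in>C n. {U \<in> space clocks. S p U})"
      by (auto simp: Q)
    also have "clocks.prob \<dots> \<le> (\<Sum>p\<in>C n. clocks.prob {U \<in> space clocks. S p U})"
      using C(1)[of n] by (intro clocks.finite_measure_subadditive_finite) auto
    also have "\<dots> \<le> (\<Sum>p\<in>C n. (b - a) ^ Suc n)"
    proof (rule sum_mono)
      fix p assume "p \<in> C n"
      then have "card (set p) = Suc n" "set p \<subseteq> lattice_edges"
        using ch[of n] by (auto simp: C_def distinct_card)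
      then show "clocks.prob {U \<in> space clocks. S p U} \<le> (b - a) ^ Suc n"
        using prob_cylinder_interval[of "set p" a b] ab(1) by (simp add: S_def)
    qed
    also have "\<dots> = real (card (C n)) * (b - a) ^ Suc n"
      by simp
    also have "\<dots> \<le> real (c ^ n) * (b - a) ^ Suc n"
      using C(2)[of n] ab(1) by (intro mult_right_mono) auto
    also have "\<dots> = ((b - a) * c) ^ n * (b - a)"
      by (simp add: power_mult_distrib)
    also have "\<dots> \<le> (1 / 2) ^ n * (b - a)"
      using ab by (intro mult_right_mono power_mono) (auto simp: c_def)
    finally show ?thesis .
  qed
  have "clocks.prob {U \<in> space clocks. \<forall>n. Q n U} \<le> (1 / 2) ^ n * (b - a)" for n
    by (rule order_trans[OF clocks.finite_measure_mono bound[of n]]) auto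
  moreover have "(\<lambda>n. (1 / 2) ^ n * (b - a)) \<longlonglongrightarrow> 0 * (b - a)"
    by (intro tendsto_mult tendsto_const LIMSEQ_power_zero) simp
  ultimately have "clocks.prob {U \<in> space clocks. \<forall>n. Q n U} \<le> 0"
    by (intro LIMSEQ_le_const[where X = "\<lambda>n. (1 / 2) ^ n * (b - a)"]) auto
  then have "clocks.prob {U \<in> space clocks. \<forall>n. Q n U} = 0"
    by (simp add: measure_le_0_iff)
  moreover have "{U \<in> space clocks. \<forall>n. Q n U} \<in> sets clocks"
    by measurable
  ultimately have "AE U in clocks. \<not> (\<forall>n. Q n U)"
    using clocks.prob_Collect_eq_0[of "\<lambda>U. \<forall>n. Q n U"] by simp
  then show ?thesis
    by (simp add: Q_def)
qed

text \<open>A decreasing sequence of nonnegative clocks is eventually trapped in one window of width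
  \<open>\<epsilon>\<close>. As it is strictly decreasing, its edges are distinct, so it provides
  long paths inside a narrow window.\<close>

lemma AE_wf: "AE U in clocks. wf (earlier (U :: (int ^ 'd::finite) set \<Rightarrow> real))"
proof -
  \<comment> \<open>Chosen so that \<open>\<epsilon> * (2 * 3 ^ CARD('d))\<close> equals
    1/2.\<close>
  define \<epsilon> :: real where "\<epsilon> = 1 / (4 * 3 ^ CARD('d))"
  have \<epsilon>: "0 < \<epsilon>"
    by (simp add: \<epsilon>_def)
  have "AE U in clocks. \<forall>e\<in>lattice_edges. \<forall>j::nat.
    \<not> (\<forall>n. \<exists>p\<in>edge_paths (e :: (int ^ 'd) set) n. distinct p \<and> (\<forall>g\<in>set p. j * \<epsilon> \<le> U g \<and> U g < Suc j * \<epsilon>))"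
    by (intro AE_ball_countable' countable_lattice_edges AE_all_countable[THEN iffD2] allI AE_no_long_paths)
      (use \<epsilon> in \<open>auto simp: algebra_simps, auto simp: \<epsilon>_def\<close>)
  then show ?thesis
    using AE_space
  proof eventually_elim
    case (elim U)
    show ?case
    proof (rule ccontr)
      assume "\<not> wf (earlier U)"
      then obtain f where f: "\<And>i. (f (Suc i), f i) \<in> earlier U"
        by (auto simp: wf_iff_no_infinite_down_chain)
      then have fl: "f i \<in> lattice_edges" for i
        by (auto simp: earlier_def)
      have "U (f (Suc i)) < U (f i)" for i
        using f by (auto simp: earlier_def)
      then have dec: "U (f j) < U (f i)" if "i < j" for i j
        using lift_Suc_mono_less[of "\<lambda>i. - U (f i)" i j] that by simp
      have nonneg: "0 \<le> U (f i)" for i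
        using clock_bounds[OF elim(2) fl] by simp
      \<comment> \<open>\<open>R j\<close> says that some clock of the chain lies below the top of
        window \<open>j\<close>. For the least such \<open>j\<close> no clock falls below the bottom
        of the window, so the chain stays in it once it has entered.\<close>
      define R where "R = (\<lambda>j::nat. \<exists>i. U (f i) < Suc j * \<epsilon>)"
      obtain N :: nat where "U (f 0) / \<epsilon> < N"
        using reals_Archimedean2 by blast
      then have "U (f 0) < Suc N * \<epsilon>"
        using \<epsilon> by (simp add: field_simps)
      then have "R N"
        unfolding R_def by blast
      define j where "j = (LEAST j. R j)"
      have "R j"
        unfolding j_def using \<open>R N\<close> by (rule LeastI)
      then obtain i where i: "U (f i) < Suc j * \<epsilon>"
        by (auto simp: R_def)
      have lower: "j * \<epsilon> \<le> U (f m)" for m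
      proof (cases j)
        case 0
        then show ?thesis using nonneg by simp
      next
        case (Suc j')
        then have "\<not> R j'"
          using not_less_Least[of j' R] by (simp add: j_def)
        then show ?thesis
          unfolding R_def Suc by (meson not_le)
      qed
      have upper: "U (f m) < Suc j * \<epsilon>" if "i \<le> m" for m
        using i dec[of i m] that by (cases "i = m") auto
      have "inj f"
        by (rule linorder_injI) (use dec in fastforce)
      then have "distinct (map f [i..<Suc (i + n)])" for n
        using inj_on_subset[of f UNIV "set [i..<Suc (i + n)]"] by (simp add: distinct_map del: upt_Suc)
      moreover have "\<forall>g\<in>set (map f [i..<Suc (i + n)]). j * \<epsilon> \<le> U g \<and> U g < Suc j * \<epsilon>" for n
        using lower upper by auto
      ultimately have "\<forall>n. \<exists>p\<in>edge_paths (f i) n. distinct p \<and> (\<forall>g\<in>set p. j * \<epsilon> \<le> U g \<and> U g < Suc j * \<epsilon>)"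
        using decreasing_path[of f U i, OF f] by blast
      with elim(1) fl show False by blast
    qed
  qed
qed

lemma AE_no_tie:
  assumes "e \<in> lattice_edges" "f \<in> lattice_edges" "e \<noteq> f"
  shows "AE U in clocks. U e \<noteq> U f"
proof -
  have [measurable]: "e \<in> lattice_edges" "f \<in> lattice_edges"
    using assms by auto
  have bound: "clocks.prob {U \<in> space clocks. U e = U f} \<le> 2 / Suc n" for n
  proof -
    define \<epsilon> :: real where "\<epsilon> = 1 / Suc n"
    \<comment> \<open>A tie puts both clocks into one cell of a grid of mesh
      \<open>\<epsilon>\<close>. The cell with index \<open>Suc n\<close> catches the value
      1.\<close>
    have "{U \<in> space clocks. U e = U f}
      \<subseteq> (\<Union>j\<le>Suc n. {U \<in> space clocks. \<forall>g\<in>{e, f}. j * \<epsilon> \<le> U g \<and> U g < j * \<epsilon> + \<epsilon>})"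
    proof
      fix U assume U: "U \<in> {U \<in> space clocks. U e = U f}"
      define j where "j = nat \<lfloor>U e * Suc n\<rfloor>"
      have b: "0 \<le> U e" "U e \<le> 1"
        using clock_bounds[of U e] U assms(1) by auto
      then have "U e * Suc n \<le> Suc n"
        by (simp add: mult_left_le_one_le)
      then have "j \<le> Suc n"
        unfolding j_def by linarith
      moreover have "j \<le> U e * Suc n" "U e * Suc n < j + 1"
        using b unfolding j_def by (simp_all, linarith+)
      then have "j * \<epsilon> \<le> U e" "U e < j * \<epsilon> + \<epsilon>"
        by (auto simp: \<epsilon>_def field_simps)
      ultimately show "U \<in> (\<Union>j\<le>Suc n. {U \<in> space clocks. \<forall>g\<in>{e, f}. j * \<epsilon> \<le> U g \<and> U g < j * \<epsilon> + \<epsilon>})"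
        using U by auto
    qed
    then have "clocks.prob {U \<in> space clocks. U e = U f}
      \<le> clocks.prob (\<Union>j\<le>Suc n. {U \<in> space clocks. \<forall>g\<in>{e, f}. j * \<epsilon> \<le> U g \<and> U g < j * \<epsilon> + \<epsilon>})"
      by (intro clocks.finite_measure_mono) auto
    also have "\<dots> \<le> (\<Sum>j\<le>Suc n. clocks.prob {U \<in> space clocks. \<forall>g\<in>{e, f}. j * \<epsilon> \<le> U g \<and> U g < j * \<epsilon> + \<epsilon>})"
      by (intro clocks.finite_measure_subadditive_finite) auto
    also have "\<dots> \<le> (\<Sum>j\<le>Suc n. \<epsilon> ^ 2)"
    proof (rule sum_mono)
      fix j
      show "clocks.prob {U \<in> space clocks. \<forall>g\<in>{e, f}. real j * \<epsilon> \<le> U g \<and> U g < real j * \<epsilon> + \<epsilon>} \<le> \<epsilon> ^ 2"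
        using prob_cylinder_interval[of "{e, f}" "j * \<epsilon>" "j * \<epsilon> + \<epsilon>"] assms by (simp add: \<epsilon>_def numeral_2_eq_2)
    qed
    also have "\<dots> = real (Suc (Suc n)) * \<epsilon> ^ 2"
      by simp
    also have "\<dots> \<le> real (2 * Suc n) * \<epsilon> ^ 2"
      by (intro mult_right_mono) auto
    also have "\<dots> = 2 * (Suc n * \<epsilon>) * \<epsilon>"
      by (simp add: power2_eq_square)
    also have "\<dots> = 2 / Suc n"
      by (simp add: \<epsilon>_def)
    finally show ?thesis .
  qed
  moreover have "(\<lambda>n. 2 / Suc n) \<longlonglongrightarrow> (0 :: real)"
    using LIMSEQ_Suc[OF lim_const_over_n[of "2 :: real"]] by simp
  ultimately have "clocks.prob {U \<in> space clocks. U e = U f} \<le> 0"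
    by (intro LIMSEQ_le_const[where X = "\<lambda>n. 2 / Suc n"]) auto
  then have "clocks.prob {U \<in> space clocks. U e = U f} = 0"
    by (simp add: measure_le_0_iff)
  moreover have "{U \<in> space clocks. U e = U f} \<in> sets clocks"
    by measurable
  ultimately show ?thesis
    using clocks.prob_Collect_eq_0[of "\<lambda>U. U e = U f"] by simp
qed

definition regular :: "((int ^ 'd) set \<Rightarrow> real) \<Rightarrow> bool" where
  "regular U \<longleftrightarrow> wf (earlier U) \<and> inj_on U lattice_edges"

lemma AE_regular: "AE U in clocks. regular (U :: (int ^ 'd::finite) set \<Rightarrow> real)"
proof -
  have "AE U in clocks. \<forall>e\<in>lattice_edges. \<forall>f\<in>lattice_edges. (e :: (int ^ 'd) set) \<noteq> f \<longrightarrow> U e \<noteq> U f"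
    by (intro AE_ball_countable' countable_lattice_edges AE_impI AE_no_tie)
  with AE_wf show ?thesis
    by eventually_elim (auto simp: regular_def inj_on_def)
qed

text \<open>An almost sure statement only provides a null set containing the exceptions; its
  complement is a measurable event of full probability on which regularity holds.\<close>

lemma regular_event:
  obtains A :: "((int ^ 'd::finite) set \<Rightarrow> real) set"
  where "A \<in> sets clocks" "clocks.prob A = 1" "\<And>U. U \<in> A \<Longrightarrow> regular U"
proof -
  obtain N :: "((int ^ 'd::finite) set \<Rightarrow> real) set"
    where N: "{U \<in> space clocks. \<not> regular U} \<subseteq> N" "emeasure clocks N = 0" "N \<in> sets clocks"
    using AE_E[OF AE_regular] .
  have "clocks.prob (space clocks - N) = 1"
    using N by (subst clocks.prob_compl) (auto simp: measure_def)
  moreover have "space clocks - N \<in> sets clocks"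
    using N(3) by auto
  ultimately show thesis
    using that[of "space clocks - N"] N(1) by blast
qed

section \<open>Resampling finitely many clocks\<close>

definition resample :: "(int ^ 'd) set set \<Rightarrow> ((int ^ 'd) set \<Rightarrow> real) \<times> ((int ^ 'd) set \<Rightarrow> real) \<Rightarrow>
    (int ^ 'd) set \<Rightarrow> real" where
  "resample R z = (\<lambda>e\<in>lattice_edges. if e \<in> R then snd z e else fst z e)"

lemma measurable_resample [measurable]: "resample R \<in> measurable (clocks \<Otimes>\<^sub>M clocks) clocks"
proof -
  have "(\<lambda>z. if e \<in> R then snd z e else fst z e) \<in>
      measurable (clocks \<Otimes>\<^sub>M clocks) (restrict_space lborel {0..1})"
    if "e \<in> lattice_edges" for e
  proof -
    have c: "(\<lambda>U. U e) \<in> measurable clocks (restrict_space lborel {0..1})"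
      unfolding clocks_def using that by (rule measurable_component_singleton)
    show ?thesis
      using measurable_compose[OF measurable_fst c] measurable_compose[OF measurable_snd c]
      by (cases "e \<in> R") simp_all
  qed
  then have "(\<lambda>z. \<lambda>e\<in>lattice_edges. if e \<in> R then snd z e else fst z e) \<in>
      measurable (clocks \<Otimes>\<^sub>M clocks) (\<Pi>\<^sub>M e\<in>lattice_edges. restrict_space lborel {0..1})"
    by (rule measurable_restrict)
  moreover have "resample R = (\<lambda>z. \<lambda>e\<in>lattice_edges. if e \<in> R then snd z e else fst z e)"
    by (simp add: resample_def fun_eq_iff)
  ultimately show ?thesis
    by (simp add: clocks_def)
qed

text \<open>Checked on finite cylinders: the factors for \<open>J - R\<close> come from the first
  copy and those for \<open>J \<inter> R\<close> from the second, which is independent of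
  it.\<close>

lemma distr_resample:
  "distr (clocks \<Otimes>\<^sub>M clocks) clocks (resample R) = (clocks :: ((int ^ 'd::finite) set \<Rightarrow> real) measure)"
proof -
  let ?M = "\<lambda>_ :: (int ^ 'd) set. restrict_space lborel {0..1::real}"
  have "distr (clocks \<Otimes>\<^sub>M clocks) clocks (resample R) = (\<Pi>\<^sub>M e\<in>lattice_edges. ?M e)"
  proof (rule clock.PiM_eq)
    show "sets (distr (clocks \<Otimes>\<^sub>M clocks) clocks (resample R)) = sets (\<Pi>\<^sub>M e\<in>lattice_edges. ?M e)"
      by (simp add: clocks_def)
  next
    fix J :: "(int ^ 'd) set set" and F :: "(int ^ 'd) set \<Rightarrow> real set"
    assume J: "finite J" "J \<subseteq> lattice_edges" and F: "\<And>j. j \<in> J \<Longrightarrow> F j \<in> sets (?M j)"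
    have pred: "{U \<in> space clocks. \<forall>j\<in>K. U j \<in> F j} \<in> sets clocks"
      "emeasure clocks {U \<in> space clocks. \<forall>j\<in>K. U j \<in> F j} = (\<Prod>j\<in>K. emeasure (?M j) (F j))"
      if "K \<subseteq> J" for K
    proof -
      have K: "K \<subseteq> lattice_edges" "finite K" "\<And>j. j \<in> K \<Longrightarrow> F j \<in> sets (?M j)"
        using that J F finite_subset by auto
      show "emeasure clocks {U \<in> space clocks. \<forall>j\<in>K. U j \<in> F j} = (\<Prod>j\<in>K. emeasure (?M j) (F j))"
        unfolding clocks_def by (rule clock.emeasure_PiM_Collect[OF K])
      have "{U \<in> space clocks. U j \<in> F j} \<in> sets clocks" if "j \<in> K" for j
        using measurable_sets[of "\<lambda>U. U j" clocks "?M j" "F j"] K that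
          measurable_component_singleton[of j lattice_edges ?M] by (auto simp: clocks_def vimage_def Int_def conj_commute)
      then show "{U \<in> space clocks. \<forall>j\<in>K. U j \<in> F j} \<in> sets clocks"
        using K(2) by (intro sets.sets_Collect_finite_All)
    qed
    define A where "A = {U \<in> space clocks. \<forall>j\<in>J - R. U j \<in> F j}"
    define B where "B = {U \<in> space clocks. \<forall>j\<in>J \<inter> R. U j \<in> F j}"
    have emb: "prod_emb lattice_edges ?M J (\<Pi>\<^sub>E j\<in>J. F j) = {U \<in> space clocks. \<forall>j\<in>J. U j \<in> F j}"
      unfolding prod_emb_def clocks_def using J(2) by (auto simp: space_PiM restrict_def PiE_def Pi_def extensional_def)
    have "emeasure (distr (clocks \<Otimes>\<^sub>M clocks) clocks (resample R)) (prod_emb lattice_edges ?M J (\<Pi>\<^sub>E j\<in>J. F j))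
      = emeasure (clocks \<Otimes>\<^sub>M clocks) (resample R -` {U \<in> space clocks. \<forall>j\<in>J. U j \<in> F j} \<inter> space (clocks \<Otimes>\<^sub>M clocks))"
      unfolding emb by (rule emeasure_distr[OF measurable_resample pred(1)]) simp
    also have "resample R -` {U \<in> space clocks. \<forall>j\<in>J. U j \<in> F j} \<inter> space (clocks \<Otimes>\<^sub>M clocks) = A \<times> B"
    proof (intro set_eqI iffI)
      fix z assume "z \<in> resample R -` {U \<in> space clocks. \<forall>j\<in>J. U j \<in> F j} \<inter> space (clocks \<Otimes>\<^sub>M clocks)"
      then have z: "fst z \<in> space clocks" "snd z \<in> space clocks" "\<forall>j\<in>J. resample R z j \<in> F j"
        by (auto simp: space_pair_measure)
      have "resample R z j = (if j \<in> R then snd z j else fst z j)" if "j \<in> J" for j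
        using that J(2) by (auto simp: resample_def)
      with z show "z \<in> A \<times> B"
        by (cases z) (auto simp: A_def B_def split: if_splits)
    next
      fix z assume z: "z \<in> A \<times> B"
      have "resample R z j = (if j \<in> R then snd z j else fst z j)" if "j \<in> J" for j
        using that J(2) by (auto simp: resample_def)
      moreover have "z \<in> space (clocks \<Otimes>\<^sub>M clocks)"
        using z by (auto simp: A_def B_def space_pair_measure)
      moreover from this have "resample R z \<in> space clocks"
        by (rule measurable_space[OF measurable_resample])
      ultimately show "z \<in> resample R -` {U \<in> space clocks. \<forall>j\<in>J. U j \<in> F j} \<inter> space (clocks \<Otimes>\<^sub>M clocks)"
        using z by (auto simp: A_def B_def)
    qed
    also have "emeasure (clocks \<Otimes>\<^sub>M clocks) (A \<times> B) = emeasure clocks A * emeasure clocks B"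
      unfolding A_def B_def by (intro clocks.emeasure_pair_measure_Times pred) auto
    also have "\<dots> = (\<Prod>j\<in>J - R. emeasure (?M j) (F j)) * (\<Prod>j\<in>J \<inter> R. emeasure (?M j) (F j))"
      unfolding A_def B_def by (subst (1 2) pred(2)) auto
    also have "\<dots> = (\<Prod>j\<in>J. emeasure (?M j) (F j))"
      using prod.Int_Diff[OF J(1), of "\<lambda>j. emeasure (?M j) (F j)" R] by (simp add: mult.commute)
    finally show "emeasure (distr (clocks \<Otimes>\<^sub>M clocks) clocks (resample R))
        (prod_emb lattice_edges ?M J (\<Pi>\<^sub>E j\<in>J. F j)) = (\<Prod>j\<in>J. emeasure (?M j) (F j))" .
  qed
  then show ?thesis
    by (simp add: clocks_def)
qed

text \<open>The new clocks come from an independent copy, so the factorization is exact even though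
  \<open>A\<close> may depend on the old clocks of \<open>R\<close>. The map
  \<open>resample R\<close> preserves the law, hence the image of \<open>A\<close> and of the
  constraint on \<open>R\<close> is measured by \<open>B\<close>.\<close>

lemma resample_bound:
  fixes A B :: "((int ^ 'd::finite) set \<Rightarrow> real) set"
  assumes A: "A \<in> sets clocks" and B: "B \<in> sets clocks"
    and R: "finite R" "R \<subseteq> lattice_edges" and X: "\<And>e. e \<in> R \<Longrightarrow> X e \<in> sets borel"
    and step: "\<And>U V. U \<in> A \<Longrightarrow> V \<in> space clocks \<Longrightarrow> regular U \<Longrightarrow> regular (resample R (U, V)) \<Longrightarrow>
      \<forall>e\<in>R. V e \<in> X e \<Longrightarrow> resample R (U, V) \<in> B"
  shows "clocks.prob A * (\<Prod>e\<in>R. measure lborel (X e \<inter> {0..1})) \<le> clocks.prob B"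
proof -
  obtain G :: "((int ^ 'd) set \<Rightarrow> real) set"
    where G: "G \<in> sets clocks" "clocks.prob G = 1" "\<And>U. U \<in> G \<Longrightarrow> regular U"
    using regular_event by blast
  define W where "W = {V \<in> space clocks. \<forall>e\<in>R. V e \<in> X e}"
  \<comment> \<open>Outcomes outside \<open>G\<close> after resampling are not covered by
    \<open>step\<close>; they are added to the target as a null set.\<close>
  define B' where "B' = B \<union> (space clocks - G)"
  have "{V \<in> space clocks. V e \<in> X e} \<in> sets clocks" if "e \<in> R" for e
  proof -
    have "(\<lambda>V. V e) \<in> borel_measurable clocks"
      using that R(2) measurable_clock by blast
    from measurable_sets[OF this X[OF that]] show ?thesis
      by (simp add: vimage_def Int_def conj_commute)
  qed
  then have W: "W \<in> sets clocks"
    unfolding W_def using R(1) by (intro sets.sets_Collect_finite_All)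
  have B': "B' \<in> sets clocks"
    using B G(1) by (auto simp: B'_def)
  have "emeasure clocks (A \<inter> G) * emeasure clocks W = emeasure (clocks \<Otimes>\<^sub>M clocks) ((A \<inter> G) \<times> W)"
    using A G(1) W by (intro clocks.emeasure_pair_measure_Times[symmetric]) auto
  also have "\<dots> \<le> emeasure (clocks \<Otimes>\<^sub>M clocks) (resample R -` B' \<inter> space (clocks \<Otimes>\<^sub>M clocks))"
  proof (rule emeasure_mono)
    show "(A \<inter> G) \<times> W \<subseteq> resample R -` B' \<inter> space (clocks \<Otimes>\<^sub>M clocks)"
    proof
      fix z assume "z \<in> (A \<inter> G) \<times> W"
      then obtain U V where z: "z = (U, V)" "U \<in> A" "U \<in> G" "V \<in> W"
        by auto
      have "z \<in> space (clocks \<Otimes>\<^sub>M clocks)"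
        using z A sets.sets_into_space by (auto simp: space_pair_measure W_def)
      moreover from this have "resample R z \<in> space clocks"
        by (rule measurable_space[OF measurable_resample])
      moreover have "resample R z \<in> B" if "resample R z \<in> G"
        using step[of U V] G(3)[of U] G(3)[OF that] z by (auto simp: W_def)
      ultimately show "z \<in> resample R -` B' \<inter> space (clocks \<Otimes>\<^sub>M clocks)"
        by (auto simp: B'_def)
    qed
    show "resample R -` B' \<inter> space (clocks \<Otimes>\<^sub>M clocks) \<in> sets (clocks \<Otimes>\<^sub>M clocks)"
      by (rule measurable_sets[OF measurable_resample B'])
  qed
  also have "\<dots> = emeasure (distr (clocks \<Otimes>\<^sub>M clocks) clocks (resample R)) B'"
    by (rule emeasure_distr[OF measurable_resample B', symmetric])
  also have "\<dots> = emeasure clocks B'"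
    by (simp add: distr_resample)
  finally have "clocks.prob (A \<inter> G) * clocks.prob W \<le> clocks.prob B'"
    by (simp add: clocks.emeasure_eq_measure ennreal_mult'[symmetric])
  moreover have "clocks.prob (A \<inter> G) = clocks.prob A"
    using clocks.measure_space_inter[OF A G(1)] G(2) clocks.prob_space by simp
  moreover have "clocks.prob B' \<le> clocks.prob B"
  proof -
    have "clocks.prob B' \<le> clocks.prob B + clocks.prob (space clocks - G)"
      unfolding B'_def using B G(1) by (intro measure_Un_le) auto
    then show ?thesis
      using G(1,2) by (simp add: clocks.prob_compl)
  qed
  moreover have "clocks.prob W = (\<Prod>e\<in>R. measure lborel (X e \<inter> {0..1}))"
    unfolding W_def by (rule prob_cylinder[OF R X])
  ultimately show ?thesis
    by simp
qed

section \<open>Measurable properties of random graphs\<close>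

definition random_graph :: "(((int ^ 'd) set \<Rightarrow> real) \<Rightarrow> (int ^ 'd) set set) \<Rightarrow> bool" where
  "random_graph X \<longleftrightarrow> (\<forall>U. X U \<subseteq> lattice_edges) \<and> (\<forall>e. Measurable.pred clocks (\<lambda>U. e \<in> X U))"

text \<open>Quantifying over all random graphs, rather than over \<open>config k t\<close> alone,
  makes the notion stable under operations on graphs such as \<open>avoid\<close> or adding edges,
  without a sigma-algebra on the set of graphs.\<close>

definition graph_event :: "((int ^ 'd) set set \<Rightarrow> bool) \<Rightarrow> bool" where
  "graph_event \<Psi> \<longleftrightarrow> (\<forall>X. random_graph X \<longrightarrow> Measurable.pred clocks (\<lambda>U. \<Psi> (X U)))"

lemma random_graph_edge: "random_graph X \<Longrightarrow> Measurable.pred clocks (\<lambda>U. e \<in> X U)"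
  by (simp add: random_graph_def)

lemma graph_eventD: "graph_event \<Psi> \<Longrightarrow> random_graph X \<Longrightarrow> Measurable.pred clocks (\<lambda>U. \<Psi> (X U))"
  by (simp add: graph_event_def)

lemma graph_event_edge [intro!]: "graph_event (\<lambda>H. e \<in> H)"
  by (simp add: graph_event_def random_graph_edge)

lemma graph_event_const [intro!]: "graph_event (\<lambda>H. P)"
  by (simp add: graph_event_def)

lemma graph_event_not [intro!]: "graph_event \<Phi> \<Longrightarrow> graph_event (\<lambda>H. \<not> \<Phi> H)"
  unfolding graph_event_def by (auto intro: pred_intros_logic)

lemma graph_event_conj [intro!]: "graph_event \<Phi> \<Longrightarrow> graph_event \<Psi> \<Longrightarrow> graph_event (\<lambda>H. \<Phi> H \<and> \<Psi> H)"
  unfolding graph_event_def by (auto intro: pred_intros_logic)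

lemma graph_event_imp [intro!]: "graph_event \<Phi> \<Longrightarrow> graph_event \<Psi> \<Longrightarrow> graph_event (\<lambda>H. \<Phi> H \<longrightarrow> \<Psi> H)"
  unfolding graph_event_def by (auto intro: pred_intros_logic)

lemma graph_event_ex [intro!]:
  "(\<And>i. graph_event (\<Phi> i)) \<Longrightarrow> graph_event (\<lambda>H. \<exists>i. \<Phi> i H)" for \<Phi> :: "'i::countable \<Rightarrow> _"
  unfolding graph_event_def by (auto intro!: pred_intros_countable)

lemma graph_event_all [intro!]:
  "(\<And>i. graph_event (\<Phi> i)) \<Longrightarrow> graph_event (\<lambda>H. \<forall>i. \<Phi> i H)" for \<Phi> :: "'i::countable \<Rightarrow> _"
  unfolding graph_event_def by (auto intro!: pred_intros_countable)

lemma graph_event_connected [intro!]: "graph_event (\<lambda>H. connected_in H x y)"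
proof -
  have "graph_event (\<lambda>H. (x, y) \<in> {(u, v). {u, v} \<in> H} ^^ n)" for n
  proof (induction n arbitrary: y)
    case (Suc n)
    have "graph_event (\<lambda>H. \<exists>z. (x, z) \<in> {(u, v). {u, v} \<in> H} ^^ n \<and> {z, y} \<in> H)"
      by (intro graph_event_ex graph_event_conj graph_event_edge Suc)
    then show ?case
      by (simp add: relcomp_unfold)
  qed (simp add: graph_event_const)
  then have "graph_event (\<lambda>H. \<exists>n. (x, y) \<in> {(u, v). {u, v} \<in> H} ^^ n)"
    by (rule graph_event_ex)
  then show ?thesis
    by (simp add: connected_in_def rtrancl_is_UN_relpow)
qed

text \<open>Every finite set lies in some cube, so infinity becomes a countable combination of
  connection events.\<close>

lemma infinite_cluster_iff: "infinite (cluster_in H x) \<longleftrightarrow> (\<forall>n. \<exists>y. y \<notin> cube n 0 \<and> connected_in H x y)"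
proof
  assume inf: "infinite (cluster_in H x)"
  show "\<forall>n. \<exists>y. y \<notin> cube n 0 \<and> connected_in H x y"
  proof
    fix n
    have "\<not> cluster_in H x \<subseteq> cube n 0"
      using inf finite_subset finite_cube by blast
    then show "\<exists>y. y \<notin> cube n 0 \<and> connected_in H x y"
      by auto
  qed
next
  assume *: "\<forall>n. \<exists>y. y \<notin> cube n 0 \<and> connected_in H x y"
  show "infinite (cluster_in H x)"
  proof
    assume "finite (cluster_in H x)"
    then obtain n where n: "cluster_in H x \<subseteq> cube n 0"
      by (rule cube_exhausts)
    from * obtain y where "y \<notin> cube n 0" "y \<in> cluster_in H x"
      by auto
    with n show False by blast
  qed
qed

lemma graph_event_infinite [intro!]: "graph_event (\<lambda>H. infinite (cluster_in H x))"
  unfolding infinite_cluster_iff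
  by (intro graph_event_all graph_event_ex graph_event_conj graph_event_const graph_event_connected)

lemma graph_event_avoid [intro!]: "graph_event \<Phi> \<Longrightarrow> graph_event (\<lambda>H. \<Phi> (avoid H T))"
  unfolding graph_event_def
proof (intro allI impI)
  fix X :: "((int ^ 'a) set \<Rightarrow> real) \<Rightarrow> (int ^ 'a) set set"
  assume \<Phi>: "\<forall>X. random_graph X \<longrightarrow> Measurable.pred clocks (\<lambda>U. \<Phi> (X U))" and X: "random_graph X"
  have "random_graph (\<lambda>U. avoid (X U) T)"
    unfolding random_graph_def
  proof (intro conjI allI)
    show "Measurable.pred clocks (\<lambda>U. e \<in> avoid (X U) T)" for e
      using X by (cases "e \<inter> T = {}") (simp_all add: avoid_def random_graph_def)
  qed (use X in \<open>auto simp: random_graph_def avoid_def\<close>)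
  with \<Phi> show "Measurable.pred clocks (\<lambda>U. \<Phi> (avoid (X U) T))"
    by blast
qed

lemma graph_event_trifurcation [intro!]: "graph_event (\<lambda>H. trifurcation H x)"
  unfolding trifurcation_def
  by (intro graph_event_ex graph_event_conj graph_event_not graph_event_edge
      graph_event_avoid[OF graph_event_infinite] graph_event_avoid[OF graph_event_connected])

text \<open>Having at most one neighbour is phrased by quantifiers over vertices, so closure under
  countable quantifiers is enough.\<close>

lemma graph_event_endpoint [intro!]: "graph_event (\<lambda>H. endpoint H x)"
  unfolding endpoint_def
  by (intro graph_event_conj graph_event_ex graph_event_all graph_event_imp graph_event_edge
      graph_event_const graph_event_infinite)

lemma pred_card_less:
  assumes "finite F" "\<And>x. x \<in> F \<Longrightarrow> Measurable.pred M (P x)" "\<And>x U. P x U \<Longrightarrow> x \<in> F"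
  shows "Measurable.pred M (\<lambda>U. card {x. P x U} < k)"
proof -
  have eq: "card {x. P x U} < k \<longleftrightarrow> (\<exists>S\<in>{S \<in> Pow F. card S < k}. \<forall>x\<in>F. P x U \<longleftrightarrow> x \<in> S)" for U
  proof
    assume "card {x. P x U} < k"
    then show "\<exists>S\<in>{S \<in> Pow F. card S < k}. \<forall>x\<in>F. P x U \<longleftrightarrow> x \<in> S"
      using assms(3) by (intro bexI[of _ "{x. P x U}"]) auto
  next
    assume "\<exists>S\<in>{S \<in> Pow F. card S < k}. \<forall>x\<in>F. P x U \<longleftrightarrow> x \<in> S"
    then obtain S where "S \<subseteq> F" "card S < k" "\<forall>x\<in>F. P x U \<longleftrightarrow> x \<in> S"
      by auto
    moreover from this have "{x. P x U} = S"
      using assms(3) by auto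
    ultimately show "card {x. P x U} < k" by simp
  qed
  have [measurable]: "Measurable.pred M (\<lambda>U. P x U \<longleftrightarrow> x \<in> S)" if "x \<in> F" for x S
    using assms(2)[OF that] by (cases "x \<in> S") simp_all
  show ?thesis
    unfolding eq using assms(1) by (intro pred_intros_finite) auto
qed

lemma graph_event_degree [intro!]: "graph_event (\<lambda>H. degree_in H v \<le> k)"
  unfolding graph_event_def
proof (intro allI impI)
  fix X :: "((int ^ 'a) set \<Rightarrow> real) \<Rightarrow> (int ^ 'a) set set"
  assume X: "random_graph X"
  have "Measurable.pred clocks (\<lambda>U. card {x. {x, v} \<in> X U} < Suc k)"
    by (rule pred_card_less[OF finite_nbrs[of v]]) (use X in \<open>auto simp: random_graph_def nbrs_def\<close>)
  then show "Measurable.pred clocks (\<lambda>U. degree_in (X U) v \<le> k)"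
    by (simp add: degree_in_def less_Suc_eq_le)
qed

lemma random_graph_config: "random_graph (config k t)"
proof -
  have stage: "Measurable.pred clocks (\<lambda>U. e \<in> stage k U n)" for e :: "(int ^ 'a) set" and n
  proof (induction n arbitrary: e)
    case (Suc n)
    show ?case
    proof (cases "e \<in> lattice_edges")
      case True
      have "Measurable.pred clocks (\<lambda>U. card {x. {x, v} \<in> stage k U n \<and> U {x, v} < U e} < k)" for v
      proof (rule pred_card_less[OF finite_nbrs[of v]])
        fix x assume "x \<in> nbrs v"
        then have [measurable]: "{x, v} \<in> lattice_edges" "e \<in> lattice_edges"
          using True by (auto simp: nbrs_def)
        note Suc[measurable]
        show "Measurable.pred clocks (\<lambda>U. {x, v} \<in> stage k U n \<and> U {x, v} < U e)"
          by measurable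
      qed (use stage_subset in \<open>auto simp: nbrs_def\<close>)
      then have "Measurable.pred clocks (\<lambda>U. \<forall>v\<in>e. card {x. {x, v} \<in> stage k U n \<and> U {x, v} < U e} < k)"
        using finite_edge[OF True] by (intro pred_intros_finite)
      then show ?thesis
        using True by simp
    qed simp
  qed simp
  have "Measurable.pred clocks (\<lambda>U. e \<in> config k t U)" for e :: "(int ^ 'a) set"
  proof (cases "e \<in> lattice_edges")
    case True
    note True[measurable] stage[measurable]
    show ?thesis
      unfolding config_def opened_def by simp
  next
    case False
    then have "e \<notin> config k t U" for U
      using config_subset by blast
    then show ?thesis by simp
  qed
  then show ?thesis
    unfolding random_graph_def using config_subset by blast
qed

lemma random_graph_patch:
  "random_graph X \<Longrightarrow> Q \<subseteq> lattice_edges \<Longrightarrow> random_graph (\<lambda>U. (X U - E) \<union> Q)"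
proof -
  assume X: "random_graph X" and Q: "Q \<subseteq> lattice_edges"
  have "Measurable.pred clocks (\<lambda>U. e \<in> (X U - E) \<union> Q)" for e
    using X by (cases "e \<in> Q"; cases "e \<in> E") (simp_all add: random_graph_def)
  with X Q show ?thesis
    by (auto simp: random_graph_def)
qed

section \<open>The cost of a surgery\<close>

definition config_prob :: "nat \<Rightarrow> real \<Rightarrow> ((int ^ 'd::finite) set set \<Rightarrow> bool) \<Rightarrow> real" where
  "config_prob k t \<Psi> = clocks.prob {U \<in> space clocks. \<Psi> (config k t U)}"

text \<open>The graph \<open>H\<close> depends on \<open>G\<close> in an unspecified way, so no
  measurable choice is available. Instead the event is split according to the old and the new
  pattern on \<open>E\<close>; for a fixed pair of patterns the clocks to resample and their target
  ranges are deterministic. Each pair costs at most \<open>\<delta> ^ card E\<close>, and there are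
  at most \<open>4 ^ card E\<close> pairs.\<close>

lemma surgery_bound:
  fixes D :: "(int ^ 'd::finite) set"
  assumes t: "0 < t" "t < 1" and k: "0 < k" and D: "finite D"
    and \<Phi>: "graph_event \<Phi>" and \<Psi>: "graph_event \<Psi>"
    and surgery: "\<And>G. G \<subseteq> lattice_edges \<Longrightarrow> (\<And>v. degree_in G v \<le> k) \<Longrightarrow> \<Phi> G \<Longrightarrow>
      \<exists>H. H \<subseteq> lattice_edges \<and> H - touch D = G - touch D \<and> (\<forall>v. degree_in H v \<le> k) \<and> \<Psi> H"
  shows "config_prob k t \<Phi> * (min t (1 - t) / 4) ^ card (touch (\<Union> (touch D))) \<le> config_prob k t \<Psi>"
proof -
  define E where "E = touch (\<Union> (touch D))"
  have E: "finite E" "E \<subseteq> lattice_edges" "touch D \<subseteq> E"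
    using finite_touch[OF finite_Union_touch[OF D]] by (auto simp: E_def touch_def)
  \<comment> \<open>\<open>P\<close> is the trace of the old graph on \<open>E\<close> and
    \<open>Q\<close> that of the new one.\<close>
  define pats where "pats = {(P, Q). P \<subseteq> E \<and> Q \<subseteq> E \<and> Q - touch D = P - touch D}"
  define A where "A = (\<lambda>(P, Q). {U \<in> space clocks. \<Phi> (config k t U) \<and> config k t U \<inter> E = P \<and>
    \<Psi> ((config k t U - E) \<union> Q) \<and> (\<forall>v. degree_in ((config k t U - E) \<union> Q) v \<le> k)})"
  define B where "B = {U \<in> space clocks. \<Psi> (config k t U)}"
  define \<delta> where "\<delta> = min t (1 - t)"
  have \<delta>: "0 < \<delta>" "\<delta> \<le> 1"
    using t by (auto simp: \<delta>_def)
  note rg = random_graph_config[of k t]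
  have B: "B \<in> sets clocks"
    using graph_eventD[OF \<Psi> rg] by (simp add: B_def)
  have pats: "finite pats" "card pats \<le> 4 ^ card E"
  proof -
    have sub: "pats \<subseteq> Pow E \<times> Pow E"
      by (auto simp: pats_def)
    then show "finite pats"
      using E(1) by (auto intro: finite_subset)
    have "card pats \<le> card (Pow E \<times> Pow E)"
      using sub E(1) by (intro card_mono) auto
    also have "\<dots> = 4 ^ card E"
      using E(1) by (simp add: card_cartesian_product card_Pow power_mult_distrib[symmetric])
    finally show "card pats \<le> 4 ^ card E" .
  qed
  have A: "A (P, Q) \<in> sets clocks" if "(P, Q) \<in> pats" for P Q
  proof -
    have "Q \<subseteq> lattice_edges"
      using that E(2) by (auto simp: pats_def)
    note rgQ = random_graph_patch[OF rg this, of E]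
    have "graph_event (\<lambda>H. \<forall>v. degree_in H v \<le> k)"
      by (intro graph_event_all graph_event_degree)
    note [measurable] = graph_eventD[OF \<Phi> rg] graph_eventD[OF \<Psi> rgQ] graph_eventD[OF this rgQ]
    have "config k t U \<inter> E = P \<longleftrightarrow> (\<forall>e\<in>E. e \<in> config k t U \<longleftrightarrow> e \<in> P)" for U
      using that by (auto simp: pats_def)
    moreover have "Measurable.pred clocks (\<lambda>U. \<forall>e\<in>E. e \<in> config k t U \<longleftrightarrow> e \<in> P)"
    proof (intro pred_intros_finite E(1))
      fix e show "Measurable.pred clocks (\<lambda>U. e \<in> config k t U \<longleftrightarrow> e \<in> P)"
        using random_graph_edge[OF rg, of e] by (cases "e \<in> P") simp_all
    qed
    ultimately have [measurable]: "Measurable.pred clocks (\<lambda>U. config k t U \<inter> E = P)"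
      by simp
    show ?thesis
      unfolding A_def prod.case by measurable
  qed
  have part: "clocks.prob (A (P, Q)) * \<delta> ^ card E \<le> clocks.prob B" if PQ: "(P, Q) \<in> pats" for P Q
  proof -
    \<comment> \<open>Edges open both before and after keep their clocks, because edges outside
      \<open>E\<close> compare their own clocks with them. All others in \<open>E\<close> are
      resampled, below or above \<open>t\<close> as \<open>Q\<close> prescribes.\<close>
    define R where "R = E - (P \<inter> Q)"
    define X where "X = (\<lambda>e. if e \<in> Q then {..t} else {t<..})"
    have R: "finite R" "R \<subseteq> lattice_edges"
      using E by (auto simp: R_def)
    have "clocks.prob (A (P, Q)) * \<delta> ^ card E \<le> clocks.prob (A (P, Q)) * \<delta> ^ card R"
      using \<delta> E(1) by (intro mult_left_mono power_decreasing card_mono) (auto simp: R_def)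
    also have "\<dots> = clocks.prob (A (P, Q)) * (\<Prod>e\<in>R. \<delta>)"
      by simp
    also have "\<dots> \<le> clocks.prob (A (P, Q)) * (\<Prod>e\<in>R. measure lborel (X e \<inter> {0..1}))"
    proof (intro mult_left_mono prod_mono conjI)
      fix e
      have "{..t} \<inter> {0..1} = {0..t}" "{t<..} \<inter> {0..1} = {t<..1}"
        using t by auto
      then show "\<delta> \<le> measure lborel (X e \<inter> {0..1})"
        using t by (auto simp: X_def \<delta>_def)
    qed (use \<delta> in auto)
    also have "\<dots> \<le> clocks.prob B"
    proof (rule resample_bound[OF A[OF PQ] B R])
      fix e show "X e \<in> sets borel"
        by (simp add: X_def)
    next
      fix U V
      assume U: "U \<in> A (P, Q)" and V: "V \<in> space clocks" "\<forall>e\<in>R. V e \<in> X e"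
        and reg: "regular U" "regular (resample R (U, V))"
      let ?H = "(config k t U - E) \<union> Q"
      let ?U = "resample R (U, V)"
      have P: "config k t U \<inter> E = P" and \<Psi>H: "\<Psi> ?H" and deg: "\<And>v. degree_in ?H v \<le> k"
        and Us: "U \<in> space clocks"
        using U by (auto simp: A_def)
      have Q: "Q \<subseteq> E" "Q - touch D = P - touch D"
        using PQ by (auto simp: pats_def)
      have res: "?U e = (if e \<in> R then V e else U e)" if "e \<in> lattice_edges" for e
        using that by (simp add: resample_def)
      have Hl: "?H \<subseteq> lattice_edges"
        using Q E(2) config_subset by blast
      have "config k t ?U = ?H"
      proof (rule config_surgery[where D = D and U = U])
        show "wf (earlier U)" "wf (earlier ?U)"
          using reg by (auto simp: regular_def)
        show "?H - touch D = config k t U - touch D"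
          using P Q E(3) by blast
      next
        fix e assume "e \<in> lattice_edges" "e \<notin> touch (\<Union> (touch D))"
        then show "?U e = U e"
          using res[of e] by (simp add: R_def E_def)
      next
        fix e assume e: "e \<in> ?H" "e \<in> config k t U"
        then have "e \<notin> R"
          using P by (auto simp: R_def)
        then show "?U e = U e"
          using res[of e] e Hl by auto
      next
        fix e assume e: "e \<in> ?H" "e \<notin> config k t U"
        then have eQ: "e \<in> Q" and eR: "e \<in> R"
          using P Q by (auto simp: R_def)
        then show "?U e \<le> t"
          using res[OF subsetD[OF R(2) eR]] bspec[OF V(2) eR] by (simp add: X_def)
      next
        fix e assume e: "e \<in> touch (\<Union> (touch D))" "e \<notin> ?H"
        then have eQ: "e \<notin> Q" and eR: "e \<in> R"
          by (auto simp: R_def E_def)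
        then show "t < ?U e"
          using res[OF subsetD[OF R(2) eR]] bspec[OF V(2) eR] by (simp add: X_def)
      qed (use k Hl deg in auto)
      moreover have "?U \<in> space clocks"
        by (rule measurable_space[OF measurable_resample]) (simp add: space_pair_measure Us V(1))
      ultimately show "?U \<in> B"
        using \<Psi>H by (simp add: B_def)
    qed
    finally show ?thesis .
  qed
  have "config_prob k t \<Phi> \<le> clocks.prob (\<Union>z\<in>pats. A z)"
    unfolding config_prob_def
  proof (rule clocks.finite_measure_mono_AE)
    show "AE U in clocks. U \<in> {U \<in> space clocks. \<Phi> (config k t U)} \<longrightarrow> U \<in> (\<Union>z\<in>pats. A z)"
      using AE_regular
    proof eventually_elim
      case (elim U)
      show ?case
      proof
        assume U: "U \<in> {U \<in> space clocks. \<Phi> (config k t U)}"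
        have deg: "degree_in (config k t U) v \<le> k" for v
          using degree_config elim by (auto simp: regular_def)
        then obtain H where H: "H \<subseteq> lattice_edges" "H - touch D = config k t U - touch D"
          "\<forall>v. degree_in H v \<le> k" "\<Psi> H"
          using surgery[OF config_subset[of k t U] deg] U by blast
        \<comment> \<open>Outside \<open>touch D\<close>, and so outside \<open>E\<close>, nothing
          has changed: the trace on \<open>E\<close> determines the new graph.\<close>
        have "(config k t U - E) \<union> (H \<inter> E) = H"
          using H(2) E(3) by blast
        moreover have "(config k t U \<inter> E, H \<inter> E) \<in> pats"
          using H(2) by (auto simp: pats_def)
        ultimately show "U \<in> (\<Union>z\<in>pats. A z)"
          using U H by (intro UN_I[of "(config k t U \<inter> E, H \<inter> E)"]) (auto simp: A_def)
      qed
    qed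
    show "(\<Union>z\<in>pats. A z) \<in> sets clocks"
      using pats(1) A by (intro sets.finite_UN) auto
  qed
  also have "\<dots> \<le> (\<Sum>z\<in>pats. clocks.prob (A z))"
    using pats(1) A by (intro clocks.finite_measure_subadditive_finite) auto
  finally have "config_prob k t \<Phi> * \<delta> ^ card E \<le> (\<Sum>z\<in>pats. clocks.prob (A z)) * \<delta> ^ card E"
    using \<delta> by (intro mult_right_mono) auto
  also have "\<dots> = (\<Sum>z\<in>pats. clocks.prob (A z) * \<delta> ^ card E)"
    by (rule sum_distrib_right)
  also have "\<dots> \<le> (\<Sum>z\<in>pats. clocks.prob B)"
    using part by (intro sum_mono) auto
  also have "\<dots> = card pats * clocks.prob B"
    by simp
  also have "\<dots> \<le> 4 ^ card E * clocks.prob B"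
  proof (intro mult_right_mono)
    have "real (card pats) \<le> real (4 ^ card E)"
      using pats(2) by (subst of_nat_le_iff)
    then show "real (card pats) \<le> 4 ^ card E"
      by simp
  qed simp
  finally show ?thesis
    by (simp add: power_divide field_simps E_def \<delta>_def B_def config_prob_def)
qed

text \<open>A preimage under the shift, hence \<open>H\<close> moved by \<open>- a\<close>; this
  orientation matches \<open>shift_clocks\<close>, which also evaluates at the shifted edge.\<close>

definition translate_graph :: "int ^ 'd \<Rightarrow> (int ^ 'd) set set \<Rightarrow> (int ^ 'd) set set" where
  "translate_graph a H = {e. (\<lambda>v. v + a) ` e \<in> H}"

lemma shift_clocks_eq: "shift_clocks a = (\<lambda>U. \<lambda>e\<in>lattice_edges. U ((\<lambda>v. v + a) ` e))"
  by (simp add: shift_clocks_def fun_eq_iff)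

lemma distr_shift:
  "distr clocks clocks (shift_clocks a) = (clocks :: ((int ^ 'd::finite) set \<Rightarrow> real) measure)"
proof -
  have "inj (\<lambda>v. v + a)"
    by (auto intro: injI)
  then have "inj ((`) (\<lambda>v. v + a))"
    by (intro injI) (simp add: inj_image_eq_iff)
  then have "inj_on ((`) (\<lambda>v. v + a)) (lattice_edges :: (int ^ 'd) set set)"
    by (rule inj_on_subset) simp
  moreover have "(`) (\<lambda>v. v + a) \<in> lattice_edges \<rightarrow> (lattice_edges :: (int ^ 'd) set set)"
    by simp
  ultimately have "distr (\<Pi>\<^sub>M e\<in>(lattice_edges :: (int ^ 'd) set set). restrict_space lborel {0..1::real})
      (\<Pi>\<^sub>M e\<in>lattice_edges. restrict_space lborel {0..1})
      (\<lambda>\<omega>. \<lambda>e\<in>lattice_edges. \<omega> ((\<lambda>v. v + a) ` e)) =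
      (\<Pi>\<^sub>M e\<in>lattice_edges. restrict_space lborel {0..1})"
    by (intro distr_PiM_reindex prob_space_unit)
  then show ?thesis
    by (simp add: clocks_def shift_clocks_eq)
qed

lemma measurable_shift: "shift_clocks a \<in> measurable clocks clocks"
proof -
  have "(\<lambda>U. \<lambda>e\<in>lattice_edges. U ((\<lambda>v. v + a) ` e)) \<in>
      measurable clocks (\<Pi>\<^sub>M e\<in>lattice_edges. restrict_space lborel {0..1})"
    unfolding clocks_def by (intro measurable_restrict measurable_component_singleton) simp
  then show ?thesis
    by (simp add: clocks_def shift_clocks_eq)
qed

lemma config_prob_translate:
  assumes "graph_event \<Psi>"
  shows "config_prob k t (\<lambda>H. \<Psi> (translate_graph a H)) = config_prob k t \<Psi>"
proof -
  have S: "{U \<in> space clocks. \<Psi> (config k t U)} \<in> sets clocks"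
    using graph_eventD[OF assms random_graph_config, of k t] by simp
  have "config k t (shift_clocks a U) = translate_graph a (config k t U)" for U
    by (auto simp: translate_graph_def config_shift)
  then have "shift_clocks a -` {U \<in> space clocks. \<Psi> (config k t U)} \<inter> space clocks
    = {U \<in> space clocks. \<Psi> (translate_graph a (config k t U))}"
    using measurable_space[OF measurable_shift, of _ a] by auto
  then show ?thesis
    using measure_distr[OF measurable_shift S, of a] by (simp add: config_prob_def distr_shift)
qed

section \<open>Translation invariance\<close>

lemma translate_graph_translate: "translate_graph a (translate_graph b H) = translate_graph (a + b) H"
  by (simp add: translate_graph_def image_image add.assoc)

lemma translate_graph_zero [simp]: "translate_graph 0 H = H"
  by (simp add: translate_graph_def)

lemma translate_graph_edge [simp]: "{x, y} \<in> translate_graph a H \<longleftrightarrow> {x + a, y + a} \<in> H"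
  by (simp add: translate_graph_def)

text \<open>The implication is assumed for all graphs and shifts, so applying it to the inverse
  shift yields the converse.\<close>

lemma translate_graph_transfer:
  assumes imp: "\<And>H a x. P (translate_graph a H) x \<Longrightarrow> P H (x + a)"
  shows "P (translate_graph a H) x \<longleftrightarrow> P H (x + a)"
proof
  assume "P H (x + a)"
  then have "P (translate_graph (- a) (translate_graph a H)) (x + a)"
    by (simp add: translate_graph_translate)
  from imp[OF this] show "P (translate_graph a H) x"
    by simp
qed (rule imp)

lemma connected_in_translate:
  "connected_in (translate_graph a H) x y \<longleftrightarrow> connected_in H (x + a) (y + a)"
proof -
  have imp: "connected_in H (x + a) (y + a)" if "connected_in (translate_graph a H) x y" for H a x y
    using that unfolding connected_in_def
  proof (induction rule: rtrancl_induct)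
    case (step y z)
    then show ?case
      by (intro rtrancl_into_rtrancl[OF step.IH]) simp
  qed simp
  show ?thesis
  proof
    assume "connected_in H (x + a) (y + a)"
    then have "connected_in (translate_graph (- a) (translate_graph a H)) (x + a) (y + a)"
      by (simp add: translate_graph_translate)
    from imp[OF this] show "connected_in (translate_graph a H) x y"
      by simp
  qed (rule imp)
qed

lemma infinite_cluster_translate:
  "infinite (cluster_in (translate_graph a H) x) \<longleftrightarrow> infinite (cluster_in H (x + a))"
proof -
  have "cluster_in H (x + a) = (\<lambda>y. y + a) ` cluster_in (translate_graph a H) x"
  proof (intro set_eqI iffI)
    fix y assume "y \<in> cluster_in H (x + a)"
    then have "y - a \<in> cluster_in (translate_graph a H) x"
      by (simp add: connected_in_translate)
    then show "y \<in> (\<lambda>y. y + a) ` cluster_in (translate_graph a H) x"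
      by (rule image_eqI[rotated]) simp
  qed (auto simp: connected_in_translate)
  moreover have "inj_on (\<lambda>y. y + a) (cluster_in (translate_graph a H) x)"
    by (auto intro: inj_onI)
  ultimately show ?thesis
    by (simp add: finite_image_iff)
qed

lemma avoid_translate: "avoid (translate_graph a H) {x} = translate_graph a (avoid H {x + a})"
  by (auto simp: avoid_def translate_graph_def)

lemma trifurcation_translate: "trifurcation (translate_graph a H) x \<longleftrightarrow> trifurcation H (x + a)"
proof (rule translate_graph_transfer)
  fix H :: "(int ^ 'a) set set" and a x
  assume "trifurcation (translate_graph a H) x"
  then obtain u v w where
    "{u + a, x + a} \<in> H \<and> {v + a, x + a} \<in> H \<and> {w + a, x + a} \<in> H \<and>
     infinite (cluster_in (avoid H {x + a}) (u + a)) \<and> infinite (cluster_in (avoid H {x + a}) (v + a)) \<and>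
     infinite (cluster_in (avoid H {x + a}) (w + a)) \<and> \<not> connected_in (avoid H {x + a}) (u + a) (v + a) \<and>
     \<not> connected_in (avoid H {x + a}) (u + a) (w + a) \<and> \<not> connected_in (avoid H {x + a}) (v + a) (w + a)"
    unfolding trifurcation_def avoid_translate translate_graph_edge infinite_cluster_translate
      connected_in_translate by (elim exE) (rule that)
  then show "trifurcation H (x + a)"
    unfolding trifurcation_def by (intro exI)
qed

lemma endpoint_translate: "endpoint (translate_graph a H) x \<longleftrightarrow> endpoint H (x + a)"
proof (rule translate_graph_transfer)
  fix H :: "(int ^ 'a) set set" and a x
  assume e: "endpoint (translate_graph a H) x"
  then obtain u where u: "\<And>y. {y + a, x + a} \<in> H \<Longrightarrow> y = u"
    unfolding endpoint_def by auto
  have "y = u + a" if "{y, x + a} \<in> H" for y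
    using u[of "y - a"] that by (simp add: algebra_simps)
  moreover have "infinite (cluster_in H (x + a))"
    using e by (simp add: endpoint_def infinite_cluster_translate)
  ultimately show "endpoint H (x + a)"
    unfolding endpoint_def by blast
qed

lemma config_event [measurable]:
  "graph_event \<Psi> \<Longrightarrow> Measurable.pred clocks (\<lambda>U. \<Psi> (config k t U))"
  by (rule graph_eventD[OF _ random_graph_config])

section \<open>Infinite clusters\<close>

text \<open>The boundary of a cube is negligible with respect to its volume.\<close>

lemma sparse_points_null:
  fixes \<Psi> :: "int ^ 'd::finite \<Rightarrow> (int ^ 'd) set set \<Rightarrow> bool"
  assumes ev: "\<And>v. graph_event (\<Psi> v)"
    and q: "\<And>v. config_prob k t (\<Psi> v) = q"
    and count: "\<And>U n. regular U \<Longrightarrow>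
      card {v \<in> cube n 0. \<Psi> v (config k t U)} \<le> card (cube (Suc n) (0 :: int ^ 'd) - cube n 0)"
  shows "q = 0"
proof -
  have "0 \<le> q"
    using q[of 0, symmetric] by (simp add: config_prob_def)
  let ?S = "\<lambda>v. {U \<in> space clocks. \<Psi> v (config k t U)}"
  have S: "?S v \<in> sets clocks" for v
    using config_event[OF ev[of v], of k t] by simp
  \<comment> \<open>The expected number of special points in the cube is its volume times
    \<open>q\<close> and is at most the size of the shell. The bound is the ratio of shell to cube,
    with side lengths \<open>2 * n + 3\<close> and \<open>2 * n + 1\<close>, and tends to 0.\<close>
  have bound: "q \<le> (1 + 2 / real (2 * n + 1)) ^ CARD('d) - 1" for n
  proof -
    let ?B = "cube n (0 :: int ^ 'd)" and ?B' = "cube (Suc n) (0 :: int ^ 'd)"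
    have "card ?B * q = (\<Sum>v\<in>?B. clocks.prob (?S v))"
      using q by (simp add: config_prob_def)
    also have "\<dots> = (\<Sum>v\<in>?B. clocks.expectation (indicator (?S v)))"
      using S by (simp add: sets.sets_into_space Int_absorb2)
    also have "\<dots> = clocks.expectation (\<lambda>U. \<Sum>v\<in>?B. indicator (?S v) U)"
      using S by (intro Bochner_Integration.integral_sum[symmetric] integrable_real_indicator)
        (auto simp: clocks.emeasure_eq_measure)
    also have "\<dots> \<le> (\<integral>U. real (card (?B' - ?B)) \<partial>(clocks :: ((int ^ 'd) set \<Rightarrow> real) measure))"
    proof (rule integral_mono_AE)
      show "AE U in clocks. (\<Sum>v\<in>?B. indicator (?S v) U) \<le> real (card (?B' - ?B))"
        using AE_regular
      proof eventually_elim
        case (elim U)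
        have "(\<Sum>v\<in>?B. indicator (?S v) U) \<le> (\<Sum>v\<in>?B. if \<Psi> v (config k t U) then 1 else 0 :: real)"
          by (intro sum_mono) (auto simp: indicator_def)
        also have "\<dots> = real (card {v \<in> ?B. \<Psi> v (config k t U)})"
          by (simp add: sum.If_cases Int_def conj_commute)
        also have "\<dots> \<le> real (card (?B' - ?B))"
          using count[OF elim, of n] by simp
        finally show ?case .
      qed
      show "integrable clocks (\<lambda>U. \<Sum>v\<in>?B. indicator (?S v) U :: real)"
        using S by (intro Bochner_Integration.integrable_sum integrable_real_indicator)
          (auto simp: clocks.emeasure_eq_measure)
    qed simp
    also have "\<dots> = real (card (?B' - ?B))"
      by (simp add: clocks.prob_space)
    also have "\<dots> = real (2 * n + 3) ^ CARD('d) - real (2 * n + 1) ^ CARD('d)"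
    proof -
      have "?B \<subseteq> ?B'"
        by (rule cube_mono) simp
      then have "real (card (?B' - ?B)) = real (card ?B') - real (card ?B)"
        using card_mono[of ?B' ?B] by (simp add: card_Diff_subset of_nat_diff)
      then show ?thesis
        by (simp add: card_cube algebra_simps)
    qed
    finally have "real (2 * n + 1) ^ CARD('d) * q \<le> real (2 * n + 3) ^ CARD('d) - real (2 * n + 1) ^ CARD('d)"
      by (simp add: card_cube)
    moreover have pos: "0 < real (2 * n + 1) ^ CARD('d)"
      by simp
    ultimately have "q \<le> (real (2 * n + 3) ^ CARD('d) - real (2 * n + 1) ^ CARD('d)) / real (2 * n + 1) ^ CARD('d)"
      by (simp add: pos_le_divide_eq mult.commute)
    also have "\<dots> = (real (2 * n + 3) / real (2 * n + 1)) ^ CARD('d) - 1"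
      using pos by (simp add: diff_divide_distrib power_divide)
    also have "real (2 * n + 3) / real (2 * n + 1) = 1 + 2 / real (2 * n + 1)"
      by (simp add: field_simps)
    finally show ?thesis .
  qed
  have "(\<lambda>n. 2 / real (2 * n + 1)) \<longlonglongrightarrow> 0"
    using LIMSEQ_subseq_LIMSEQ[OF lim_const_over_n[of "2 :: real"], of "\<lambda>n. 2 * n + 1"]
    by (simp add: strict_mono_def o_def)
  then have "(\<lambda>n. (1 + 2 / real (2 * n + 1)) ^ CARD('d) - 1) \<longlonglongrightarrow> (1 + 0) ^ CARD('d) - 1"
    by (intro tendsto_intros)
  then have "q \<le> (1 + 0) ^ CARD('d) - 1"
    by (rule LIMSEQ_le_const) (use bound in auto)
  with \<open>0 \<le> q\<close> show "q = 0"
    by simp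
qed

lemma config_prob_nonneg: "0 \<le> config_prob k t \<Psi>"
  by (simp add: config_prob_def)

lemma no_trifurcations:
  "config_prob k t (\<lambda>H. trifurcation H (x :: int ^ 'd::finite)) = 0"
proof (rule sparse_points_null[where \<Psi> = "\<lambda>v H. trifurcation H v"])
  fix v :: "int ^ 'd"
  have "config_prob k t (\<lambda>H. trifurcation H y) = config_prob k t (\<lambda>H. trifurcation H (0 :: int ^ 'd))" for y :: "int ^ 'd"
    using config_prob_translate[of "\<lambda>H. trifurcation H (0 :: int ^ 'd)" k t y]
    by (simp add: trifurcation_translate graph_event_trifurcation)
  then show "config_prob k t (\<lambda>H. trifurcation H v) = config_prob k t (\<lambda>H. trifurcation H x)"
    by metis
qed (rule graph_event_trifurcation card_trifurcations config_subset)+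

lemma no_endpoints:
  assumes "k \<le> 2"
  shows "config_prob k t (\<lambda>H. endpoint H (x :: int ^ 'd::finite)) = 0"
proof (rule sparse_points_null[where \<Psi> = "\<lambda>v H. endpoint H v"])
  fix v :: "int ^ 'd"
  have "config_prob k t (\<lambda>H. endpoint H y) = config_prob k t (\<lambda>H. endpoint H (0 :: int ^ 'd))" for y :: "int ^ 'd"
    using config_prob_translate[of "\<lambda>H. endpoint H (0 :: int ^ 'd)" k t y]
    by (simp add: endpoint_translate graph_event_endpoint)
  then show "config_prob k t (\<lambda>H. endpoint H v) = config_prob k t (\<lambda>H. endpoint H x)"
    by metis
next
  fix U :: "(int ^ 'd) set \<Rightarrow> real" and n assume "regular U"
  then have "degree_in (config k t U) v \<le> 2" for v
    using degree_config[of U k t v] assms by (simp add: regular_def)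
  then show "card {v \<in> cube n 0. endpoint (config k t U) v} \<le> card (cube (Suc n) (0 :: int ^ 'd) - cube n 0)"
    by (intro card_endpoints config_subset)
qed auto

text \<open>The surgery acts at the single vertex \<open>x\<close>; the bound on \<open>k\<close>
  enters through the scarcity of endpoints.\<close>

lemma no_infinite_clusters_le_2:
  assumes t: "0 < t" "t < 1" and k: "0 < k" "k \<le> 2"
  shows "config_prob k t (\<lambda>H. infinite (cluster_in H (x :: int ^ 'd::finite))) = 0"
proof -
  have "config_prob k t (\<lambda>H. infinite (cluster_in H x)) * (min t (1 - t) / 4) ^ card (touch (\<Union> (touch {x})))
    \<le> config_prob k t (\<lambda>H. endpoint H x)"
  proof (rule surgery_bound[OF t k(1)])
    fix G :: "(int ^ 'd) set set"
    assume "G \<subseteq> lattice_edges" "\<And>v. degree_in G v \<le> k" "infinite (cluster_in G x)"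
    then show "\<exists>H. H \<subseteq> lattice_edges \<and> H - touch {x} = G - touch {x} \<and> (\<forall>v. degree_in H v \<le> k) \<and> endpoint H x"
      using endpoint_surgery[of G k x] by metis
  qed auto
  then have "config_prob k t (\<lambda>H. infinite (cluster_in H x)) * (min t (1 - t) / 4) ^ card (touch (\<Union> (touch {x}))) \<le> 0"
    using no_endpoints[OF k(2), of t x] by simp
  moreover have "0 < (min t (1 - t) / 4) ^ card (touch (\<Union> (touch {x})))"
    using t by simp
  ultimately have "config_prob k t (\<lambda>H. infinite (cluster_in H x)) \<le> 0"
    by (meson mult_pos_pos not_le)
  then show ?thesis
    using config_prob_nonneg[of k t "\<lambda>H. infinite (cluster_in H x)"] by simp
qed

section \<open>At most two infinite clusters, and cubes that meet all of them\<close>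

definition separated :: "'a set set \<Rightarrow> 'a \<Rightarrow> 'a \<Rightarrow> 'a \<Rightarrow> bool" where
  "separated H a b c \<longleftrightarrow> infinite (cluster_in H a) \<and> infinite (cluster_in H b) \<and> infinite (cluster_in H c) \<and>
     \<not> connected_in H a b \<and> \<not> connected_in H a c \<and> \<not> connected_in H b c"

lemma graph_event_separated: "graph_event (\<lambda>H. separated H a b c)"
  unfolding separated_def
  by (intro graph_event_conj graph_event_not graph_event_infinite graph_event_connected)

lemma config_prob_eq_0D:
  assumes "graph_event \<Psi>" "config_prob k t \<Psi> = 0"
  shows "AE U in clocks. \<not> \<Psi> (config k t U)"
  using clocks.prob_Collect_eq_0[of "\<lambda>U. \<Psi> (config k t U)"] config_event[OF assms(1), of k t] assms(2)
  by (simp add: config_prob_def)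

lemma no_three_infinite_clusters:
  assumes t: "0 < t" "t < 1" and k: "3 \<le> k"
  shows "config_prob k t (\<lambda>H. separated H a b (c :: int ^ 'd::finite)) = 0"
proof -
  obtain n where "{a, b, c} \<subseteq> cube n 0"
    by (rule cube_exhausts[of "{a, b, c}" 0]) auto
  then have n: "a \<in> cube n 0" "b \<in> cube n 0" "c \<in> cube n 0"
    by auto
  define D where "D = cube n (0 :: int ^ 'd)"
  have "config_prob k t (\<lambda>H. separated H a b c) * (min t (1 - t) / 4) ^ card (touch (\<Union> (touch D)))
    \<le> config_prob k t (\<lambda>H. \<exists>x. x \<in> D \<and> trifurcation H x)"
  proof (rule surgery_bound[OF t])
    show "graph_event (\<lambda>H. separated H a b c)"
      by (rule graph_event_separated)
    show "graph_event (\<lambda>H. \<exists>x. x \<in> D \<and> trifurcation H x)"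
      by (intro graph_event_ex graph_event_conj graph_event_const graph_event_trifurcation)
    fix G :: "(int ^ 'd) set set"
    assume G: "G \<subseteq> lattice_edges" "\<And>v. degree_in G v \<le> k" "separated G a b c"
    have "finite D" "\<And>y z. y \<in> D \<Longrightarrow> z \<in> D \<Longrightarrow> connected_in {e \<in> lattice_edges. e \<subseteq> D} y z"
      using cube_connected by (auto simp: D_def)
    then obtain H x where "x \<in> D" "H \<subseteq> lattice_edges" "H - touch D = G - touch D"
      "\<And>v. degree_in H v \<le> k" "trifurcation H x"
      by (rule trifurcation_surgery[OF G(1,2) k, of D a b c])
        (use G(3) n in \<open>auto simp: separated_def D_def\<close>)
    then show "\<exists>H. H \<subseteq> lattice_edges \<and> H - touch D = G - touch D \<and> (\<forall>v. degree_in H v \<le> k) \<and>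
        (\<exists>x. x \<in> D \<and> trifurcation H x)"
      by blast
  qed (use k in \<open>auto simp: D_def\<close>)
  \<comment> \<open>The position of the trifurcation is not prescribed by the surgery; each position
    has probability zero and there are countably many.\<close>
  also have "config_prob k t (\<lambda>H. \<exists>x. x \<in> D \<and> trifurcation H x) = 0"
  proof -
    have "AE U in clocks. \<not> (\<exists>x. x \<in> D \<and> trifurcation (config k t U) x)"
      using AE_all_countable[THEN iffD2, OF allI, OF config_prob_eq_0D[OF graph_event_trifurcation no_trifurcations]]
      by (rule AE_mp) auto
    then show ?thesis
      unfolding config_prob_def
      by (subst clocks.prob_Collect_eq_0)
        (auto intro!: config_event[unfolded pred_def] graph_event_ex graph_event_conj simp: pred_def)
  qed
  finally have "config_prob k t (\<lambda>H. separated H a b c) * (min t (1 - t) / 4) ^ card (touch (\<Union> (touch D))) \<le> 0" .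
  moreover have "0 < (min t (1 - t) / 4) ^ card (touch (\<Union> (touch D)))"
    using t by simp
  ultimately have "config_prob k t (\<lambda>H. separated H a b c) \<le> 0"
    by (meson mult_pos_pos not_le)
  then show ?thesis
    using config_prob_nonneg[of k t "\<lambda>H. separated H a b c"] by simp
qed

text \<open>Vacuously true if there is no infinite cluster. Its failure is therefore a rare event
  for large cubes, whatever the probability that infinite clusters exist.\<close>

definition all_meet :: "(int ^ 'd) set set \<Rightarrow> (int ^ 'd) set \<Rightarrow> bool" where
  "all_meet H D \<longleftrightarrow> (\<forall>y. infinite (cluster_in H y) \<longrightarrow> (\<exists>z. z \<in> D \<and> connected_in H y z))"

lemma graph_event_all_meet: "graph_event (\<lambda>H. all_meet H D)"
  unfolding all_meet_def
  by (intro graph_event_all graph_event_imp graph_event_ex graph_event_conj graph_event_const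
      graph_event_infinite graph_event_connected)

lemma all_meet_translate: "all_meet (translate_graph a H) (cube n 0) \<longleftrightarrow> all_meet H (cube n (a :: int ^ 'd::finite))"
proof -
  have c: "z \<in> cube n 0 \<longleftrightarrow> z + a \<in> cube n a" for z :: "int ^ 'd"
    using cube_translate[of z a n 0] by simp
  have s: "(\<forall>y. P (y + a)) \<longleftrightarrow> (\<forall>y. P y)" "(\<exists>y. P (y + a)) \<longleftrightarrow> (\<exists>y. P y)" for P :: "int ^ 'd \<Rightarrow> bool"
    by (metis diff_add_cancel)+
  show ?thesis
    unfolding all_meet_def infinite_cluster_translate connected_in_translate c
    using s(1)[of "\<lambda>y. infinite (cluster_in H y) \<longrightarrow> (\<exists>z. z + a \<in> cube n a \<and> connected_in H y (z + a))"]
      s(2)[of "\<lambda>z. z \<in> cube n a \<and> connected_in H _ z"] by simp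
qed

text \<open>One representative of each infinite cluster, at most two points in all, is contained in
  some cube.\<close>

lemma few_clusters_all_meet:
  fixes H :: "(int ^ 'd::finite) set set"
  assumes "\<And>a b c. \<not> separated H a b c"
  obtains n where "all_meet H (cube n 0)"
proof -
  have "\<exists>S. finite S \<and> all_meet H S"
  proof (cases "\<exists>y. infinite (cluster_in H y)")
    case True
    then obtain a where a: "infinite (cluster_in H a)" by blast
    show ?thesis
    proof (cases "\<exists>y. infinite (cluster_in H y) \<and> \<not> connected_in H y a")
      case True
      then obtain b where b: "infinite (cluster_in H b)" "\<not> connected_in H b a" by blast
      have "connected_in H y a \<or> connected_in H y b" if "infinite (cluster_in H y)" for y
        using assms[of y b a] a b that connected_in_sym[of H] by (auto simp: separated_def)
      then have "all_meet H {a, b}"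
        by (auto simp: all_meet_def)
      then show ?thesis by (intro exI[of _ "{a, b}"]) simp
    next
      case False
      then have "all_meet H {a}"
        by (auto simp: all_meet_def)
      then show ?thesis by (intro exI[of _ "{a}"]) simp
    qed
  next
    case False
    then have "all_meet H {}"
      by (auto simp: all_meet_def)
    then show ?thesis by blast
  qed
  then obtain S where S: "finite S" "all_meet H S" by blast
  obtain n where "S \<subseteq> cube n 0"
    by (rule cube_exhausts[OF S(1)])
  with S(2) have "all_meet H (cube n 0)"
    unfolding all_meet_def by blast
  then show thesis
    by (rule that)
qed

lemma config_prob_mono:
  assumes "graph_event \<Psi>" "\<And>G. G \<subseteq> lattice_edges \<Longrightarrow> \<Phi> G \<Longrightarrow> \<Psi> G"
  shows "config_prob k t \<Phi> \<le> config_prob k t \<Psi>"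
  unfolding config_prob_def
proof (rule clocks.finite_measure_mono)
  show "{U \<in> space clocks. \<Psi> (config k t U)} \<in> sets clocks"
    using config_event[OF assms(1), of k t] by simp
qed (use assms(2) config_subset in blast)

text \<open>The failure events decrease in \<open>n\<close> and their intersection is null, so
  continuity from above applies at the origin. Translation invariance makes the same radius work for
  every centre.\<close>

lemma cubes_usually_meet:
  assumes t: "0 < t" "t < 1" and k: "3 \<le> k" and "0 < \<epsilon>"
  obtains n where "\<And>x :: int ^ 'd::finite. config_prob k t (\<lambda>H. \<not> all_meet H (cube n x)) < \<epsilon>"
proof -
  define A where "A = (\<lambda>n. {U \<in> space clocks. \<not> all_meet (config k t U) (cube n (0 :: int ^ 'd))})"
  have ev: "graph_event (\<lambda>H. \<not> all_meet H (cube n x))" for n and x :: "int ^ 'd"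
    by (intro graph_event_not graph_event_all_meet)
  have A: "A n \<in> sets clocks" for n
    using config_event[OF ev, of k t n 0] by (simp add: A_def)
  have "decseq A"
  proof (rule antimonoI)
    fix m n :: nat assume "m \<le> n"
    then have "cube m (0 :: int ^ 'd) \<subseteq> cube n 0"
      by (rule cube_mono)
    then show "A n \<le> A m"
      unfolding A_def all_meet_def by blast
  qed
  then have "(\<lambda>n. clocks.prob (A n)) \<longlonglongrightarrow> clocks.prob (\<Inter>n. A n)"
    using A by (intro clocks.finite_Lim_measure_decseq) auto
  moreover have "clocks.prob (\<Inter>n. A n) = 0"
  proof -
    have "AE U in clocks. \<forall>a b c. \<not> separated (config k t U) a b (c :: int ^ 'd)"
      by (intro AE_all_countable[THEN iffD2] allI
          config_prob_eq_0D[OF graph_event_separated no_three_infinite_clusters[OF t k]])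
    then have "AE U in clocks. U \<notin> (\<Inter>n. A n)"
    proof eventually_elim
      case (elim U)
      then obtain n where "all_meet (config k t U) (cube n 0)"
        using few_clusters_all_meet[of "config k t U"] by blast
      then show ?case
        by (auto simp: A_def)
    qed
    moreover have "(\<Inter>n. A n) \<in> sets clocks"
      using A by blast
    ultimately show ?thesis
      using clocks.prob_eq_0 by blast
  qed
  ultimately have "eventually (\<lambda>n. clocks.prob (A n) < \<epsilon>) sequentially"
    using \<open>0 < \<epsilon>\<close> by (auto intro: order_tendstoD(2))
  then obtain n where n: "clocks.prob (A n) < \<epsilon>"
    by (auto simp: eventually_sequentially)
  have "config_prob k t (\<lambda>H. \<not> all_meet H (cube n x)) = clocks.prob (A n)" for x :: "int ^ 'd"
    using config_prob_translate[OF ev[of n 0], of k t x]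
    by (simp add: all_meet_translate A_def config_prob_def)
  with n show thesis
    by (intro that[of n]) simp
qed

section \<open>The uniform lower bound\<close>

lemma graph_event_patch:
  assumes "graph_event \<Phi>" "Q \<subseteq> lattice_edges"
  shows "graph_event (\<lambda>H. \<Phi> (H \<union> Q))"
  unfolding graph_event_def
proof (intro allI impI)
  fix X :: "((int ^ 'a) set \<Rightarrow> real) \<Rightarrow> (int ^ 'a) set set"
  assume "random_graph X"
  from graph_eventD[OF assms(1) random_graph_patch[OF this assms(2), of "{}"]]
  show "Measurable.pred clocks (\<lambda>U. \<Phi> (X U \<union> Q))"
    by simp
qed

text \<open>Only a union bound is used: from \<open>p\<close> two failures of probability below
  \<open>p / 4\<close> are subtracted, which leaves \<open>p / 2\<close>. The set \<open>D\<close>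
  of the surgery is the union of two cubes and may be disconnected, since the link between them is
  an open path of \<open>G\<close>.\<close>

lemma config_prob_connected_ge:
  fixes x y :: "int ^ 'd::finite"
  assumes t: "0 < t" "t < 1" and k: "3 \<le> k"
    and p: "p \<le> config_prob k t (\<lambda>H. \<exists>z :: int ^ 'd. infinite (cluster_in H z))"
    and n: "\<And>x :: int ^ 'd. config_prob k t (\<lambda>H. \<not> all_meet H (cube n x)) < p / 4" and "0 < p"
  shows "p / 2 * (min t (1 - t) / 4) ^ (4 * (2 * n + 1) ^ CARD('d) * 3 ^ CARD('d) * 3 ^ CARD('d))
    \<le> config_prob k t (\<lambda>H. connected_in H x y)"
proof -
  define D where "D = cube n x \<union> cube n y"
  define Q where "Q = {e \<in> lattice_edges. e \<subseteq> D}"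
  define \<delta> where "\<delta> = min t (1 - t) / 4"
  have \<delta>: "0 < \<delta>" "\<delta> \<le> 1"
    using t by (auto simp: \<delta>_def)
  have Q: "Q \<subseteq> lattice_edges"
    by (auto simp: Q_def)
  have evC: "graph_event (\<lambda>H. connected_in (H \<union> Q) x y)"
    by (rule graph_event_patch[OF graph_event_connected Q])
  have evI: "graph_event (\<lambda>H. \<exists>z :: int ^ 'd. infinite (cluster_in H z))"
    by (intro graph_event_ex graph_event_infinite)
  have evN: "graph_event (\<lambda>H. \<not> all_meet H (cube n z))" for z :: "int ^ 'd"
    by (intro graph_event_not graph_event_all_meet)
  \<comment> \<open>The cluster of \<open>z\<close> meets the cubes in \<open>u\<close> and
    \<open>v\<close>. The route from \<open>x\<close> to \<open>u\<close> and from \<open>v\<close>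
    to \<open>y\<close> uses arbitrary edges of the cubes, the middle part uses open ones.\<close>
  have meet: "connected_in (G \<union> Q) x y"
    if G: "infinite (cluster_in G z)" "all_meet G (cube n x)" "all_meet G (cube n y)" for G z
  proof -
    obtain u v where uv: "u \<in> cube n x" "connected_in G z u" "v \<in> cube n y" "connected_in G z v"
      using G unfolding all_meet_def by blast
    have Qc: "connected_in (G \<union> Q) a b" if "a \<in> cube n w" "b \<in> cube n w" "w \<in> {x, y}" for a b w
      by (rule connected_in_mono[OF cube_connected[OF that(1,2)]]) (use that(3) in \<open>auto simp: Q_def D_def\<close>)
    have "connected_in (G \<union> Q) u v"
      using connected_in_trans[OF connected_in_sym[OF uv(2)] uv(4)] by (rule connected_in_mono) simp
    then show ?thesis
      using Qc[of x x u] Qc[of v y y] uv(1,3) connected_in_trans[of "G \<union> Q" x u v]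
        connected_in_trans[of "G \<union> Q" x v y] by simp
  qed
  have "config_prob k t (\<lambda>H. \<exists>z :: int ^ 'd. infinite (cluster_in H z))
    \<le> clocks.prob ({U \<in> space clocks. connected_in (config k t U \<union> Q) x y} \<union>
        ({U \<in> space clocks. \<not> all_meet (config k t U) (cube n x)} \<union>
         {U \<in> space clocks. \<not> all_meet (config k t U) (cube n y)}))"
    unfolding config_prob_def
    using config_event[OF evC, of k t] config_event[OF evN, of k t x] config_event[OF evN, of k t y] meet
    by (intro clocks.finite_measure_mono) auto
  also have "\<dots> \<le> config_prob k t (\<lambda>H. connected_in (H \<union> Q) x y) +
      clocks.prob ({U \<in> space clocks. \<not> all_meet (config k t U) (cube n x)} \<union>
         {U \<in> space clocks. \<not> all_meet (config k t U) (cube n y)})"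
    unfolding config_prob_def
    using config_event[OF evC, of k t] config_event[OF evN, of k t x] config_event[OF evN, of k t y]
    by (intro measure_Un_le) auto
  also have "\<dots> \<le> config_prob k t (\<lambda>H. connected_in (H \<union> Q) x y) +
      (config_prob k t (\<lambda>H. \<not> all_meet H (cube n x)) + config_prob k t (\<lambda>H. \<not> all_meet H (cube n y)))"
    unfolding config_prob_def
    using config_event[OF evN, of k t x] config_event[OF evN, of k t y]
    by (intro add_left_mono measure_Un_le) auto
  finally have half: "p / 2 \<le> config_prob k t (\<lambda>H. connected_in (H \<union> Q) x y)"
    using p n[of x] n[of y] by simp
  have finD: "finite D"
    by (simp add: D_def)
  \<comment> \<open>The exponent: two cubes, a factor \<open>3 ^ CARD('d)\<close> for the edges at
    \<open>D\<close>, 2 for their ends, and again \<open>3 ^ CARD('d)\<close> for the edges at these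
    ends.\<close>
  have "card D \<le> 2 * (2 * n + 1) ^ CARD('d)"
    unfolding D_def by (rule order_trans[OF card_Un_le]) (simp add: card_cube)
  then have "card (touch D) \<le> 2 * (2 * n + 1) ^ CARD('d) * 3 ^ CARD('d)"
    using card_touch[OF finD] by (meson mult_le_mono1 order_trans)
  then have "card (\<Union> (touch D)) \<le> 4 * (2 * n + 1) ^ CARD('d) * 3 ^ CARD('d)"
    using card_Union_touch[OF finD] by simp
  then have E: "card (touch (\<Union> (touch D))) \<le> 4 * (2 * n + 1) ^ CARD('d) * 3 ^ CARD('d) * 3 ^ CARD('d)"
    using card_touch[OF finite_Union_touch[OF finD]] by (meson mult_le_mono1 order_trans)
  have "p / 2 * \<delta> ^ (4 * (2 * n + 1) ^ CARD('d) * 3 ^ CARD('d) * 3 ^ CARD('d))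
    \<le> p / 2 * \<delta> ^ card (touch (\<Union> (touch D)))"
    using \<delta> E \<open>0 < p\<close> by (intro mult_left_mono power_decreasing) auto
  also have "\<dots> \<le> config_prob k t (\<lambda>H. connected_in (H \<union> Q) x y) * \<delta> ^ card (touch (\<Union> (touch D)))"
    using \<delta> half by (intro mult_right_mono) auto
  also have "\<dots> \<le> config_prob k t (\<lambda>H. connected_in H x y)"
    unfolding \<delta>_def
  proof (rule surgery_bound[OF t _ finD evC graph_event_connected])
    fix G :: "(int ^ 'd) set set"
    assume G: "G \<subseteq> lattice_edges" "\<And>v. degree_in G v \<le> k" "connected_in (G \<union> Q) x y"
    obtain H where "H \<subseteq> lattice_edges" "H - touch D = G - touch D" "\<And>v. degree_in H v \<le> k"
      "connected_in H x y"
      by (rule connecting_surgery[OF G(1,2) _ G(3)[unfolded Q_def]]) (use k in auto)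
    then show "\<exists>H. H \<subseteq> lattice_edges \<and> H - touch D = G - touch D \<and> (\<forall>v. degree_in H v \<le> k) \<and> connected_in H x y"
      by blast
  qed (use k in simp)
  finally show ?thesis
    by (simp add: \<delta>_def)
qed

section \<open>From the recursion back to the model\<close>

lemma measure_clock_law_eq:
  fixes \<Psi> :: "(int ^ 'd::finite) set set \<Rightarrow> bool"
  assumes "graph_event \<Psi>" "0 < k"
  shows "measure clock_law {U \<in> space clock_law. \<Psi> (cdp_open k U t)} = config_prob k t \<Psi>"
proof -
  have law: "clock_law = completion (clocks :: ((int ^ 'd) set \<Rightarrow> real) measure)"
    by (simp add: clock_law_def clocks_def)
  let ?S = "{U \<in> space clocks. \<Psi> (config k t U)}"
  let ?S' = "{U \<in> space (completion clocks). \<Psi> (cdp_open k U t)}"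
  have S: "?S \<in> sets clocks"
    using config_event[OF assms(1), of k t] by simp
  then have Sc: "?S \<in> sets (completion clocks)"
    by (rule sets_completionI_sets)
  \<comment> \<open>For regular clocks the definite description is the recursively defined
    configuration. The two sets differ by a null set only, so the second is measurable for the
    completed law.\<close>
  have "AE U in clocks. U \<in> ?S \<longleftrightarrow> U \<in> ?S'"
    using AE_regular
  proof eventually_elim
    case (elim U)
    then show ?case
      using cdp_open_eq_config[OF _ assms(2), of U] by (simp add: regular_def)
  qed
  then have ae: "AE U in completion clocks. U \<in> ?S \<longleftrightarrow> U \<in> ?S'"
    by (rule AE_completion)
  moreover have S': "?S' \<in> sets (completion clocks)"
    by (rule completion.in_sets_AE[OF ae Sc]) auto
  ultimately have "measure (completion clocks) ?S' = measure (completion clocks) ?S"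
    by (intro measure_eq_AE) (use Sc in auto)
  also have "\<dots> = config_prob k t \<Psi>"
    using S by (simp add: config_prob_def measure_completion)
  finally show ?thesis
    by (simp add: law)
qed

text \<open>Excludes time 0, where the cost \<open>min t (1 - t)\<close> of the surgery degenerates:
  almost surely no clock is at most 0, so no edge is open.\<close>

lemma config_prob_zero_time:
  assumes "t \<le> 0"
  shows "config_prob k t (\<lambda>H. infinite (cluster_in H (x :: int ^ 'd::finite))) = 0"
proof -
  have "AE U in clocks. \<not> U e \<le> 0" if e: "e \<in> lattice_edges" for e :: "(int ^ 'd) set"
  proof -
    have "clocks.prob {U \<in> space clocks. \<forall>f\<in>{e}. U f \<in> {..0}} = (\<Prod>f\<in>{e}. measure lborel ({..0} \<inter> {0..1::real}))"
      by (rule prob_cylinder) (use e in auto)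
    moreover have "{..0} \<inter> {0..1::real} = {0}"
      by auto
    ultimately have "clocks.prob {U \<in> space clocks. U e \<le> 0} = 0"
      by simp
    moreover have "{U \<in> space clocks. U e \<le> 0} \<in> sets clocks"
      using e by measurable
    ultimately show ?thesis
      using clocks.prob_Collect_eq_0[of "\<lambda>U. U e \<le> 0"] by simp
  qed
  then have "AE U in clocks. \<forall>e\<in>lattice_edges. \<not> U (e :: (int ^ 'd) set) \<le> 0"
    by (intro AE_ball_countable' countable_lattice_edges)
  then have "AE U in clocks. \<not> infinite (cluster_in (config k t U) x)"
  proof eventually_elim
    case (elim U)
    then have "config k t U = {}"
      using config_subset[of k t U] assms by (fastforce simp: config_def)
    then have "cluster_in (config k t U) x = {x}"
      by (auto simp: cluster_in_def connected_in_def)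
    then show ?case by simp
  qed
  moreover have "{U \<in> space clocks. infinite (cluster_in (config k t U) x)} \<in> sets clocks"
    using config_event[OF graph_event_infinite, of k t x] by simp
  ultimately show ?thesis
    using clocks.prob_Collect_eq_0[of "\<lambda>U. infinite (cluster_in (config k t U) x)"]
    by (simp add: config_prob_def)
qed

theorem theorem2:
  fixes k :: nat and t :: real
  assumes "0 < k" and "k \<le> 2 * CARD('d::finite)"
    and "0 \<le> t" and "t < 1"
    and "cdp_theta TYPE('d) k t > 0"
  shows "(INF (x, y)\<in>UNIV. cdp_tau k t (x :: int ^ 'd) y) > 0"
proof -
  define p where "p = config_prob k t (\<lambda>H. infinite (cluster_in H (0 :: int ^ 'd)))"
  have "cdp_theta TYPE('d) k t = p"
    unfolding cdp_theta_def p_def using assms(1) by (intro measure_clock_law_eq graph_event_infinite)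
  with assms(5) have p: "0 < p" by simp
  have t: "0 < t"
    using p config_prob_zero_time[of t k "0 :: int ^ 'd"] unfolding p_def by (cases "0 < t") auto
  have k: "3 \<le> k"
    using p no_infinite_clusters_le_2[OF t assms(4,1), of "0 :: int ^ 'd"]
    unfolding p_def by (cases "k \<le> 2") auto
  obtain n where n: "\<And>x :: int ^ 'd. config_prob k t (\<lambda>H. \<not> all_meet H (cube n x)) < p / 4"
    using cubes_usually_meet[OF t assms(4) k, of "p / 4"] p by auto
  have "p \<le> config_prob k t (\<lambda>H. \<exists>z :: int ^ 'd. infinite (cluster_in H z))"
    unfolding p_def by (intro config_prob_mono graph_event_ex graph_event_infinite) auto
  note bound = config_prob_connected_ge[OF t assms(4) k this n p]
  \<comment> \<open>The radius \<open>n\<close> was chosen for all centres at once, so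
    \<open>c\<close> involves neither \<open>x\<close> nor \<open>y\<close>.\<close>
  define c where "c = p / 2 * (min t (1 - t) / 4) ^ (4 * (2 * n + 1) ^ CARD('d) * 3 ^ CARD('d) * 3 ^ CARD('d))"
  have "0 < c"
    using p t assms(4) by (simp add: c_def)
  have "c \<le> cdp_tau k t x y" for x y :: "int ^ 'd"
  proof -
    have "cdp_tau k t x y = config_prob k t (\<lambda>H. connected_in H x y)"
      unfolding cdp_tau_def using assms(1) by (intro measure_clock_law_eq graph_event_connected)
    then show ?thesis
      using bound[of x y] by (simp add: c_def)
  qed
  then have "c \<le> (INF (x, y)\<in>UNIV. cdp_tau k t (x :: int ^ 'd) y)"
    by (intro cINF_greatest) auto
  with \<open>0 < c\<close> show ?thesis by simp
qed

end
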